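(* Let $r, d$ be integers with $2 \leq r \leq d-2$ and $\gcd(r,d)=1$. Let $p$ be an odd prime such that either $p\equiv \pm1 \pmod d$, or $p\equiv \pm r \pmod d$ with $r^2 \equiv \pm1 \pmod d$. Let $s(p) := \Gamma_p\!\left(\tfrac{1}{d}\right) \Gamma_p\!\left(\tfrac{r}{d}\right)\Gamma_p\!\left(\tfrac{d-r}{d}\right)\Gamma_p\!\left(\tfrac{d-1}{d}\right)$. Then \[ {}_{4}G\left(\tfrac{1}{d} , \tfrac{r}{d}, 1-\tfrac{r}{d} , 1-\tfrac{1}{d}\right)_p \equiv {}_{4}F_3\left[ \begin{array}{cccc} \frac{1}{d}, & \frac{r}{d}, & 1-\frac{r}{d}, & 1-\frac{1}{d}\\ & 1, & 1, & 1 \end{array} \Big| \; 1 \right]_{p-1} + s(p)\, p \pmod {p^3}. \]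
   Context: $\Gamma_p$ is Morita's $p$-adic gamma function. For real $x$, $\lfloor x\rfloor$ is the floor and $\langle x\rangle:=x-\lfloor x\rfloor$. For an odd prime $p$, $n\in\mathbb{Z}^+$ and $\frac{m_i}{d_i}\in\mathbb{Q}\cap\mathbb{Z}_p$ with $0<\frac{m_i}{d_i}<1$, define ${}_{n+1}G\left(\tfrac{m_1}{d_1},\dots,\tfrac{m_{n+1}}{d_{n+1}}\right)_p:=\frac{-1}{p-1}\sum_{j=0}^{p-2}\left((-1)^j\Gamma_p(\tfrac{j}{p-1})\right)^{n+1}\prod_{i=1}^{n+1}\frac{\Gamma_p(\langle \frac{m_i}{d_i}-\frac{j}{p-1}\rangle)}{\Gamma_p(\frac{m_i}{d_i})}(-p)^{-\lfloor \frac{m_i}{d_i}-\frac{j}{p-1}\rfloor}$. Rising factorial: $(a)_0:=1$, $(a)_k:=a(a+1)\cdots(a+k-1)$. Truncated hypergeometric series: ${}_rF_s\left[\begin{array}{ccc}a_1,&\dots,&a_r\\ &b_1,\dots,&b_s\end{array}\Big|\,z\right]_m:=\sum_{k=0}^{m}\frac{(a_1)_k\cdots(a_r)_k}{(b_1)_k\cdots(b_s)_k}\frac{z^k}{k!}$. Congruences are in $\mathbb{Z}_p$. *)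

theory Defs
  imports "HOL-Number_Theory.Number_Theory" "HOL-Algebra.Divisibility"
begin

hide_const (open) Divisibility.prime

text \<open>
  The ring of \<open>p\<close>-adic integers as the inverse limit of the rings of integers modulo \<open>p ^ n\<close>:
  \<open>x n\<close> is the residue of \<open>x\<close> modulo \<open>p ^ n\<close>. The case \<open>m = n\<close> of the compatibility condition
  says that \<open>x n\<close> is a reduced residue in \<open>{0..<p ^ n}\<close>.
\<close>

definition padic_int :: "nat \<Rightarrow> (nat \<Rightarrow> int) ring" where
  "padic_int p =
     \<lparr>carrier = {x. \<forall>m n. n \<le> m \<longrightarrow> x m mod int p ^ n = x n},
      mult = (\<lambda>x y n. (x n * y n) mod int p ^ n),
      one = (\<lambda>n. 1 mod int p ^ n),
      zero = (\<lambda>n. 0),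
      add = (\<lambda>x y n. (x n + y n) mod int p ^ n)\<rparr>"

definition padic_of_int :: "nat \<Rightarrow> int \<Rightarrow> (nat \<Rightarrow> int)" where
  "padic_of_int p k = (\<lambda>n. k mod int p ^ n)"

lemma padic_of_int_closed: "padic_of_int p k \<in> carrier (padic_int p)"
  by (auto simp: padic_int_def padic_of_int_def mod_mod_cancel le_imp_power_dvd)

lemma padic_int_cring: "cring (padic_int p)"
proof (rule cringI)
  have mm: "a mod int p ^ m mod int p ^ n = a mod int p ^ n" if "n \<le> m" for a m n
    using that by (simp add: mod_mod_cancel le_imp_power_dvd)
  show "abelian_group (padic_int p)"
  proof (rule abelian_groupI)
    fix x y assume "x \<in> carrier (padic_int p)" "y \<in> carrier (padic_int p)"
    then show "x \<oplus>\<^bsub>padic_int p\<^esub> y \<in> carrier (padic_int p)"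
      by (auto simp: padic_int_def mm) (metis mod_add_eq)
  next
    fix x assume x: "x \<in> carrier (padic_int p)"
    show "\<exists>y\<in>carrier (padic_int p). y \<oplus>\<^bsub>padic_int p\<^esub> x = \<zero>\<^bsub>padic_int p\<^esub>"
    proof (rule bexI)
      show "(\<lambda>n. - x n mod int p ^ n) \<in> carrier (padic_int p)"
        using x by (auto simp: padic_int_def mm) (metis mod_minus_eq)
    qed (simp add: padic_int_def mod_simps)
  qed (auto simp: padic_int_def mod_simps algebra_simps)
  show "comm_monoid (padic_int p)"
  proof (rule comm_monoidI)
    fix x y assume "x \<in> carrier (padic_int p)" "y \<in> carrier (padic_int p)"
    then show "x \<otimes>\<^bsub>padic_int p\<^esub> y \<in> carrier (padic_int p)"
      by (auto simp: padic_int_def mm) (metis mod_mult_eq)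
  qed (auto simp: padic_int_def mod_simps algebra_simps mm)
qed (auto simp: padic_int_def mod_simps algebra_simps)

text \<open>
  The embedding into the \<open>p\<close>-adic integers of the rationals whose reduced denominator is prime
  to \<open>p\<close>. On other rationals the inverse does not exist and the value is meaningless.
\<close>

definition padic_of_rat :: "nat \<Rightarrow> rat \<Rightarrow> (nat \<Rightarrow> int)" where
  "padic_of_rat p q =
     padic_of_int p (fst (quotient_of q)) \<otimes>\<^bsub>padic_int p\<^esub>
       inv\<^bsub>padic_int p\<^esub> padic_of_int p (snd (quotient_of q))"

definition padic_cong :: "nat \<Rightarrow> nat \<Rightarrow> (nat \<Rightarrow> int) \<Rightarrow> (nat \<Rightarrow> int) \<Rightarrow> bool" where
  "padic_cong p k x y \<longleftrightarrow>
     padic_of_int p (int p ^ k) divides\<^bsub>padic_int p\<^esub> (x \<ominus>\<^bsub>padic_int p\<^esub> y)"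

text \<open>
  Morita's \<open>p\<close>-adic gamma function for odd \<open>p\<close>: first its values at positive integers, then its
  value at a \<open>p\<close>-adic integer \<open>x\<close> as the limit of the values at positive integers \<open>n\<close>
  tending \<open>p\<close>-adically to \<open>x\<close>.
\<close>

definition padic_gamma_nat :: "nat \<Rightarrow> nat \<Rightarrow> int" where
  "padic_gamma_nat p n = (-1) ^ n * (\<Prod>j\<in>{j. 0 < j \<and> j < n \<and> \<not> p dvd j}. int j)"

definition padic_gamma :: "nat \<Rightarrow> (nat \<Rightarrow> int) \<Rightarrow> (nat \<Rightarrow> int)" where
  "padic_gamma p x =
     (THE y. y \<in> carrier (padic_int p) \<and>
        (\<forall>k. \<exists>l. \<forall>n>0. padic_cong p l (padic_of_int p (int n)) x \<longrightarrow>
           padic_cong p k (padic_of_int p (padic_gamma_nat p n)) y))"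

text \<open>
  The function \<open>G\<close> with its parameters in the list \<open>as\<close>, for rational parameters strictly between
  0 and 1 that are \<open>p\<close>-adic integers. For these the exponents of \<open>-p\<close> are 0 or 1, all
  inverses are inverses of units, and the value is a \<open>p\<close>-adic integer.
\<close>

definition padic_G :: "nat \<Rightarrow> rat list \<Rightarrow> (nat \<Rightarrow> int)" where
  "padic_G p as =
     (let R = padic_int p;
          \<Gamma> = (\<lambda>q. padic_gamma p (padic_of_rat p q));
          t = (\<lambda>j::nat. of_nat j / (of_nat p - 1) :: rat)
      in padic_of_rat p (- 1 / (of_nat p - 1)) \<otimes>\<^bsub>R\<^esub>
         (\<Oplus>\<^bsub>R\<^esub>j\<in>{0..p - 2}.
            (padic_of_int p ((-1) ^ j) \<otimes>\<^bsub>R\<^esub> \<Gamma> (t j)) [^]\<^bsub>R\<^esub> length as \<otimes>\<^bsub>R\<^esub>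
            (\<Otimes>\<^bsub>R\<^esub>i\<in>{..<length as}.
               \<Gamma> (frac (as ! i - t j)) \<otimes>\<^bsub>R\<^esub> inv\<^bsub>R\<^esub> \<Gamma> (as ! i) \<otimes>\<^bsub>R\<^esub>
               padic_of_int p (- int p) [^]\<^bsub>R\<^esub> (- \<lfloor>as ! i - t j\<rfloor>))))"

definition hypergeom_trunc :: "'a::field_char_0 list \<Rightarrow> 'a list \<Rightarrow> 'a \<Rightarrow> nat \<Rightarrow> 'a" where
  "hypergeom_trunc as bs z m =
     (\<Sum>k=0..m. (\<Prod>a\<leftarrow>as. pochhammer a k) / (\<Prod>b\<leftarrow>bs. pochhammer b k) * (z ^ k / fact k))"

end

(*
  Write u = 1 / (1 - p), so that j / (p - 1) = - j u. For p >= 5 Wolstenholme's congruence makes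
  Gamma_p multiplicative on p Z_p modulo p^3, hence all values of Gamma_p in the j-th term of G cancel
  and this term is congruent to the hypergeometric term T(j), a rational function of j, continued
  p-adically from j to j u; that the factors p match uses that the Dwork primes of the four parameters
  are a permutation of them. Thus G - F is congruent to the sum over j of u T(j u) - T(j).

  Modulo p^3, T(j + x) with p | x is (up to a factor 1 + c p^2 that does not depend on x and cancels)
  P(j + x) / w_j(x)^2, where P(y) = s * (product of the Pochhammer symbols (a - y)_m over the parameters
  a, with m the residue of - a), s = 1 or - 1 and congruent to s(p), and w_j(x) is the product of the
  numbers i - j - x for i < p different from j. Lagrange interpolation of P, of degree 2 p - 2, at
  the 2 p - 1 nodes j and j u evaluates the sum of the differences exactly: it is p u^p times the
  leading coefficient s of P, and u^p is 1 modulo p^2.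

  For p = 3 only d = 5, 8, 10 are possible, and these are computed.
*)
theory Submission
  imports Defs "HOL-Computational_Algebra.Polynomial"
begin

section \<open>Rational numbers that are \<open>p\<close>-adic integers\<close>

text \<open>All comparisons modulo \<open>p ^ 3\<close> take place among rationals with denominator
  prime to \<open>p\<close>, where field division and polynomials are available; \<open>rep\<close>
  is the bridge to the p-adic ring.

  No termwise comparison can work: the differences u T(j u) - T(j) are divisible by p, but not all
  of them by p^2, since their sum is s(p) p modulo p^3 and s(p) is a unit. Hence the exact
  interpolation. It yields a leading coefficient because the residues of - a and of a - 1 add up to
  p - 1, so that the degree 2 p - 2 is one less than the number of nodes (0 is a common node). The
  factor p is the one in j u - j = p j u.

  Interpolation produces w_j at two different nodes instead of a square. The two values differ by a
  factor 1 + O(p^2), and this does no harm because the numerators u P(j u) and P(j) agree modulo p.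

  G stops at j = p - 2, but F at j = p - 1. The missing node is j u = - 1, and the continued term
  has to vanish there modulo p^3. This requires a count of factors p in each class of p modulo
  d.\<close>

definition zloc :: "nat \<Rightarrow> rat set" where
  "zloc p = {of_int a / of_int b | a b. coprime b (int p)}"

definition zunit :: "nat \<Rightarrow> rat set" where
  "zunit p = {x. x \<noteq> 0 \<and> x \<in> zloc p \<and> inverse x \<in> zloc p}"

definition qcong :: "nat \<Rightarrow> nat \<Rightarrow> rat \<Rightarrow> rat \<Rightarrow> bool" where
  "qcong p k x y \<longleftrightarrow> (\<exists>z\<in>zloc p. x - y = of_nat p ^ k * z)"

locale odd_prime =
  fixes p :: nat
  assumes p_prime: "prime p" and p_odd: "odd p"
begin

lemma p_ge_3: "p \<ge> 3"
  using p_prime p_odd prime_ge_2_nat[of p] by (cases "p = 2") auto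

lemma p_pos: "p > 0"
  using p_ge_3 by simp

lemma coprime_p_iff: "coprime b (int p) \<longleftrightarrow> \<not> int p dvd b"
proof -
  have "prime (int p)"
    using p_prime by simp
  then show ?thesis
    by (metis coprime_absorb_right coprime_commute not_prime_unit prime_imp_coprime)
qed

lemma zlocE:
  assumes "x \<in> zloc p"
  obtains a b where "x = of_int a / of_int b" "coprime b (int p)" "b \<noteq> 0"
  using assms p_prime by (auto simp: zloc_def coprime_p_iff)

lemma zlocI: "coprime b (int p) \<Longrightarrow> of_int a / of_int b \<in> zloc p"
  by (auto simp: zloc_def)

lemma zloc_of_int [simp, intro]: "of_int k \<in> zloc p"
  using zlocI[of 1 k] by simp

lemma zloc_of_nat [simp, intro]: "of_nat k \<in> zloc p"
  using zloc_of_int[of "int k"] by simp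

lemma zloc_0 [simp, intro]: "0 \<in> zloc p"
  and zloc_1 [simp, intro]: "1 \<in> zloc p"
  and zloc_numeral [simp, intro]: "numeral w \<in> zloc p"
  using zloc_of_int[of 0] zloc_of_int[of 1] zloc_of_int[of "numeral w"] by simp_all

lemma zloc_add [intro]:
  assumes "x \<in> zloc p" "y \<in> zloc p"
  shows "x + y \<in> zloc p"
proof -
  from assms obtain a b c e where "x = of_int a / of_int b" "coprime b (int p)" "b \<noteq> 0"
    "y = of_int c / of_int e" "coprime e (int p)" "e \<noteq> 0"
    by (metis zlocE)
  moreover from this have "x + y = of_int (a * e + c * b) / of_int (b * e)"
    by (simp add: field_simps)
  ultimately show ?thesis
    using zlocI[of "b * e" "a * e + c * b"] by (metis coprime_mult_left_iff)
qed

lemma zloc_mult [intro]: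
  assumes "x \<in> zloc p" "y \<in> zloc p"
  shows "x * y \<in> zloc p"
proof -
  from assms obtain a b c e where "x = of_int a / of_int b" "coprime b (int p)" "b \<noteq> 0"
    "y = of_int c / of_int e" "coprime e (int p)" "e \<noteq> 0"
    by (metis zlocE)
  moreover from this have "x * y = of_int (a * c) / of_int (b * e)"
    by (simp add: field_simps)
  ultimately show ?thesis
    using zlocI[of "b * e" "a * c"] by (metis coprime_mult_left_iff)
qed

lemma zloc_uminus [intro]: "x \<in> zloc p \<Longrightarrow> - x \<in> zloc p"
  using zloc_mult[of "- 1" x] zloc_of_int[of "- 1"] by simp

lemma zloc_diff [intro]: "x \<in> zloc p \<Longrightarrow> y \<in> zloc p \<Longrightarrow> x - y \<in> zloc p"
  using zloc_add[of x "- y"] zloc_uminus[of y] by simp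

lemma zloc_power [intro]: "x \<in> zloc p \<Longrightarrow> x ^ n \<in> zloc p"
  by (induction n) auto

lemma zloc_sum [intro]: "(\<And>i. i \<in> A \<Longrightarrow> f i \<in> zloc p) \<Longrightarrow> sum f A \<in> zloc p"
  by (induction A rule: infinite_finite_induct) auto

lemma zloc_prod [intro]: "(\<And>i. i \<in> A \<Longrightarrow> f i \<in> zloc p) \<Longrightarrow> prod f A \<in> zloc p"
  by (induction A rule: infinite_finite_induct) auto

lemma zloc_pochhammer [intro]: "x \<in> zloc p \<Longrightarrow> pochhammer x n \<in> zloc p"
  unfolding pochhammer_prod by (intro zloc_prod zloc_add) auto

lemma not_zloc_of_p_mult_zunit: "of_nat p * x \<in> zunit p \<Longrightarrow> x \<notin> zloc p"
proof
  assume "of_nat p * x \<in> zunit p" "x \<in> zloc p"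
  then have "x * inverse (of_nat p * x) \<in> zloc p" "x \<noteq> 0"
    by (auto simp: zunit_def)
  then have "inverse (of_nat p) \<in> zloc p"
    by (simp add: field_simps)
  then obtain a b where "inverse (of_nat p) = of_int a / (of_int b :: rat)" "coprime b (int p)" "b \<noteq> 0"
    by (metis zlocE)
  then have "of_int b = (of_int (a * int p) :: rat)"
    using p_pos by (simp add: field_simps)
  then have "b = a * int p"
    by linarith
  with \<open>coprime b (int p)\<close> show False
    by (simp add: coprime_p_iff)
qed

lemma zunit_mult [intro]: "x \<in> zunit p \<Longrightarrow> y \<in> zunit p \<Longrightarrow> x * y \<in> zunit p"
  by (simp add: zunit_def zloc_mult)

lemma zunit_inverse [intro]: "x \<in> zunit p \<Longrightarrow> inverse x \<in> zunit p"
  by (simp add: zunit_def)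

lemma zunit_divide [intro]: "x \<in> zunit p \<Longrightarrow> y \<in> zunit p \<Longrightarrow> x / y \<in> zunit p"
  by (simp add: divide_inverse zunit_mult zunit_inverse)

lemma zloc_divide [intro]: "x \<in> zloc p \<Longrightarrow> y \<in> zunit p \<Longrightarrow> x / y \<in> zloc p"
  by (simp add: zunit_def divide_inverse zloc_mult)

lemma zunit_imp_zloc [intro]: "x \<in> zunit p \<Longrightarrow> x \<in> zloc p"
  by (simp add: zunit_def)

lemma zunit_nz: "x \<in> zunit p \<Longrightarrow> x \<noteq> 0"
  by (simp add: zunit_def)

lemma zunit_1 [simp, intro]: "1 \<in> zunit p"
  by (simp add: zunit_def)

lemma zunit_uminus [intro]: "x \<in> zunit p \<Longrightarrow> - x \<in> zunit p"
  by (simp add: zunit_def zloc_uminus)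

lemma zunit_power [intro]: "x \<in> zunit p \<Longrightarrow> x ^ n \<in> zunit p"
  by (induction n) auto

lemma zunit_prod [intro]: "(\<And>i. i \<in> A \<Longrightarrow> f i \<in> zunit p) \<Longrightarrow> prod f A \<in> zunit p"
  by (induction A rule: infinite_finite_induct) auto

lemma zunit_of_int: "\<not> int p dvd k \<Longrightarrow> of_int k \<in> zunit p"
  using zlocI[of k 1] by (auto simp: zunit_def coprime_p_iff field_simps)

lemma zunit_of_int_iff: "of_int k \<in> zunit p \<longleftrightarrow> \<not> int p dvd k"
proof
  assume u: "of_int k \<in> zunit p"
  show "\<not> int p dvd k"
  proof
    assume "int p dvd k"
    then obtain l where "k = int p * l" ..
    with u not_zloc_of_p_mult_zunit[of "of_int l"] show False
      by simp
  qed
qed (rule zunit_of_int)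

lemma qcongI: "z \<in> zloc p \<Longrightarrow> x - y = of_nat p ^ k * z \<Longrightarrow> qcong p k x y"
  by (auto simp: qcong_def)

lemma qcong_refl [simp, intro]: "qcong p k x x"
  by (auto simp: qcong_def)

lemma qcong_sym: "qcong p k x y \<Longrightarrow> qcong p k y x"
proof -
  assume "qcong p k x y"
  then obtain z where "z \<in> zloc p" "x - y = of_nat p ^ k * z"
    by (auto simp: qcong_def)
  then show ?thesis
    by (intro qcongI[of "- z"]) (auto simp: algebra_simps)
qed

lemma qcong_trans [trans]: "qcong p k x y \<Longrightarrow> qcong p k y z \<Longrightarrow> qcong p k x z"
proof -
  assume "qcong p k x y" "qcong p k y z"
  then obtain v w where "v \<in> zloc p" "x - y = of_nat p ^ k * v" "w \<in> zloc p" "y - z = of_nat p ^ k * w"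
    by (auto simp: qcong_def)
  then show ?thesis
    by (intro qcongI[of "v + w"]) (auto simp: algebra_simps)
qed

lemma qcong_add: "qcong p k x y \<Longrightarrow> qcong p k x' y' \<Longrightarrow> qcong p k (x + x') (y + y')"
proof -
  assume "qcong p k x y" "qcong p k x' y'"
  then obtain v w where "v \<in> zloc p" "x - y = of_nat p ^ k * v" "w \<in> zloc p" "x' - y' = of_nat p ^ k * w"
    by (auto simp: qcong_def)
  then show ?thesis
    by (intro qcongI[of "v + w"]) (auto simp: algebra_simps)
qed

lemma qcong_lmult: "qcong p k x y \<Longrightarrow> c \<in> zloc p \<Longrightarrow> qcong p k (c * x) (c * y)"
proof -
  assume "qcong p k x y" "c \<in> zloc p"
  then obtain v where "v \<in> zloc p" "x - y = of_nat p ^ k * v"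
    by (auto simp: qcong_def)
  with \<open>c \<in> zloc p\<close> show ?thesis
    by (intro qcongI[of "c * v"]) (auto simp flip: right_diff_distrib)
qed

lemma qcong_rmult: "qcong p k x y \<Longrightarrow> c \<in> zloc p \<Longrightarrow> qcong p k (x * c) (y * c)"
  using qcong_lmult[of k x y c] by (simp add: mult.commute)

lemma qcong_uminus: "qcong p k x y \<Longrightarrow> qcong p k (- x) (- y)"
  using qcong_lmult[of k x y "- 1"] by auto

lemma qcong_diff: "qcong p k x y \<Longrightarrow> qcong p k x' y' \<Longrightarrow> qcong p k (x - x') (y - y')"
  using qcong_add[of k x y "- x'" "- y'"] qcong_uminus[of k x' y'] by simp

lemma qcong_mult:
  "qcong p k x y \<Longrightarrow> qcong p k x' y' \<Longrightarrow> y \<in> zloc p \<Longrightarrow> x' \<in> zloc p \<Longrightarrow> qcong p k (x * x') (y * y')"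
  by (meson qcong_lmult qcong_rmult qcong_trans)

lemma qcong_sum: "(\<And>i. i \<in> A \<Longrightarrow> qcong p k (f i) (g i)) \<Longrightarrow> qcong p k (sum f A) (sum g A)"
  by (induction A rule: infinite_finite_induct) (auto intro: qcong_add)

lemma qcong_prod:
  "(\<And>i. i \<in> A \<Longrightarrow> qcong p k (f i) (g i)) \<Longrightarrow> (\<And>i. i \<in> A \<Longrightarrow> f i \<in> zloc p) \<Longrightarrow>
   (\<And>i. i \<in> A \<Longrightarrow> g i \<in> zloc p) \<Longrightarrow> qcong p k (prod f A) (prod g A)"
  by (induction A rule: infinite_finite_induct) (auto intro!: qcong_mult)

lemma qcong_zloc: "qcong p k x y \<Longrightarrow> y \<in> zloc p \<Longrightarrow> x \<in> zloc p"
proof -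
  assume "qcong p k x y" "y \<in> zloc p"
  then obtain v where "v \<in> zloc p" "x = of_nat p ^ k * v + y"
    by (auto simp: qcong_def algebra_simps)
  with \<open>y \<in> zloc p\<close> show ?thesis
    by auto
qed

lemma qcong_power:
  "qcong p k x y \<Longrightarrow> y \<in> zloc p \<Longrightarrow> qcong p k (x ^ n) (y ^ n)"
  by (induction n) (auto intro!: qcong_mult intro: qcong_zloc)

lemma qcong_mono: "qcong p k x y \<Longrightarrow> l \<le> k \<Longrightarrow> qcong p l x y"
proof -
  assume "qcong p k x y" "l \<le> k"
  then obtain v where "v \<in> zloc p" "x - y = of_nat p ^ k * v"
    by (auto simp: qcong_def)
  with \<open>l \<le> k\<close> show ?thesis
    by (intro qcongI[of "of_nat p ^ (k - l) * v"]) (auto simp flip: power_add mult.assoc)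
qed

lemma qcong_of_int: "[a = b] (mod int p ^ k) \<Longrightarrow> qcong p k (of_int a) (of_int b)"
proof -
  assume "[a = b] (mod int p ^ k)"
  then obtain c where "a - b = int p ^ k * c"
    by (auto simp: cong_iff_dvd_diff)
  then have "of_int a - of_int b = (of_int (int p ^ k * c) :: rat)"
    by (metis of_int_diff)
  then show ?thesis
    by (intro qcongI[of "of_int c"]) auto
qed

lemma qcong_of_int_iff: "qcong p k (of_int a) (of_int b) \<longleftrightarrow> [a = b] (mod int p ^ k)"
proof
  assume "qcong p k (of_int a) (of_int b)"
  then obtain z where z: "z \<in> zloc p" "of_int a - of_int b = of_nat p ^ k * z"
    by (auto simp: qcong_def)
  then obtain c e where ce: "z = of_int c / of_int e" "coprime e (int p)" "e \<noteq> 0"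
    by (metis zlocE)
  then have "(of_int ((a - b) * e) :: rat) = of_int (int p ^ k * c)"
    using z by (simp add: field_simps)
  then have "(a - b) * e = int p ^ k * c"
    by linarith
  then have "int p ^ k dvd (a - b) * e"
    by simp
  then have "int p ^ k dvd a - b"
    using ce(2) by (simp add: coprime_commute coprime_dvd_mult_left_iff)
  then show "[a = b] (mod int p ^ k)"
    by (simp add: cong_iff_dvd_diff)
qed (rule qcong_of_int)

text \<open>The localization is a local ring with maximal ideal generated by \<open>p\<close>; the
  numerator of a fraction decides.\<close>

lemma zunit_cases:
  assumes "x \<in> zloc p"
  obtains "x \<in> zunit p" | z where "z \<in> zloc p" "x = of_nat p * z"
proof -
  from assms obtain a b where ab: "x = of_int a / of_int b" "coprime b (int p)" "b \<noteq> 0"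
    by (metis zlocE)
  then have b: "of_int b \<in> zunit p"
    using coprime_p_iff zunit_of_int by blast
  show ?thesis
  proof (cases "int p dvd a")
    case False
    then show ?thesis
      using that(1) ab(1) b zunit_of_int[of a] by auto
  next
    case True
    then obtain l where "a = int p * l" ..
    then show ?thesis
      using that(2)[of "of_int l / of_int b"] b ab(1) by auto
  qed
qed

lemma not_zunit_p_mult: "z \<in> zloc p \<Longrightarrow> of_nat p * z \<notin> zunit p"
  using not_zloc_of_p_mult_zunit by blast

lemma zunit_qcong:
  assumes "qcong p k x y" "k > 0" "y \<in> zunit p"
  shows "x \<in> zunit p"
proof (rule ccontr)
  assume n: "x \<notin> zunit p"
  from assms obtain v where v: "v \<in> zloc p" "x - y = of_nat p ^ k * v"
    by (auto simp: qcong_def)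
  have "x \<in> zloc p"
    using assms qcong_zloc by blast
  with n obtain z where z: "z \<in> zloc p" "x = of_nat p * z"
    by (meson zunit_cases)
  have "y = of_nat p * (z - of_nat p ^ (k - 1) * v)"
    using v z assms(2) by (cases k) (auto simp: algebra_simps)
  moreover have "z - of_nat p ^ (k - 1) * v \<in> zloc p"
    using v z by auto
  ultimately show False
    using not_zunit_p_mult assms(3) by metis
qed

lemma qcong_inverse:
  assumes "qcong p k x y" "x \<in> zunit p" "y \<in> zunit p"
  shows "qcong p k (inverse x) (inverse y)"
proof -
  have "qcong p k (x * (inverse x * inverse y)) (y * (inverse x * inverse y))"
    using assms by (auto intro!: qcong_rmult)
  then show ?thesis
    using assms(2,3)[THEN zunit_nz]
    by (subst qcong_sym) (simp_all add: field_simps)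
qed

lemma qcong_divide:
  assumes "qcong p k x x'" "qcong p k y y'" "x' \<in> zloc p" "y \<in> zunit p" "y' \<in> zunit p"
  shows "qcong p k (x / y) (x' / y')"
  unfolding divide_inverse using assms
  by (intro qcong_mult qcong_inverse) (auto simp: zunit_def)

lemma qcong_cancel:
  assumes "qcong p k (c * x) (c * y)" "c \<in> zunit p"
  shows "qcong p k x y"
  using qcong_lmult[OF assms(1), of "inverse c"] assms(2) by (simp add: zunit_def flip: mult.assoc)

lemma qcong_0_iff: "qcong p k x 0 \<longleftrightarrow> (\<exists>z\<in>zloc p. x = of_nat p ^ k * z)"
  by (simp add: qcong_def)

lemma qcong_scale_power:
  assumes "qcong p k x y" 
  shows "qcong p (k + l) (of_nat p ^ l * x) (of_nat p ^ l * y)"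
  using assms by (auto simp: qcong_def power_add algebra_simps)

text \<open>Positive integers are dense in the localization, which lets statements about
  \<open>padic_gamma_nat\<close> pass to fractions.\<close>

lemma qcong_ex_nat:
  assumes "x \<in> zloc p"
  shows "\<exists>n::nat. n > 0 \<and> qcong p k x (of_nat n)"
proof -
  from assms obtain a b where ab: "x = of_int a / of_int b" "coprime b (int p)" "b \<noteq> 0"
    by (metis zlocE)
  have "coprime b (int p ^ k)"
    using ab(2) by simp
  then obtain c where c: "[b * c = 1] (mod int p ^ k)"
    using cong_solve_coprime_int by blast
  \<comment> \<open>The summand \<open>p ^ k\<close> keeps the class and makes \<open>n\<close>
    positive, as the limit in \<open>padic_gamma\<close> runs over positive integers.\<close>
  define n where "n = nat ((a * c) mod int p ^ k) + p ^ k"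
  have pk: "(0::int) < int p ^ k"
    using p_pos by simp
  have "int n = (a * c) mod int p ^ k + int p ^ k"
    using pk by (simp add: n_def)
  then have "[int n = a * c] (mod int p ^ k)"
    by (simp add: cong_def)
  then have "[b * int n = b * (a * c)] (mod int p ^ k)"
    by (rule cong_scalar_left)
  also have "b * (a * c) = a * (b * c)"
    by simp
  also have "[a * (b * c) = a * 1] (mod int p ^ k)"
    using c by (rule cong_scalar_left)
  finally have "qcong p k (of_int (b * int n)) (of_int a)"
    by (intro qcong_of_int) simp
  moreover have bu: "of_int b \<in> zunit p"
    using ab coprime_p_iff zunit_of_int by blast
  ultimately have "qcong p k (of_int b * of_nat n) (of_int b * x)"
    using ab(1,3) by simp
  then have "qcong p k (of_nat n) x"
    using bu qcong_cancel by blast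
  moreover have "n > 0"
    using p_pos by (simp add: n_def)
  ultimately show ?thesis
    using qcong_sym by blast
qed

section \<open>The ring of \<open>p\<close>-adic integers and the gamma function\<close>

abbreviation (input) R where "R \<equiv> padic_int p"

lemma padic_cring: "cring R"
  by (rule padic_int_cring)

lemma padic_carrier_iff: "X \<in> carrier R \<longleftrightarrow> (\<forall>m n. n \<le> m \<longrightarrow> X m mod int p ^ n = X n)"
  by (simp add: padic_int_def)

lemma padic_mod: "X \<in> carrier R \<Longrightarrow> n \<le> m \<Longrightarrow> X m mod int p ^ n = X n"
  by (simp add: padic_carrier_iff)

lemma padic_cong_level: "X \<in> carrier R \<Longrightarrow> n \<le> m \<Longrightarrow> [X m = X n] (mod int p ^ n)"
  by (metis padic_mod cong_def mod_mod_trivial)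

lemma padic_add: "(X \<oplus>\<^bsub>R\<^esub> Y) n = (X n + Y n) mod int p ^ n"
  by (simp add: padic_int_def)

lemma padic_mult: "(X \<otimes>\<^bsub>R\<^esub> Y) n = (X n * Y n) mod int p ^ n"
  by (simp add: padic_int_def)

lemma padic_one: "\<one>\<^bsub>R\<^esub> n = 1 mod int p ^ n"
  by (simp add: padic_int_def)

lemma padic_minus:
  assumes "X \<in> carrier R" "Y \<in> carrier R"
  shows "(X \<ominus>\<^bsub>R\<^esub> Y) n = (X n - Y n) mod int p ^ n"
proof -
  interpret cring R by (rule padic_cring)
  \<comment> \<open>The additive inverse of the ring is not given by a formula, so the difference is
    found from the equation Z + Y = X, read at level \<open>n\<close>.\<close>
  define Z where "Z = X \<ominus>\<^bsub>R\<^esub> Y"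
  have Z: "Z \<in> carrier R" "Z \<oplus>\<^bsub>R\<^esub> Y = X"
    using assms by (auto simp: Z_def a_minus_def a_assoc l_neg)
  then have "X n = (Z n + Y n) mod int p ^ n"
    using padic_add by metis
  then have "(X n - Y n) mod int p ^ n = Z n mod int p ^ n"
    by (metis add_diff_cancel_right' mod_diff_left_eq)
  also have "\<dots> = Z n"
    using Z padic_mod by blast
  finally show ?thesis
    by (simp add: Z_def)
qed

text \<open>Divisibility by \<open>p ^ k\<close> in the inverse limit amounts to a vanishing
  component at level \<open>k\<close>: the quotient is read off from the components \<open>k\<close>
  levels higher.\<close>

lemma padic_cong_iff:
  assumes X: "X \<in> carrier R" and Y: "Y \<in> carrier R"
  shows "padic_cong p k X Y \<longleftrightarrow> X k = Y k"
proof
  assume "padic_cong p k X Y"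
  then obtain c where "X \<ominus>\<^bsub>R\<^esub> Y = padic_of_int p (int p ^ k) \<otimes>\<^bsub>R\<^esub> c"
    by (auto simp: padic_cong_def factor_def)
  then have "(X \<ominus>\<^bsub>R\<^esub> Y) k = 0"
    by (simp add: padic_mult padic_of_int_def)
  then have "X k mod int p ^ k = Y k mod int p ^ k"
    using assms by (simp add: padic_minus mod_eq_dvd_iff dvd_eq_mod_eq_0)
  then show "X k = Y k"
    using X Y padic_mod[of X k k] padic_mod[of Y k k] by simp
next
  assume eq: "X k = Y k"
  interpret cring R by (rule padic_cring)
  define D where "D = X \<ominus>\<^bsub>R\<^esub> Y"
  have D: "D \<in> carrier R"
    using X Y by (simp add: D_def)
  have Dk: "D k = 0"
    using X Y eq by (simp add: D_def padic_minus)
  have dv: "int p ^ k dvd D (n + k)" for n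
    using padic_mod[OF D, of k "n + k"] Dk by (simp add: dvd_eq_mod_eq_0)
  define c where "c = (\<lambda>n. D (n + k) div int p ^ k)"
  have Dc: "D (n + k) = int p ^ k * c n" for n
    using dv[of n] by (simp add: c_def)
  have pk: "int p ^ k > 0"
    using p_pos by simp
  have "c m mod int p ^ n = c n" if "n \<le> m" for m n
  proof -
    have "int p ^ k * (c m mod int p ^ n) = (int p ^ k * c m) mod int p ^ (n + k)"
      by (simp add: power_add mult.commute flip: mult_mod_left mult_mod_right)
    also have "\<dots> = int p ^ k * c n"
      using padic_mod[OF D, of "n + k" "m + k"] that by (simp flip: Dc)
    finally show ?thesis
      using p_pos by simp
  qed
  then have "c \<in> carrier R"
    by (simp add: padic_carrier_iff)
  moreover have "D = padic_of_int p (int p ^ k) \<otimes>\<^bsub>R\<^esub> c"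
  proof
    fix n
    have "D n = D (n + k) mod int p ^ n"
      using padic_mod[OF D, of n "n + k"] by simp
    also have "\<dots> = (int p ^ k * c n) mod int p ^ n"
      by (simp add: Dc)
    finally show "D n = (padic_of_int p (int p ^ k) \<otimes>\<^bsub>R\<^esub> c) n"
      by (simp add: padic_mult padic_of_int_def mod_mult_left_eq)
  qed
  ultimately show "padic_cong p k X Y"
    by (auto simp: padic_cong_def factor_def D_def)
qed

text \<open>A sequence with nonzero residue modulo \<open>p\<close> can be inverted at every level;
  the inverses are compatible because an inverse modulo \<open>p ^ n\<close> is unique.\<close>

lemma padic_unit:
  assumes X: "X \<in> carrier R" and "\<not> int p dvd X 1"
  shows "X \<in> Units R"
proof -
  interpret cring R by (rule padic_cring)
  have cop: "coprime (X n) (int p ^ n)" for n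
  proof (cases n)
    case (Suc l)
    then have "X n mod int p = X 1"
      using padic_mod[OF X, of 1 n] by simp
    then have "\<not> int p dvd X n"
      using assms(2) by (metis dvd_mod_iff dvd_refl)
    then show ?thesis
      by (simp add: coprime_p_iff)
  qed simp
  have "\<exists>z. [X n * z = 1] (mod int p ^ n)" for n
    using cong_solve_coprime_int cop by blast
  then obtain z where z: "[X n * z n = 1] (mod int p ^ n)" for n
    by metis
  define Y where "Y = (\<lambda>n. z n mod int p ^ n)"
  have XY: "[X n * Y n = 1] (mod int p ^ n)" for n
    using z[of n] by (simp add: Y_def cong_def mod_mult_right_eq)
  have "Y m mod int p ^ n = Y n" if "n \<le> m" for m n
  proof -
    have "[X m * Y m = 1] (mod int p ^ n)"
      using XY[of m] that cong_dvd_modulus le_imp_power_dvd by blast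
    then have "[X n * Y m = 1] (mod int p ^ n)"
      by (metis padic_cong_level[OF X that] cong_scalar_right cong_sym cong_trans)
    then have "[X n * Y m = X n * Y n] (mod int p ^ n)"
      using XY[of n] by (metis cong_sym cong_trans)
    then have "[Y m = Y n] (mod int p ^ n)"
      using cop[of n] by (simp add: cong_mult_lcancel)
    then show ?thesis
      by (simp add: cong_def Y_def)
  qed
  then have Y: "Y \<in> carrier R"
    by (simp add: padic_carrier_iff)
  have "X \<otimes>\<^bsub>R\<^esub> Y = \<one>\<^bsub>R\<^esub>"
    using XY by (auto simp: padic_mult padic_one cong_def)
  then show ?thesis
    using X Y m_comm unfolding Units_def by fastforce
qed

text \<open>\<open>X\<close> need not be the image of \<open>q\<close>, only agree with it modulo
  \<open>p ^ 3\<close>. Thus a gamma value, which need not be rational, can be represented by an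
  integer, and ring expressions are transferred operation by operation.\<close>

definition rep :: "(nat \<Rightarrow> int) \<Rightarrow> rat \<Rightarrow> bool" where
  "rep X q \<longleftrightarrow> X \<in> carrier R \<and> q \<in> zloc p \<and> qcong p 3 (of_int (X 3)) q"

lemma rep_carrier: "rep X q \<Longrightarrow> X \<in> carrier R"
  by (simp add: rep_def)

lemma qcong_of_int_mod: "qcong p k (of_int (a mod int p ^ k)) (of_int a)"
  by (rule qcong_of_int) (simp add: cong_def)

lemma rep_add:
  assumes "rep X q" "rep Y r"
  shows "rep (X \<oplus>\<^bsub>R\<^esub> Y) (q + r)"
proof -
  interpret cring R by (rule padic_cring)
  have "qcong p 3 (of_int ((X \<oplus>\<^bsub>R\<^esub> Y) 3)) (of_int (X 3 + Y 3))"
    unfolding padic_add by (rule qcong_of_int_mod)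
  also have "qcong p 3 (of_int (X 3 + Y 3)) (q + r)"
    using assms by (simp add: rep_def qcong_add)
  finally show ?thesis
    using assms by (auto simp: rep_def)
qed

lemma rep_mult:
  assumes "rep X q" "rep Y r"
  shows "rep (X \<otimes>\<^bsub>R\<^esub> Y) (q * r)"
proof -
  interpret cring R by (rule padic_cring)
  have "qcong p 3 (of_int ((X \<otimes>\<^bsub>R\<^esub> Y) 3)) (of_int (X 3 * Y 3))"
    unfolding padic_mult by (rule qcong_of_int_mod)
  also have "qcong p 3 (of_int (X 3 * Y 3)) (q * r)"
    using assms by (simp add: rep_def qcong_mult)
  finally show ?thesis
    using assms by (auto simp: rep_def)
qed

lemma rep_of_int: "rep (padic_of_int p k) (of_int k)"
  unfolding rep_def using padic_of_int_closed qcong_of_int_mod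
  by (auto simp: padic_of_int_def)

lemma rep_one: "rep \<one>\<^bsub>R\<^esub> 1"
proof -
  have "\<one>\<^bsub>R\<^esub> = padic_of_int p 1"
    by (simp add: padic_int_def padic_of_int_def)
  then show ?thesis
    using rep_of_int[of 1] by simp
qed

lemma rep_zero: "rep \<zero>\<^bsub>R\<^esub> 0"
proof -
  have "\<zero>\<^bsub>R\<^esub> = padic_of_int p 0"
    by (simp add: padic_int_def padic_of_int_def)
  then show ?thesis
    using rep_of_int[of 0] by simp
qed

lemma rep_power: "rep X q \<Longrightarrow> rep (X [^]\<^bsub>R\<^esub> (n::nat)) (q ^ n)"
proof (induction n)
  case 0
  then show ?case
    using rep_one by simp
next
  case (Suc n)
  then show ?case
    using rep_mult[of "X [^]\<^bsub>R\<^esub> n" "q ^ n" X q] by (simp add: mult.commute)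
qed

lemma rep_inv:
  assumes "rep X q" "q \<in> zunit p"
  shows "rep (inv\<^bsub>R\<^esub> X) (inverse q)"
proof -
  interpret cring R by (rule padic_cring)
  have X: "X \<in> carrier R" and q: "qcong p 3 (of_int (X 3)) q"
    using assms by (auto simp: rep_def)
  have u3: "of_int (X 3) \<in> zunit p"
    using q assms(2) zunit_qcong by fastforce
  then have "\<not> int p dvd X 3"
    using zunit_of_int_iff by blast
  then have "\<not> int p dvd X 1"
    using padic_mod[OF X, of 1 3] by (metis dvd_mod_iff dvd_refl one_le_numeral power_one_right)
  then have U: "X \<in> Units R"
    using X padic_unit by blast
  then have Y: "inv\<^bsub>R\<^esub> X \<in> carrier R" and "X \<otimes>\<^bsub>R\<^esub> inv\<^bsub>R\<^esub> X = \<one>\<^bsub>R\<^esub>"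
    by auto
  then have "[X 3 * (inv\<^bsub>R\<^esub> X) 3 = 1] (mod int p ^ 3)"
    using padic_mult padic_one by (metis cong_def)
  then have "qcong p 3 (of_int (X 3) * of_int ((inv\<^bsub>R\<^esub> X) 3)) (of_int (X 3) * inverse (of_int (X 3)))"
    using qcong_of_int u3[THEN zunit_nz] by fastforce
  then have "qcong p 3 (of_int ((inv\<^bsub>R\<^esub> X) 3)) (inverse (of_int (X 3)))"
    using u3 qcong_cancel by blast
  also have "qcong p 3 (inverse (of_int (X 3))) (inverse q)"
    using q u3 assms(2) qcong_inverse by blast
  finally show ?thesis
    using Y assms(2) by (auto simp: rep_def)
qed

lemma rep_finsum:
  assumes "finite A" "\<And>i. i \<in> A \<Longrightarrow> rep (f i) (g i)"
  shows "rep (\<Oplus>\<^bsub>R\<^esub>i\<in>A. f i) (sum g A)"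
  using assms
proof (induction A rule: finite_induct)
  case empty
  interpret cring R by (rule padic_cring)
  show ?case
    by (simp add: rep_zero)
next
  case (insert x F)
  interpret cring R by (rule padic_cring)
  have "f \<in> F \<rightarrow> carrier R" "f x \<in> carrier R"
    using insert.prems rep_carrier by auto
  then show ?case
    using insert rep_add by simp
qed

lemma rep_finprod:
  assumes "finite A" "\<And>i. i \<in> A \<Longrightarrow> rep (f i) (g i)"
  shows "rep (\<Otimes>\<^bsub>R\<^esub>i\<in>A. f i) (prod g A)"
  using assms
proof (induction A rule: finite_induct)
  case empty
  interpret cring R by (rule padic_cring)
  show ?case
    by (simp add: rep_one)
next
  case (insert x F)
  interpret cring R by (rule padic_cring)
  have "f \<in> F \<rightarrow> carrier R" "f x \<in> carrier R"
    using insert.prems rep_carrier by auto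
  then show ?case
    using insert rep_mult by simp
qed

lemma rep_of_rat:
  assumes "q \<in> zloc p"
  shows "rep (padic_of_rat p q) q"
proof -
  obtain n k where nk: "quotient_of q = (n, k)"
    by fastforce
  have k: "k > 0" and cop: "coprime n k" and q: "q = of_int n / of_int k"
    using nk quotient_of_denom_pos quotient_of_coprime quotient_of_div by blast+
  obtain a b where ab: "q = of_int a / of_int b" "coprime b (int p)" "b \<noteq> 0"
    using assms by (metis zlocE)
  have "(of_int (n * b) :: rat) = of_int (a * k)"
    using q ab k by (simp add: field_simps)
  then have "n * b = a * k"
    by linarith
  \<comment> \<open>The reduced denominator divides every denominator of \<open>q\<close>, in
    particular one that is prime to \<open>p\<close>.\<close>
  then have "k dvd b"
    using cop by (metis coprime_commute coprime_dvd_mult_right_iff dvd_triv_right)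
  then have "coprime k (int p)"
    using ab(2) by (metis coprime_divisors dvd_refl)
  then have "of_int k \<in> zunit p"
    using coprime_p_iff zunit_of_int by blast
  then show ?thesis
    using rep_mult[OF rep_of_int[of n] rep_inv[OF rep_of_int[of k]]] q nk
    by (simp add: padic_of_rat_def divide_inverse)
qed

lemma padic_cong_3_rep:
  assumes "rep X q" "rep Y r" "qcong p 3 q r"
  shows "padic_cong p 3 X Y"
proof -
  have "qcong p 3 (of_int (X 3)) (of_int (Y 3))"
    using assms unfolding rep_def by (meson qcong_sym qcong_trans)
  then have "X 3 mod int p ^ 3 = Y 3 mod int p ^ 3"
    by (simp add: qcong_of_int_iff cong_def)
  then have "X 3 = Y 3"
    using assms padic_mod unfolding rep_def by (metis order_refl)
  then show ?thesis
    using assms by (simp add: padic_cong_iff rep_def)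
qed

text \<open>Wilson's theorem for prime powers. With a primitive root \<open>g\<close> and
  \<open>totient N = 2 * h\<close>, the product is \<open>g\<close> to the power
  \<open>h * (2 * h - 1)\<close>, an odd power of \<open>g ^ h\<close>, and \<open>g ^ h\<close> is
  congruent to - 1.\<close>

lemma prod_units_prime_power:
  assumes "k > 0"
  shows "[(\<Prod>j\<in>{j. 0 < j \<and> j < p ^ k \<and> \<not> p dvd j}. int j) = - 1] (mod int p ^ k)"
proof -
  define N where "N = p ^ k"
  have "p ^ 1 \<le> p ^ k"
    using assms p_pos by (intro power_increasing) auto
  then have N: "N > 2"
    using p_ge_3 by (simp add: N_def)
  obtain g where "residue_primroot N g"
    using residue_primroot_odd_prime_power_exists[OF p_prime p_odd] assms N_def by metis
  then have bij: "bij_betw (\<lambda>i. g ^ i mod N) {..<totient N} (totatives N)"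
    and ordg: "ord N g = totient N"
    using N residue_primroot_is_generator by (auto simp: residue_primroot_def)
  have tot: "totatives N = {j. 0 < j \<and> j < N \<and> \<not> p dvd j}"
  proof -
    have "coprime j N \<longleftrightarrow> \<not> p dvd j" for j :: nat
    proof -
      have "coprime j N \<longleftrightarrow> coprime p j"
        using assms by (simp add: N_def coprime_commute)
      also have "\<dots> \<longleftrightarrow> \<not> p dvd j"
        using p_prime by (metis coprime_absorb_left not_prime_unit prime_imp_coprime)
      finally show ?thesis .
    qed
    moreover have "p dvd N"
      using assms by (simp add: N_def)
    ultimately show ?thesis
      by (auto simp: totatives_def le_less)
  qed
  define h where "h = totient N div 2"
  have t: "totient N = 2 * h"
    using totient_even[OF N] by (simp add: h_def)
  have "totient N > 0"
    using N by simp
  then have h: "h > 0"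
    using t by simp
  define x where "x = int g ^ h"
  have "[g ^ (2 * h) = 1] (mod N)"
    using ord_works[of g N] ordg t by (metis)
  then have "[int (g ^ (2 * h)) = int 1] (mod int N)"
    using cong_int_iff by blast
  then have "[x ^ 2 = 1] (mod int N)"
    by (simp add: x_def mult.commute flip: power_mult)
  then have dv: "int p ^ k dvd (x - 1) * (x + 1)"
    by (simp add: cong_iff_dvd_diff N_def algebra_simps power2_eq_square)
  have "\<not> [g ^ h = 1] (mod N)"
    using ordg t h by (metis ord_minimal less_add_same_cancel1 mult_2)
  then have n1: "\<not> int p ^ k dvd x - 1"
    by (metis N_def cong_iff_dvd_diff cong_int_iff of_nat_1 of_nat_power x_def)
  \<comment> \<open>\<open>x\<close> squares to 1 but is not 1. As \<open>p\<close> is odd, it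
    divides at most one of \<open>x - 1\<close> and \<open>x + 1\<close>, so the whole of
    \<open>p ^ k\<close> divides one of them.\<close>
  have xm: "[x = - 1] (mod int p ^ k)"
  proof (cases "int p dvd x - 1")
    case False
    then have "coprime (int p ^ k) (x - 1)"
      using coprime_p_iff[of "x - 1"] by (simp add: coprime_commute)
    then have "int p ^ k dvd x + 1"
      using dv coprime_dvd_mult_right_iff by blast
    then show ?thesis
      by (simp add: cong_iff_dvd_diff)
  next
    case True
    have "\<not> int p dvd x + 1"
    proof
      assume "int p dvd x + 1"
      then have "int p dvd 2"
        using True dvd_diff[of "int p" "x + 1" "x - 1"] by simp
      then show False
        using p_ge_3 zdvd_imp_le[of "int p" 2] by simp
    qed
    then have "coprime (int p ^ k) (x + 1)"
      using coprime_p_iff[of "x + 1"] by (simp add: coprime_commute)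
    then have "int p ^ k dvd x - 1"
      using dv coprime_dvd_mult_left_iff by blast
    then show ?thesis
      using n1 by simp
  qed
  have "(\<Prod>j\<in>totatives N. int j) = (\<Prod>i<totient N. int (g ^ i mod N))"
    using prod.reindex_bij_betw[OF bij, of int] by simp
  also have "[\<dots> = (\<Prod>i<totient N. int g ^ i)] (mod int N)"
    by (rule cong_prod) (simp add: zmod_int cong_def)
  also have "(\<Prod>i<totient N. int g ^ i) = int g ^ (\<Sum>i<totient N. i)"
    by (simp add: power_sum)
  also have "(\<Sum>i<totient N. i) = h * (2 * h - 1)"
    unfolding t using h by (simp add: gauss_sum_nat lessThan_atLeast0 Sum_Ico_nat)
  also have "int g ^ (h * (2 * h - 1)) = x ^ (2 * h - 1)"
    by (simp add: x_def power_mult)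
  also have "[x ^ (2 * h - 1) = (- 1) ^ (2 * h - 1)] (mod int N)"
    using xm cong_pow N_def by auto
  also have "(- 1 :: int) ^ (2 * h - 1) = - 1"
    using h by (intro neg_one_odd_power) simp
  finally show ?thesis
    unfolding tot by (simp add: N_def)
qed

lemma gamma_nat_Suc:
  "padic_gamma_nat p (Suc n) = - (if p dvd n then 1 else int n) * padic_gamma_nat p n"
proof (cases "p dvd n")
  case True
  then have "{j. 0 < j \<and> j < Suc n \<and> \<not> p dvd j} = {j. 0 < j \<and> j < n \<and> \<not> p dvd j}"
    by (auto simp: less_Suc_eq)
  with True show ?thesis
    by (simp add: padic_gamma_nat_def)
next
  case False
  then have "{j. 0 < j \<and> j < Suc n \<and> \<not> p dvd j} = insert n {j. 0 < j \<and> j < n \<and> \<not> p dvd j}"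
    by (auto simp: less_Suc_eq intro!: gr0I)
  with False show ?thesis
    by (simp add: padic_gamma_nat_def)
qed

lemma gamma_nat_0: "padic_gamma_nat p 0 = 1"
  by (simp add: padic_gamma_nat_def)

text \<open>Continuity of the gamma function. The base case is Wilson's theorem, whose value - 1
  cancels the sign \<open>(- 1) ^ (p ^ k)\<close>; each step multiplies both sides by congruent
  factors.\<close>

lemma gamma_nat_add_power:
  "[padic_gamma_nat p (n + p ^ k) = padic_gamma_nat p n] (mod int p ^ k)"
proof (cases "k = 0")
  case False
  show ?thesis
  proof (induction n)
    case 0
    have "[padic_gamma_nat p (p ^ k) = (- 1) ^ (p ^ k) * (- 1)] (mod int p ^ k)"
      unfolding padic_gamma_nat_def using False
      by (intro cong_mult prod_units_prime_power) auto
    then show ?case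
      using p_odd by (simp add: gamma_nat_0)
  next
    case (Suc n)
    have "p dvd n + p ^ k \<longleftrightarrow> p dvd n"
      using False by (simp add: dvd_add_left_iff)
    moreover have "[int (n + p ^ k) = int n] (mod int p ^ k)"
      by (simp add: cong_def)
    ultimately show ?case
      unfolding add_Suc gamma_nat_Suc using Suc
      by (intro cong_mult) (auto simp: cong_minus_minus_iff)
  qed
qed auto

lemma gamma_nat_cong:
  assumes "[int m = int n] (mod int p ^ k)"
  shows "[padic_gamma_nat p m = padic_gamma_nat p n] (mod int p ^ k)"
proof -
  have *: "[padic_gamma_nat p (n + q * p ^ k) = padic_gamma_nat p n] (mod int p ^ k)" for n q
  proof (induction q)
    case (Suc q)
    have "n + Suc q * p ^ k = (n + q * p ^ k) + p ^ k"
      by simp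
    then show ?case
      using gamma_nat_add_power[of "n + q * p ^ k" k] Suc by (metis cong_trans)
  qed simp
  have "m mod p ^ k = n mod p ^ k"
    using assms by (metis cong_def cong_int_iff of_nat_power)
  then show ?thesis
    using *[of "m mod p ^ k" "m div p ^ k"] *[of "n mod p ^ k" "n div p ^ k"]
    by (metis cong_sym cong_trans mod_div_decomp add.commute)
qed

text \<open>Besides existence and uniqueness of the limit behind \<open>THE\<close>, this gives an
  explicit modulus of continuity: level \<open>k\<close> of the argument determines level
  \<open>k\<close> of the value.\<close>

lemma padic_gamma_level:
  assumes X: "X \<in> carrier R"
  shows "padic_gamma p X \<in> carrier R"
    and "[int n = X k] (mod int p ^ k) \<Longrightarrow> n > 0 \<Longrightarrow> [padic_gamma p X k = padic_gamma_nat p n] (mod int p ^ k)"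
proof -
  define P where "P = (\<lambda>y. y \<in> carrier R \<and>
        (\<forall>k. \<exists>l. \<forall>n>0. padic_cong p l (padic_of_int p (int n)) X \<longrightarrow>
           padic_cong p k (padic_of_int p (padic_gamma_nat p n)) y))"
  define N where "N = (\<lambda>k. nat (X k) + p ^ k)"
  have pk: "(0::int) < int p ^ k" for k
    using p_pos by simp
  have X0: "0 \<le> X k" for k
    using padic_mod[OF X, of k k] pk[of k] by (metis order_refl pos_mod_sign)
  have Nk: "[int (N k) = X k] (mod int p ^ k)" and N0: "N k > 0" for k
    using X0[of k] p_pos by (auto simp: N_def cong_def)
  define Y where "Y = (\<lambda>k. padic_gamma_nat p (N k) mod int p ^ k)"
  have Yk: "[padic_gamma_nat p n = Y k] (mod int p ^ k)" if "[int n = X k] (mod int p ^ k)" for n k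
    using gamma_nat_cong[of n "N k" k] that Nk[of k] by (auto simp: Y_def cong_def)
  have Y: "Y \<in> carrier R"
    unfolding padic_carrier_iff
  proof (intro allI impI)
    fix m n :: nat
    assume mn: "n \<le> m"
    have "[int (N m) = X n] (mod int p ^ n)"
      using Nk[of m] padic_cong_level[OF X mn] mn
      by (meson cong_dvd_modulus cong_trans le_imp_power_dvd)
    then have "[padic_gamma_nat p (N m) = Y n] (mod int p ^ n)"
      by (rule Yk)
    then show "Y m mod int p ^ n = Y n"
      using mn by (simp add: Y_def cong_def mod_mod_cancel le_imp_power_dvd)
  qed
  have of_int: "padic_cong p l (padic_of_int p a) Z \<longleftrightarrow> [a = Z l] (mod int p ^ l)"
    if "Z \<in> carrier R" for a l Z
    using padic_cong_iff[OF padic_of_int_closed that] padic_mod[OF that, of l l]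
    by (auto simp: padic_of_int_def cong_def)
  have PY: "P Y"
    unfolding P_def using X Y Yk by (auto simp: of_int)
  have uniq: "Z = Y" if "P Z" for Z
  proof
    fix k
    have Z: "Z \<in> carrier R"
      using that by (simp add: P_def)
    have "\<exists>l. \<forall>n>0. [int n = X l] (mod int p ^ l) \<longrightarrow> [padic_gamma_nat p n = Z k] (mod int p ^ k)"
      using that X Z by (simp add: P_def of_int)
    then obtain l where l: "\<forall>n>0. [int n = X l] (mod int p ^ l) \<longrightarrow> [padic_gamma_nat p n = Z k] (mod int p ^ k)" ..
    \<comment> \<open>One approximation \<open>N M\<close> serves both purposes: it is good to level
      \<open>l\<close> for the limit property of \<open>Z\<close> and to level \<open>k\<close> for
      the value of \<open>Y\<close>.\<close>
    define M where "M = max k l"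
    have "[int (N M) = X l] (mod int p ^ l)" "[int (N M) = X k] (mod int p ^ k)"
      using Nk[of M] padic_cong_level[OF X, of l M] padic_cong_level[OF X, of k M]
      unfolding M_def by (meson cong_dvd_modulus cong_trans le_imp_power_dvd max.cobounded1 max.cobounded2)+
    then have "[Z k = Y k] (mod int p ^ k)"
      using l N0 Yk by (meson cong_sym cong_trans)
    then show "Z k = Y k"
      using padic_mod[OF Z order_refl] padic_mod[OF Y order_refl] unfolding cong_def by metis
  qed
  have "padic_gamma p X = Y"
    unfolding padic_gamma_def P_def[symmetric] using PY uniq by (rule the_equality)
  then show "padic_gamma p X \<in> carrier R"
    and "[int n = X k] (mod int p ^ k) \<Longrightarrow> n > 0 \<Longrightarrow> [padic_gamma p X k = padic_gamma_nat p n] (mod int p ^ k)"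
    using Y Yk cong_sym by metis+
qed

text \<open>Only the residue modulo \<open>p\<^sup>3\<close> of \<open>gam x\<close> is meaningful: it is that of the gamma function at \<open>x\<close>.\<close>

definition gam :: "rat \<Rightarrow> rat" where
  "gam x = of_int (padic_gamma_nat p (SOME n. n > 0 \<and> qcong p 3 x (of_nat n)))"

lemma gam_ex:
  assumes "x \<in> zloc p"
  obtains n where "n > 0" "qcong p 3 x (of_nat n)" "gam x = of_int (padic_gamma_nat p n)"
  using someI_ex[OF qcong_ex_nat[OF assms, of 3]] by (auto simp: gam_def)

lemma qcong_of_nat_iff: "qcong p k (of_nat m) (of_nat n) \<longleftrightarrow> [int m = int n] (mod int p ^ k)"
  using qcong_of_int_iff[of k "int m" "int n"] by simp

lemma gam_qcong_nat:
  assumes "qcong p 3 x (of_nat n)"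
  shows "qcong p 3 (gam x) (of_int (padic_gamma_nat p n))"
proof -
  have "x \<in> zloc p"
    using assms qcong_zloc by blast
  then obtain m where m: "qcong p 3 x (of_nat m)" "gam x = of_int (padic_gamma_nat p m)"
    by (metis gam_ex)
  then have "qcong p 3 (of_nat m) (of_nat n)"
    using assms by (meson qcong_sym qcong_trans)
  then show ?thesis
    using m by (simp add: qcong_of_nat_iff gamma_nat_cong qcong_of_int)
qed

lemma rep_gamma:
  assumes "x \<in> zloc p"
  shows "rep (padic_gamma p (padic_of_rat p x)) (gam x)"
proof -
  obtain n where n: "n > 0" "qcong p 3 x (of_nat n)" "gam x = of_int (padic_gamma_nat p n)"
    by (metis gam_ex assms)
  have r: "rep (padic_of_rat p x) x"
    using assms rep_of_rat by blast
  then have "qcong p 3 (of_int (padic_of_rat p x 3)) (of_int (int n))"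
    using n by (auto simp: rep_def intro: qcong_trans)
  then have "[int n = padic_of_rat p x 3] (mod int p ^ 3)"
    using qcong_of_int_iff cong_sym by blast
  then show ?thesis
    using padic_gamma_level[OF rep_carrier[OF r]] n by (auto simp: rep_def intro: qcong_of_int)
qed

section \<open>The gamma function modulo \<open>p\<^sup>3\<close>\<close>

text \<open>The maximal ideal of the localization. At its elements the gamma function skips a
  factor.\<close>

definition zmax :: "rat set" where
  "zmax = {of_nat p * z | z. z \<in> zloc p}"

lemma zmaxI: "z \<in> zloc p \<Longrightarrow> of_nat p * z \<in> zmax"
  by (auto simp: zmax_def)

lemma zmax_p [simp, intro]: "of_nat p \<in> zmax"
  using zmaxI[of 1] by simp

lemma zmax_0 [simp, intro]: "0 \<in> zmax"
  using zmaxI[of 0] by simp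

lemma zmax_zloc [intro]: "x \<in> zmax \<Longrightarrow> x \<in> zloc p"
  by (auto simp: zmax_def)

lemma zmax_add [intro]: "x \<in> zmax \<Longrightarrow> y \<in> zmax \<Longrightarrow> x + y \<in> zmax"
  by (auto simp: zmax_def simp flip: distrib_left)

lemma zmax_rmult [intro]: "x \<in> zmax \<Longrightarrow> y \<in> zloc p \<Longrightarrow> x * y \<in> zmax"
  by (auto simp: zmax_def mult.assoc)

lemma zmax_lmult [intro]: "x \<in> zmax \<Longrightarrow> y \<in> zloc p \<Longrightarrow> y * x \<in> zmax"
  using zmax_rmult by (simp add: mult.commute)

lemma zmax_uminus [intro]: "x \<in> zmax \<Longrightarrow> - x \<in> zmax"
  using zmax_rmult[of x "- 1"] by auto

lemma zmax_diff [intro]: "x \<in> zmax \<Longrightarrow> y \<in> zmax \<Longrightarrow> x - y \<in> zmax"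
  using zmax_add[of x "- y"] by auto

lemma zmax_not_zunit: "x \<in> zmax \<Longrightarrow> x \<notin> zunit p"
  using not_zunit_p_mult by (auto simp: zmax_def)

lemma zunit_add_zmax:
  assumes "x \<in> zunit p" "y \<in> zmax"
  shows "x + y \<in> zunit p"
proof -
  obtain z where "z \<in> zloc p" "y = of_nat p * z"
    using assms by (auto simp: zmax_def)
  then have "qcong p 1 (x + y) x"
    by (intro qcongI[of z]) auto
  then show ?thesis
    using zunit_qcong[of 1 "x + y" x] assms by simp
qed

lemma zunit_of_nat: "0 < c \<Longrightarrow> c < p \<Longrightarrow> of_nat c \<in> zunit p"
  using zunit_of_int[of "int c"] by (simp add: nat_dvd_not_less)

lemma zunit_of_nat_add: "0 < c \<Longrightarrow> c < p \<Longrightarrow> x \<in> zmax \<Longrightarrow> of_nat c + x \<in> zunit p"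
  by (rule zunit_add_zmax[OF zunit_of_nat])

lemma zunit_of_nat_diff: "0 < c \<Longrightarrow> c < p \<Longrightarrow> x \<in> zmax \<Longrightarrow> of_nat c - x \<in> zunit p"
  using zunit_of_nat_add[of c "- x"] by auto

lemma pochhammer_1_zunit: "n < p \<Longrightarrow> x \<in> zmax \<Longrightarrow> pochhammer (1 + x) n \<in> zunit p"
  unfolding pochhammer_prod
proof (rule zunit_prod)
  fix i
  assume "n < p" "x \<in> zmax" "i \<in> {0..<n}"
  then show "1 + x + of_nat i \<in> zunit p"
    using zunit_of_nat_add[of "Suc i" x] by (simp add: algebra_simps)
qed

lemma zloc_neg_one_power: "(- 1) ^ n \<in> zloc p"
  by (intro zloc_power zloc_uminus zloc_1)

lemma qcong_pochhammer:
  assumes "qcong p k x y" "y \<in> zloc p"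
  shows "qcong p k (pochhammer x n) (pochhammer y n)"
  unfolding pochhammer_prod using assms qcong_zloc[OF assms]
  by (intro qcong_prod qcong_add) auto

lemma fact_zunit: "n < p \<Longrightarrow> fact n \<in> zunit p"
  using pochhammer_1_zunit[of n 0] by (simp add: pochhammer_fact)

lemma gam_qcong:
  assumes "qcong p 3 x y" "y \<in> zloc p"
  shows "qcong p 3 (gam x) (gam y)"
proof -
  obtain n where "qcong p 3 y (of_nat n)"
    using qcong_ex_nat assms(2) by blast
  then show ?thesis
    using assms gam_qcong_nat by (meson qcong_sym qcong_trans)
qed

lemma gam_zloc [intro]: "gam x \<in> zloc p"
  by (simp add: gam_def)

lemma gam_zunit: "gam x \<in> zunit p"
proof -
  have "\<not> int p dvd padic_gamma_nat p n" for n
  proof (induction n)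
    case 0
    then show ?case
      using p_ge_3 by (simp add: gamma_nat_0)
  next
    case (Suc n)
    then show ?case
      using p_prime by (auto simp: gamma_nat_Suc prime_dvd_mult_iff)
  qed
  then show ?thesis
    unfolding gam_def by (intro zunit_of_int)
qed

lemma gam_nat: "qcong p 3 (gam (of_nat n)) (of_int (padic_gamma_nat p n))"
  by (rule gam_qcong_nat) simp

lemma gam_0: "qcong p 3 (gam 0) 1"
  using gam_nat[of 0] by (simp add: gamma_nat_0)

section \<open>Functional equation and reflection formula\<close>

lemma gam_Suc_zunit:
  assumes "x \<in> zunit p"
  shows "qcong p 3 (gam (x + 1)) (- x * gam x)"
proof -
  obtain n where n: "qcong p 3 x (of_nat n)"
    using qcong_ex_nat assms by blast
  then have "of_nat n \<in> zunit p"
    using assms zunit_qcong[of 3 "of_nat n" x] qcong_sym by simp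
  then have nd: "\<not> p dvd n"
    using zunit_of_int_iff[of "int n"] by simp
  have "qcong p 3 (gam (x + 1)) (of_int (padic_gamma_nat p (Suc n)))"
    using qcong_add[OF n qcong_refl, of 1] by (intro gam_qcong_nat) (simp add: add.commute)
  also have "of_int (padic_gamma_nat p (Suc n)) = - of_nat n * (of_int (padic_gamma_nat p n) :: rat)"
    using nd by (simp add: gamma_nat_Suc)
  also have "qcong p 3 \<dots> (- x * gam x)"
    using n gam_qcong_nat[OF n] assms
    by (intro qcong_mult qcong_uminus) (auto intro: qcong_sym)
  finally show ?thesis .
qed

lemma gam_Suc_zmax:
  assumes "x \<in> zmax"
  shows "qcong p 3 (gam (x + 1)) (- gam x)"
proof -
  obtain n where n: "qcong p 3 x (of_nat n)"
    using qcong_ex_nat assms by blast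
  then have "of_nat n \<notin> zunit p"
    using assms zunit_qcong[of 3 x "of_nat n"] zmax_not_zunit by auto
  then have nd: "p dvd n"
    using zunit_of_int[of "int n"] by auto
  have "qcong p 3 (gam (x + 1)) (of_int (padic_gamma_nat p (Suc n)))"
    using qcong_add[OF n qcong_refl, of 1] by (intro gam_qcong_nat) (simp add: add.commute)
  also have "of_int (padic_gamma_nat p (Suc n)) = - (of_int (padic_gamma_nat p n) :: rat)"
    using nd by (simp add: gamma_nat_Suc)
  also have "qcong p 3 \<dots> (- gam x)"
    using gam_qcong_nat[OF n] by (intro qcong_uminus) (auto intro: qcong_sym)
  finally show ?thesis .
qed

text \<open>The arguments \<open>x - N\<close>, ..., \<open>x - 1\<close> are all units, so the
  functional equation contributes every factor; written from \<open>1 - x\<close> upwards, the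
  product absorbs all signs.\<close>

lemma gam_down:
  assumes "x \<in> zmax" "N < p"
  shows "qcong p 3 (gam x) (gam (x - of_nat N) * pochhammer (1 - x) N)"
  using assms(2)
proof (induction N)
  case (Suc N)
  define y where "y = x - of_nat (Suc N)"
  have "of_nat (Suc N) - x \<in> zunit p"
    using Suc.prems assms(1) by (intro zunit_of_nat_diff) auto
  then have "- (of_nat (Suc N) - x) \<in> zunit p"
    by blast
  then have "y \<in> zunit p"
    by (simp add: y_def)
  then have "qcong p 3 (gam (y + 1)) (- y * gam y)"
    by (rule gam_Suc_zunit)
  then have *: "qcong p 3 (gam (x - of_nat N)) (- y * gam y)"
    by (simp add: y_def)
  have "qcong p 3 (gam x) (gam (x - of_nat N) * pochhammer (1 - x) N)"
    using Suc by simp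
  also have "qcong p 3 \<dots> ((- y * gam y) * pochhammer (1 - x) N)"
    using * assms by (intro qcong_rmult) auto
  also have "(- y * gam y) * pochhammer (1 - x) N = gam y * pochhammer (1 - x) (Suc N)"
    by (simp add: y_def pochhammer_Suc algebra_simps)
  finally show ?case
    by (simp add: y_def)
qed simp

text \<open>The first step leaves \<open>x\<close> itself, which lies in \<open>zmax\<close>, and
  contributes only a sign. This is why the shift is \<open>Suc N\<close> while the Pochhammer symbol
  has length \<open>N\<close>.\<close>

lemma gam_up:
  assumes "x \<in> zmax" "N < p"
  shows "qcong p 3 (gam (x + of_nat (Suc N))) ((- 1) ^ Suc N * gam x * pochhammer (1 + x) N)"
  using assms(2)
proof (induction N)
  case 0
  then show ?case
    using gam_Suc_zmax[OF assms(1)] by simp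
next
  case (Suc N)
  define y where "y = x + of_nat (Suc N)"
  have yu: "y \<in> zunit p"
    using zunit_of_nat_add[of "Suc N" x] Suc.prems assms(1) by (simp add: y_def add.commute)
  have "x + of_nat (Suc (Suc N)) = y + 1"
    by (simp add: y_def)
  then have "qcong p 3 (gam (x + of_nat (Suc (Suc N)))) (- y * gam y)"
    using gam_Suc_zunit[OF yu] by (simp only:)
  also have "qcong p 3 (- y * gam y) (- y * ((- 1) ^ Suc N * gam x * pochhammer (1 + x) N))"
    using Suc yu by (intro qcong_lmult zloc_uminus zunit_imp_zloc) (simp_all add: y_def)
  also have "- y * ((- 1) ^ Suc N * gam x * pochhammer (1 + x) N)
      = (- 1) ^ Suc (Suc N) * gam x * pochhammer (1 + x) (Suc N)"
    by (simp add: y_def pochhammer_Suc algebra_simps)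
  finally show ?case .
qed

text \<open>The product \<open>gam x * gam (1 - x)\<close> is compared with its shift by 1: the
  functional equation is used at \<open>x\<close> and at \<open>- x\<close>, and the factors cancel
  up to sign.\<close>

lemma gam_reflect_step:
  assumes "x \<in> zloc p"
  shows "qcong p 3 (gam (x + 1) * gam (- x)) ((if x \<in> zunit p then - 1 else 1) * (gam x * gam (1 - x)))"
proof (cases "x \<in> zunit p")
  case True
  have "qcong p 3 (gam (x + 1) * gam (- x)) ((- x * gam x) * gam (- x))"
    using gam_Suc_zunit[OF True] by (intro qcong_rmult) auto
  also have "\<dots> = - gam x * (- (- x) * gam (- x))"
    by simp
  also have "qcong p 3 \<dots> (- gam x * gam (- x + 1))"
    using gam_Suc_zunit[of "- x"] True by (intro qcong_lmult qcong_sym[OF gam_Suc_zunit]) auto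
  finally show ?thesis
    using True by simp
next
  case False
  then have x: "x \<in> zmax"
    using assms zunit_cases zmaxI by metis
  have "qcong p 3 (gam (x + 1) * gam (- x)) ((- gam x) * gam (- x))"
    using gam_Suc_zmax[OF x] by (intro qcong_rmult) auto
  also have "\<dots> = gam x * (- gam (- x))"
    by simp
  also have "qcong p 3 \<dots> (gam x * gam (- x + 1))"
    using x by (intro qcong_lmult qcong_sym[OF gam_Suc_zmax]) auto
  finally show ?thesis
    using False by simp
qed

text \<open>Let h(x) = Gamma_p(x) Gamma_p(1 - x). A move by \<open>p\<close> changes the sign of h
  exactly \<open>p - 1\<close> times, an even number, so h is constant on multiples of
  \<open>p\<close> with value h(0) = - 1. The step from \<open>1 - x\<close> to \<open>- x\<close>
  costs one more sign.\<close>

lemma gam_reflect: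
  assumes "x \<in> zmax"
  shows "qcong p 3 (gam x * gam (- x)) 1"
proof -
  let ?h = "\<lambda>x. gam x * gam (1 - x)"
  have step: "qcong p 3 (?h (of_nat n + of_nat k)) ((- 1) ^ (k - 1) * ?h (of_nat n))"
    if "p dvd n" "0 < k" "k \<le> p" for n k
    using that(2,3)
  proof (induction k)
    case (Suc k)
    show ?case
    proof (cases "k = 0")
      case True
      have "of_nat n \<notin> zunit p"
        using that(1) zunit_of_int_iff[of "int n"] by simp
      then show ?thesis
        using True gam_reflect_step[of "of_nat n"] by simp
    next
      case False
      have "\<not> p dvd n + k"
        using that(1) False Suc.prems by (simp add: dvd_add_right_iff nat_dvd_not_less)
      then have u: "of_nat n + of_nat k \<in> zunit p"
        using zunit_of_int_iff[of "int (n + k)"] by (simp flip: of_nat_add)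
      have "qcong p 3 (?h (of_nat n + of_nat (Suc k))) (- 1 * ?h (of_nat n + of_nat k))"
        using gam_reflect_step[of "of_nat n + of_nat k"] u by (auto simp: algebra_simps)
      also have "qcong p 3 \<dots> (- 1 * ((- 1) ^ (k - 1) * ?h (of_nat n)))"
        using Suc False by (intro qcong_lmult) auto
      also have "- 1 * ((- 1) ^ (k - 1) * ?h (of_nat n)) = (- 1) ^ (Suc k - 1) * ?h (of_nat n)"
        using False by (cases k) auto
      finally show ?thesis .
    qed
  qed simp
  have h: "qcong p 3 (?h (of_nat (q * p))) (- 1)" for q
  proof (induction q)
    case 0
    have "qcong p 3 (gam 0 * gam 1) (1 * (- 1))"
      using gam_0 gam_nat[of 1] gamma_nat_Suc[of 0]
      by (intro qcong_mult) (auto simp: gamma_nat_0)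
    then show ?case
      by simp
  next
    case (Suc q)
    have "qcong p 3 (?h (of_nat (q * p) + of_nat p)) ((- 1) ^ (p - 1) * ?h (of_nat (q * p)))"
      using p_pos by (intro step) auto
    moreover have "of_nat (q * p) + of_nat p = (of_nat (Suc q * p) :: rat)"
      by simp
    moreover have "(- 1) ^ (p - 1) = (1 :: rat)"
      using p_odd by simp
    ultimately have "qcong p 3 (?h (of_nat (Suc q * p))) (?h (of_nat (q * p)))"
      by (metis mult_1)
    then show ?case
      using Suc qcong_trans by blast
  qed
  obtain z where z: "z \<in> zloc p" "x = of_nat p * z"
    using assms by (auto simp: zmax_def)
  obtain q where "qcong p 3 z (of_nat q)"
    using qcong_ex_nat z by blast
  then have xq: "qcong p 3 x (of_nat (q * p))"
    using z qcong_lmult[of 3 z "of_nat q" "of_nat p"] by (simp add: mult.commute)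
  have "qcong p 3 (?h x) (?h (of_nat (q * p)))"
    using xq by (intro qcong_mult gam_qcong qcong_diff) auto
  then have "qcong p 3 (?h x) (- 1)"
    using h qcong_trans by blast
  moreover have "qcong p 3 (gam x * gam (- x + 1)) (gam x * - gam (- x))"
    using assms by (intro qcong_lmult gam_Suc_zmax) auto
  ultimately have "qcong p 3 (gam x * - gam (- x)) (- 1)"
    using qcong_sym qcong_trans by (metis uminus_add_conv_diff)
  then show ?thesis
    using qcong_uminus by fastforce
qed

text \<open>The reflection formula, with its sign expressed by the residue \<open>m\<close> of
  \<open>- x\<close>. The two arguments are moved to \<open>x + m\<close> and its negative in
  \<open>zmax\<close>; the Pochhammer symbol produced by one move is the one absorbed by the
  other.\<close>

lemma gam_reflect_residue:
  assumes "x \<in> zloc p" "x + of_nat m \<in> zmax" "m < p"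
  shows "qcong p 3 (gam x * gam (1 - x)) (- ((- 1) ^ m))"
proof -
  define y where "y = x + of_nat m"
  have y: "y \<in> zmax" and x: "x = y - of_nat m"
    using assms by (auto simp: y_def)
  have u: "pochhammer (1 - y) m \<in> zunit p"
    using pochhammer_1_zunit[of m "- y"] y assms(3) by auto
  have "qcong p 3 (gam (- y + of_nat (Suc m))) ((- 1) ^ Suc m * gam (- y) * pochhammer (1 + - y) m)"
    using y assms by (intro gam_up) auto
  then have a: "qcong p 3 (gam (1 - x)) ((- 1) ^ Suc m * gam (- y) * pochhammer (1 - y) m)"
    by (simp add: x algebra_simps)
  have "qcong p 3 (gam x * gam (1 - x)) (gam x * ((- 1) ^ Suc m * gam (- y) * pochhammer (1 - y) m))"
    using a by (intro qcong_lmult) auto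
  also have "\<dots> = (- 1) ^ Suc m * gam (- y) * (gam (y - of_nat m) * pochhammer (1 - y) m)"
    by (simp add: x)
  also have "qcong p 3 \<dots> ((- 1) ^ Suc m * gam (- y) * gam y)"
    using gam_down[OF y assms(3)] by (intro qcong_lmult zloc_mult zloc_neg_one_power gam_zloc) (rule qcong_sym)
  also have "\<dots> = (- 1) ^ Suc m * (gam y * gam (- y))"
    by simp
  also have "qcong p 3 \<dots> ((- 1) ^ Suc m * 1)"
    using gam_reflect[OF y] by (intro qcong_lmult) auto
  finally show ?thesis
    by simp
qed

section \<open>Wolstenholme's congruence and multiplicativity of the gamma function\<close>

lemma zmax_sq_mult:
  assumes "x \<in> zmax" "y \<in> zmax"
  shows "\<exists>z\<in>zloc p. x * y = of_nat p ^ 2 * z"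
proof -
  obtain a b where "a \<in> zloc p" "x = of_nat p * a" "b \<in> zloc p" "y = of_nat p * b"
    using assms by (auto simp: zmax_def)
  then show ?thesis
    by (intro bexI[of _ "a * b"]) (auto simp: power2_eq_square)
qed

lemma qcong_zmax: "x \<in> zmax \<Longrightarrow> qcong p 1 x 0"
  by (auto simp: zmax_def intro: qcongI)

lemma qcong_p2_mult:
  assumes "qcong p 1 x y"
  shows "qcong p 3 (of_nat p ^ 2 * x) (of_nat p ^ 2 * y)"
  using qcong_scale_power[OF assms, of 2] by (simp add: numeral_3_eq_3)

text \<open>Products of two corrections carry \<open>p ^ 4\<close> and vanish modulo
  \<open>p ^ 3\<close>.\<close>

lemma prod_perturb:
  assumes "finite A" "\<And>i. i \<in> A \<Longrightarrow> b i \<in> zloc p"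
  shows "qcong p 3 (\<Prod>i\<in>A. 1 + of_nat p ^ 2 * b i) (1 + of_nat p ^ 2 * (\<Sum>i\<in>A. b i))"
  using assms
proof (induction A rule: finite_induct)
  case (insert x F)
  have "(\<Prod>i\<in>insert x F. 1 + of_nat p ^ 2 * b i) = (1 + of_nat p ^ 2 * b x) * (\<Prod>i\<in>F. 1 + of_nat p ^ 2 * b i)"
    using insert.hyps by simp
  also have "qcong p 3 \<dots> ((1 + of_nat p ^ 2 * b x) * (1 + of_nat p ^ 2 * (\<Sum>i\<in>F. b i)))"
    using insert by (intro qcong_lmult) auto
  also have "qcong p 3 \<dots> (1 + of_nat p ^ 2 * (\<Sum>i\<in>insert x F. b i))"
  proof (rule qcongI)
    show "of_nat p * (b x * (\<Sum>i\<in>F. b i)) \<in> zloc p"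
      using insert.prems by auto
  qed (use insert.hyps in \<open>simp add: algebra_simps power2_eq_square power3_eq_cube\<close>)
  finally show ?case .
qed simp

text \<open>Doubling permutes the nonzero residues, so the sum S satisfies S = S / 4, that is 3 S =
  0, modulo \<open>p\<close>; and 3 is a unit because \<open>p\<close> is at least 5.\<close>

lemma inverse_squares_sum:
  assumes "p \<ge> 5"
  shows "qcong p 1 (\<Sum>c\<in>{1..<p}. 1 / of_nat c ^ 2) 0"
proof -
  let ?S = "\<Sum>c\<in>{1..<p}. 1 / of_nat c ^ 2 :: rat"
  define f where "f = (\<lambda>c. 2 * c mod p)"
  have cop: "coprime 2 p"
    using p_odd by (simp add: coprime_commute)
  have "inj_on f {1..<p}"
  proof (rule inj_onI)
    fix x y assume "x \<in> {1..<p}" "y \<in> {1..<p}" "f x = f y"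
    then have "[2 * x = 2 * y] (mod p)" "x < p" "y < p"
      by (auto simp: f_def cong_def)
    then show "x = y"
      using cop by (metis cong_mult_lcancel_nat cong_less_modulus_unique_nat)
  qed
  moreover have "f ` {1..<p} \<subseteq> {1..<p}"
  proof
    fix y assume "y \<in> f ` {1..<p}"
    then obtain c where c: "c \<in> {1..<p}" "y = 2 * c mod p"
      by (auto simp: f_def)
    then have "\<not> p dvd 2 * c"
      using cop by (auto simp: coprime_dvd_mult_right_iff coprime_commute nat_dvd_not_less)
    then show "y \<in> {1..<p}"
      using c p_pos by (auto simp: dvd_eq_mod_eq_0 Suc_le_eq)
  qed
  ultimately have bij: "bij_betw f {1..<p} {1..<p}"
    by (simp add: bij_betw_def endo_inj_surj)
  have u: "of_nat c ^ 2 \<in> zunit p" if "c \<in> {1..<p}" for c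
    using that by (intro zunit_power zunit_of_nat) auto
  have u2: "of_nat 2 \<in> zunit p"
    using assms by (intro zunit_of_nat) auto
  have "?S = (\<Sum>c\<in>{1..<p}. 1 / of_nat (f c) ^ 2)"
    using sum.reindex_bij_betw[OF bij, of "\<lambda>c. 1 / of_nat c ^ 2 :: rat"] by simp
  also have "qcong p 1 \<dots> (\<Sum>c\<in>{1..<p}. 1 / of_nat (2 * c) ^ 2)"
  proof (intro qcong_sum qcong_divide qcong_refl zloc_1)
    fix c assume c: "c \<in> {1..<p}"
    then show "of_nat (f c) ^ 2 \<in> zunit p"
      using u bij bij_betwE by blast
    show "of_nat (2 * c) ^ 2 \<in> zunit p"
      using zunit_mult[OF zunit_power[OF u2, of 2] u[OF c]] by (simp add: power_mult_distrib)
    have "[int (f c) = int (2 * c)] (mod int p ^ 1)"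
      by (simp add: f_def zmod_int cong_def)
    then have "qcong p 1 (of_nat (f c)) (of_nat (2 * c))"
      using qcong_of_nat_iff by blast
    then show "qcong p 1 (of_nat (f c) ^ 2) (of_nat (2 * c) ^ 2)"
      by (intro qcong_power) auto
  qed
  also have "(\<Sum>c\<in>{1..<p}. 1 / of_nat (2 * c) ^ 2) = ?S / 4"
    unfolding sum_divide_distrib by (intro sum.cong) (auto simp: power_mult_distrib)
  finally have q: "qcong p 1 ?S (?S / 4)" .
  have "4 * (?S - ?S / 4) = 3 * ?S" "4 * (?S / 4 - ?S / 4) = 3 * 0"
    by simp_all
  then have "qcong p 1 (3 * ?S) (3 * 0)"
    using qcong_lmult[OF qcong_diff[OF q qcong_refl[of 1 "?S / 4"]], of 4] zloc_numeral by metis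
  moreover have "3 \<in> zunit p"
    using zunit_of_nat[of 3] assms by simp
  ultimately show ?thesis
    using qcong_cancel by blast
qed

text \<open>Pairing the factors \<open>c\<close> and \<open>p - c\<close> shows that the square of the product is constant
  modulo \<open>p\<^sup>3\<close>, and the product itself is constant modulo \<open>p\<close>.\<close>

lemma wolstenholme_prod:
  assumes "p \<ge> 5" "x \<in> zmax"
  shows "qcong p 3 (\<Prod>c\<in>{1..<p}. of_nat c - x) (fact (p - 1))"
proof -
  define U where "U = (\<lambda>x::rat. \<Prod>c\<in>{1..<p}. of_nat c - x)"
  have U0: "U 0 = fact (p - 1)"
  proof -
    have "{1..<p} = {1..p - 1}"
      using p_pos by auto
    then show ?thesis
      by (simp add: U_def fact_prod)
  qed
  have U: "U y \<in> zunit p" if "y \<in> zmax" for y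
    unfolding U_def using that by (intro zunit_prod zunit_of_nat_diff) auto
  \<comment> \<open>The product (c - x) (p - c - x) equals c (p - c) + x (x - p), and
    \<open>p ^ 2\<close> divides the second summand.\<close>
  obtain w where w: "w \<in> zloc p" "x * (x - of_nat p) = of_nat p ^ 2 * w"
    using zmax_sq_mult[of x "x - of_nat p"] assms by auto
  define b where "b = (\<lambda>c::nat. w / (of_nat c * of_nat (p - c)))"
  have bu: "of_nat c * of_nat (p - c) \<in> zunit p" if "c \<in> {1..<p}" for c
    using that by (intro zunit_mult zunit_of_nat) auto
  have bz: "b c \<in> zloc p" if "c \<in> {1..<p}" for c
    unfolding b_def using w bu[OF that] by blast
  have rev: "(\<Prod>c\<in>{1..<p}. g (p - c)) = (\<Prod>c\<in>{1..<p}. g c)" for g :: "nat \<Rightarrow> rat"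
    by (rule prod.reindex_bij_witness[of _ "\<lambda>c. p - c" "\<lambda>c. p - c"]) auto
  have sq: "U y * U y = (\<Prod>c\<in>{1..<p}. (of_nat c - y) * (of_nat (p - c) - y))" for y
    unfolding prod.distrib U_def using rev[of "\<lambda>c. of_nat c - y"] by simp
  have bsum: "qcong p 1 (\<Sum>c\<in>{1..<p}. b c) 0"
  proof -
    have "qcong p 1 (\<Sum>c\<in>{1..<p}. b c) (\<Sum>c\<in>{1..<p}. (- w) * (1 / of_nat c ^ 2))"
    proof (rule qcong_sum)
      fix c assume c: "c \<in> {1..<p}"
      have "qcong p 1 (of_nat c * of_nat (p - c)) (- (of_nat c ^ 2))"
        using c by (intro qcongI[of "of_nat c"]) (auto simp: of_nat_diff algebra_simps power2_eq_square)
      then have "qcong p 1 (w / (of_nat c * of_nat (p - c))) (w / (- (of_nat c ^ 2)))"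
        using w c bu[OF c] by (intro qcong_divide zunit_uminus zunit_power zunit_of_nat) auto
      then show "qcong p 1 (b c) (- w * (1 / of_nat c ^ 2))"
        by (simp add: b_def)
    qed
    also have "(\<Sum>c\<in>{1..<p}. (- w) * (1 / of_nat c ^ 2)) = (- w) * (\<Sum>c\<in>{1..<p}. 1 / of_nat c ^ 2)"
      by (rule sum_distrib_left [symmetric])
    also have "qcong p 1 \<dots> (- w * 0)"
      using w assms by (intro qcong_lmult inverse_squares_sum) auto
    finally show ?thesis
      by simp
  qed
  have "U x * U x = (\<Prod>c\<in>{1..<p}. (of_nat c * of_nat (p - c)) * (1 + of_nat p ^ 2 * b c))"
    unfolding sq
  proof (rule prod.cong)
    fix c assume c: "c \<in> {1..<p}"
    have "(of_nat c - x) * (of_nat (p - c) - x) = of_nat c * of_nat (p - c) + x * (x - of_nat p)"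
      using c by (simp add: of_nat_diff algebra_simps)
    also have "\<dots> = of_nat c * of_nat (p - c) + of_nat p ^ 2 * w"
      by (simp add: w)
    also have "\<dots> = (of_nat c * of_nat (p - c)) * (1 + of_nat p ^ 2 * b c)"
      unfolding b_def using bu[OF c, THEN zunit_nz] by (simp add: field_simps)
    finally show "(of_nat c - x) * (of_nat (p - c) - x) = of_nat c * of_nat (p - c) * (1 + of_nat p ^ 2 * b c)" .
  qed simp
  also have "\<dots> = U 0 * U 0 * (\<Prod>c\<in>{1..<p}. 1 + of_nat p ^ 2 * b c)"
    using sq[of 0] by (simp add: prod.distrib)
  also have "qcong p 3 \<dots> (U 0 * U 0 * (1 + of_nat p ^ 2 * (\<Sum>c\<in>{1..<p}. b c)))"
    using U[of 0] bz by (intro qcong_lmult prod_perturb) auto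
  also have "qcong p 3 \<dots> (U 0 * U 0 * (1 + of_nat p ^ 2 * 0))"
    using U[of 0] by (intro qcong_lmult qcong_add[OF qcong_refl] qcong_p2_mult[OF bsum]) auto
  finally have "qcong p 3 (U x * U x) (U 0 * U 0)"
    by simp
  then have "qcong p 3 (U x * U x - U 0 * U 0) (U 0 * U 0 - U 0 * U 0)"
    by (intro qcong_diff) auto
  then have "qcong p 3 ((U x + U 0) * (U x - U 0)) ((U x + U 0) * 0)"
    by (simp add: algebra_simps)
  \<comment> \<open>To pass from the squares to the values, the sum of the two values must be a
    unit; it is congruent to \<open>2 * U 0\<close> modulo \<open>p\<close>.\<close>
  moreover have "U x + U 0 \<in> zunit p"
  proof (rule zunit_qcong)
    have "qcong p 1 (U x) (U 0)"
      unfolding U_def using assms qcong_zmax[of x] by (intro qcong_prod qcong_diff) auto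
    then show "qcong p 1 (U x + U 0) (2 * U 0)"
      using qcong_add[of 1 "U x" "U 0" "U 0" "U 0"] by simp
    show "2 * U 0 \<in> zunit p"
      using zunit_of_nat[of 2] assms U[of 0] by auto
  qed auto
  ultimately have "qcong p 3 (U x - U 0) 0"
    using qcong_cancel by blast
  then have "qcong p 3 (U x) (U 0)"
    by (simp add: qcong_def)
  then show ?thesis
    using U0 unfolding U_def by simp
qed

text \<open>This fails for \<open>p = 3\<close>, where the logarithm of the gamma function has a cubic term that does not
  vanish modulo 27.\<close>

lemma gam_add_zmax:
  assumes "p \<ge> 5" "x \<in> zmax" "y \<in> zmax"
  shows "qcong p 3 (gam (x + y)) (gam x * gam y)"
proof -
  \<comment> \<open>The value of the gamma function at \<open>p\<close>. Modulo \<open>p ^ 3\<close>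
    its value at a multiple \<open>p * q\<close> is \<open>w ^ q\<close>, and every element of
    \<open>zmax\<close> is congruent to such a multiple.\<close>
  define w where "w = - (fact (p - 1) :: rat)"
  have w: "w \<in> zunit p"
    using p_pos by (auto simp: w_def intro!: zunit_uminus fact_zunit)
  have step: "qcong p 3 (gam (x + of_nat p)) (w * gam x)" if "x \<in> zmax" for x
  proof -
    have "qcong p 3 (gam (x + of_nat (Suc (p - 1)))) ((- 1) ^ Suc (p - 1) * gam x * pochhammer (1 + x) (p - 1))"
      using that p_pos by (intro gam_up) auto
    also have "pochhammer (1 + x) (p - 1) = (\<Prod>c\<in>{1..<p}. of_nat c - (- x))"
      unfolding pochhammer_prod
      by (rule prod.reindex_bij_witness[of _ "\<lambda>c. c - 1" Suc]) (auto simp: algebra_simps of_nat_diff)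
    also have "(- 1) ^ Suc (p - 1) * gam x * \<dots> = (- gam x) * \<dots>"
      using p_odd p_pos by simp
    also have "qcong p 3 \<dots> ((- gam x) * fact (p - 1))"
      using assms that by (intro qcong_lmult wolstenholme_prod) auto
    finally show ?thesis
      using p_pos by (simp add: w_def mult.commute)
  qed
  have pow: "qcong p 3 (gam (of_nat p * of_nat q)) (w ^ q)" for q
  proof (induction q)
    case 0
    then show ?case
      using gam_0 by simp
  next
    case (Suc q)
    have "qcong p 3 (gam (of_nat p * of_nat q + of_nat p)) (w * gam (of_nat p * of_nat q))"
      by (intro step zmaxI) auto
    also have "qcong p 3 \<dots> (w * w ^ q)"
      using Suc w by (intro qcong_lmult) auto
    finally show ?case
      by (simp add: algebra_simps)
  qed
  have rep: "\<exists>q. qcong p 3 x (of_nat p * of_nat q)" if x: "x \<in> zmax" for x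
  proof -
    obtain z where z: "z \<in> zloc p" "x = of_nat p * z"
      using x by (auto simp: zmax_def)
    obtain q where "qcong p 3 z (of_nat q)"
      using qcong_ex_nat z by blast
    then show ?thesis
      using z qcong_lmult[of 3 z "of_nat q" "of_nat p"] by auto
  qed
  obtain q r where q: "qcong p 3 x (of_nat p * of_nat q)" and r: "qcong p 3 y (of_nat p * of_nat r)"
    using rep assms by metis
  have "qcong p 3 (gam (x + y)) (gam (of_nat p * of_nat (q + r)))"
    using qcong_add[OF q r] by (intro gam_qcong) (auto simp: algebra_simps)
  also have "qcong p 3 \<dots> (w ^ (q + r))"
    by (rule pow)
  also have "\<dots> = w ^ q * w ^ r"
    by (rule power_add)
  also have "qcong p 3 \<dots> (gam (of_nat p * of_nat q) * gam (of_nat p * of_nat r))"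
    using w by (intro qcong_mult qcong_sym[OF pow]) auto
  also have "qcong p 3 \<dots> (gam x * gam y)"
    using q r by (intro qcong_mult qcong_sym[OF gam_qcong]) auto
  finally show ?thesis .
qed

end

section \<open>Interpolation and hypergeometric factors\<close>

text \<open>The sum is the top coefficient of the Lagrange interpolant, because the basis products
  are monic of degree \<open>card X - 1\<close>. The interpolant equals \<open>P\<close>, since a
  nonzero difference would have more roots than its degree allows.\<close>

lemma lagrange_leading_coeff:
  fixes P :: "'a::field poly"
  assumes "finite X" "X \<noteq> {}" "degree P < card X"
  shows "(\<Sum>x\<in>X. poly P x / (\<Prod>y\<in>X - {x}. x - y)) = coeff P (card X - 1)"
proof -
  define L where "L = (\<lambda>x. \<Prod>y\<in>X - {x}. [:- y, 1:])"
  define Q where "Q = (\<Sum>x\<in>X. smult (poly P x / (\<Prod>y\<in>X - {x}. x - y)) (L x))"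
  have degL: "degree (L x) = card X - 1" and leadL: "coeff (L x) (card X - 1) = 1" if "x \<in> X" for x
  proof -
    have "degree (L x) = (\<Sum>y\<in>X - {x}. degree [:- y, 1:])"
      unfolding L_def by (rule degree_prod_eq_sum_degree) auto
    then show d: "degree (L x) = card X - 1"
      using that assms by simp
    have "lead_coeff (L x) = (\<Prod>y\<in>X - {x}. lead_coeff [:- y, 1:])"
      unfolding L_def by (rule lead_coeff_prod)
    then show "coeff (L x) (card X - 1) = 1"
      by (simp add: d)
  qed
  have "poly (P - Q) z = 0" if z: "z \<in> X" for z
  proof -
    have "poly Q z = (\<Sum>x\<in>X. if x = z then poly P z else 0)"
      unfolding Q_def poly_sum
    proof (rule sum.cong)
      fix x assume x: "x \<in> X"
      have "poly (L x) z = (\<Prod>y\<in>X - {x}. z - y)"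
        by (simp add: L_def poly_prod)
      moreover have "(\<Prod>y\<in>X - {x}. z - y) = 0" if "x \<noteq> z"
        using that z assms by (intro prod_zero) auto
      moreover have "(\<Prod>y\<in>X - {z}. z - y) \<noteq> 0"
        using assms by simp
      ultimately show "poly (smult (poly P x / (\<Prod>y\<in>X - {x}. x - y)) (L x)) z = (if x = z then poly P z else 0)"
        by auto
    qed simp
    then show ?thesis
      using z assms by simp
  qed
  moreover have "degree (P - Q) < card X"
  proof -
    have "degree Q \<le> card X - 1"
      unfolding Q_def using assms degL by (intro degree_sum_le) (auto intro: order_trans[OF degree_smult_le])
    then show ?thesis
      using assms degree_diff_le_max[of P Q] by (auto simp: card_gt_0_iff intro: le_less_trans)
  qed
  ultimately have "P - Q = 0"
  proof (rule_tac ccontr)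
    assume root: "\<And>z. z \<in> X \<Longrightarrow> poly (P - Q) z = 0" and d: "degree (P - Q) < card X" and nz: "P - Q \<noteq> 0"
    have "card X \<le> card {z. poly (P - Q) z = 0}"
      using root nz by (intro card_mono poly_roots_finite) auto
    also have "\<dots> \<le> degree (P - Q)"
      using nz by (rule card_poly_roots_bound)
    finally show False
      using d by simp
  qed
  then have "coeff P (card X - 1) = coeff Q (card X - 1)"
    by simp
  also have "\<dots> = (\<Sum>x\<in>X. poly P x / (\<Prod>y\<in>X - {x}. x - y))"
    unfolding Q_def coeff_sum by (intro sum.cong) (simp_all add: leadL[simplified])
  finally show ?thesis
    by simp
qed

lemma pochhammer_reflect:
  fixes c :: "'a::comm_ring_1"
  shows "pochhammer c m = (- 1) ^ m * pochhammer (1 - c - of_nat m) m"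
  using pochhammer_minus[of "- c" m] by (simp add: algebra_simps)

text \<open>Up to reflection of the symbols of length \<open>j\<close>, both sides are the run of
  factors from \<open>c - j\<close> to \<open>c + m - 1\<close>, cut after \<open>j\<close> or after
  \<open>m\<close> factors. The point is to move \<open>j\<close> from the length of a symbol into
  the argument of one of fixed length \<open>m\<close>, which is a polynomial in
  \<open>j\<close>.\<close>

lemma pochhammer_exchange:
  fixes c :: "'a::comm_ring_1"
  shows "pochhammer (1 - c) j * pochhammer c m
    = pochhammer (c - of_nat j) m * pochhammer (1 - c - of_nat m) j"
proof -
  have "pochhammer (1 - c) j * pochhammer c m = (- 1) ^ j * (pochhammer (c - of_nat j) j * pochhammer c m)"
    using pochhammer_reflect[of "1 - c" j] by simp
  also have "pochhammer (c - of_nat j) j * pochhammer c m = pochhammer (c - of_nat j) (m + j)"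
    using pochhammer_product'[of "c - of_nat j" j m] by (simp add: add.commute)
  also have "\<dots> = pochhammer (c - of_nat j) m * pochhammer (c - of_nat j + of_nat m) j"
    by (rule pochhammer_product')
  also have "pochhammer (c - of_nat j + of_nat m) j = (- 1) ^ j * pochhammer (1 - c - of_nat m) j"
    using pochhammer_reflect[of "c - of_nat j + of_nat m" j] by (simp add: algebra_simps)
  finally show ?thesis
    by (simp add: algebra_simps flip: power_mult_distrib)
qed

section \<open>Unit products at the interpolation nodes\<close>

context odd_prime
begin

definition unit_prod :: "rat \<Rightarrow> rat" where
  "unit_prod x = (\<Prod>c\<in>{1..<p}. of_nat c - x)"

text \<open>For \<open>x\<close> in \<open>zmax\<close> this is the product of all s - (j + x) with
  s < p, without its only nonunit factor. As \<open>p - 1\<close> is even, the orientation of the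
  differences is immaterial.\<close>

definition node_prod :: "nat \<Rightarrow> rat \<Rightarrow> rat" where
  "node_prod j x = (\<Prod>s\<in>{..<p} - {j}. of_nat s - of_nat j - x)"

lemma unit_prod_pochhammer: "unit_prod x = pochhammer (1 - x) (p - 1)"
  unfolding pochhammer_prod unit_prod_def
  by (rule prod.reindex_bij_witness[of _ Suc "\<lambda>c. c - 1"]) (auto simp: algebra_simps of_nat_diff)

lemma unit_prod_zunit: "x \<in> zmax \<Longrightarrow> unit_prod x \<in> zunit p"
  unfolding unit_prod_def by (intro zunit_prod zunit_of_nat_diff) auto

lemma unit_prod_qcong:
  assumes "p \<ge> 5" "x \<in> zmax" "y \<in> zmax"
  shows "qcong p 3 (unit_prod x) (unit_prod y)"
  unfolding unit_prod_def
  by (rule qcong_trans[OF wolstenholme_prod[OF assms(1,2)] qcong_sym[OF wolstenholme_prod[OF assms(1,3)]]])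

lemma node_prod_pochhammer:
  assumes "j < p"
  shows "node_prod j x = (- 1) ^ j * pochhammer (1 + x) j * pochhammer (1 - x) (p - 1 - j)"
proof -
  have "node_prod j x = (\<Prod>s\<in>{..<j} \<union> {j<..<p}. of_nat s - of_nat j - x)"
    unfolding node_prod_def using assms by (intro prod.cong) auto
  also have "\<dots> = (\<Prod>s\<in>{..<j}. of_nat s - of_nat j - x) * (\<Prod>s\<in>{j<..<p}. of_nat s - of_nat j - x)"
    by (intro prod.union_disjoint) auto
  also have "(\<Prod>s\<in>{..<j}. of_nat s - of_nat j - x) = (\<Prod>i\<in>{0..<j}. - (1 + x + of_nat i))"
    by (rule prod.reindex_bij_witness[of _ "\<lambda>c. j - 1 - c" "\<lambda>c. j - 1 - c"])
       (auto simp: algebra_simps of_nat_diff)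
  also have "\<dots> = (- 1) ^ j * pochhammer (1 + x) j"
    unfolding pochhammer_prod prod_uminus by simp
  also have "(\<Prod>s\<in>{j<..<p}. of_nat s - of_nat j - x) = pochhammer (1 - x) (p - 1 - j)"
    unfolding pochhammer_prod
    by (rule prod.reindex_bij_witness[of _ "\<lambda>c. c + j + 1" "\<lambda>c. c - j - 1"])
       (auto simp: algebra_simps of_nat_diff)
  finally show ?thesis .
qed

lemma node_prod_zunit: "j < p \<Longrightarrow> x \<in> zmax \<Longrightarrow> node_prod j x \<in> zunit p"
  using pochhammer_1_zunit[of "p - 1 - j" "- x"]
  by (auto simp: node_prod_pochhammer intro!: zunit_mult zunit_power zunit_uminus pochhammer_1_zunit)

text \<open>Raising the \<open>j\<close> factors below the gap by \<open>p\<close> turns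
  \<open>node_prod j x\<close> into the full \<open>unit_prod x\<close>; up to a common sign, the
  two symbols are these factors before and after the shift.\<close>

lemma node_prod_mult:
  assumes "j < p"
  shows "node_prod j x * pochhammer (1 + x - of_nat p) j = unit_prod x * pochhammer (1 + x) j"
proof -
  have "pochhammer (1 - x) (p - 1 - j) * pochhammer (1 - x + of_nat (p - 1 - j)) j = unit_prod x"
    unfolding unit_prod_pochhammer using assms pochhammer_product'[of "1 - x" "p - 1 - j" j] by simp
  moreover have "1 - x + of_nat (p - 1 - j) = of_nat p - x - of_nat j"
    using assms by (simp add: of_nat_diff algebra_simps)
  moreover have "pochhammer (1 + x - of_nat p) j = (- 1) ^ j * pochhammer (of_nat p - x - of_nat j) j"
    using pochhammer_reflect[of "1 + x - of_nat p" j] by (simp add: algebra_simps)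
  ultimately show ?thesis
    using assms by (simp add: node_prod_pochhammer algebra_simps flip: power_mult_distrib)
qed

lemma pochhammer_shift_zunit:
  assumes "j < p" "x \<in> zmax"
  shows "pochhammer (1 + x - of_nat p) j \<in> zunit p"
  using pochhammer_1_zunit[of j "x - of_nat p"] assms by (auto simp: algebra_simps)

lemma prod_perturb_qcong:
  assumes "finite A" "\<And>i. i \<in> A \<Longrightarrow> qcong p 1 (b i) (b' i)" "\<And>i. i \<in> A \<Longrightarrow> b' i \<in> zloc p"
  shows "qcong p 3 (\<Prod>i\<in>A. 1 + of_nat p ^ 2 * b i) (1 + of_nat p ^ 2 * (\<Sum>i\<in>A. b' i))"
proof -
  have "qcong p 3 (\<Prod>i\<in>A. 1 + of_nat p ^ 2 * b i) (1 + of_nat p ^ 2 * (\<Sum>i\<in>A. b i))"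
    using assms qcong_zloc by (intro prod_perturb) blast+
  also have "qcong p 3 \<dots> (1 + of_nat p ^ 2 * (\<Sum>i\<in>A. b' i))"
    using assms by (intro qcong_add[OF qcong_refl] qcong_p2_mult qcong_sum) auto
  finally show ?thesis .
qed

text \<open>The harmonic number of order 2. It measures the \<open>p ^ 2\<close> correction when a
  node product is moved by a multiple of \<open>p\<close>.\<close>

definition inv_sq_sum :: "nat \<Rightarrow> rat" where
  "inv_sq_sum j = (\<Sum>c\<in>{1..j}. 1 / of_nat c ^ 2)"

lemma inv_sq_zloc: "c \<in> {1..j} \<Longrightarrow> j < p \<Longrightarrow> 1 / of_nat c ^ 2 \<in> zloc p"
  by (intro zloc_divide zunit_power zunit_of_nat) auto

lemma inv_sq_sum_zloc: "j < p \<Longrightarrow> inv_sq_sum j \<in> zloc p"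
  unfolding inv_sq_sum_def using inv_sq_zloc by (intro zloc_sum) auto

lemma pochhammer_1_prod: "pochhammer (1 + x) j = (\<Prod>c\<in>{1..j}. of_nat c + x)"
  unfolding pochhammer_prod
  by (rule prod.reindex_bij_witness[of _ "\<lambda>c. c - 1" Suc]) (auto simp: algebra_simps)

text \<open>As \<open>unit_prod\<close> is constant modulo \<open>p ^ 3\<close>, only the quotients
  (c + x) / (c + x - p) vary with \<open>x\<close>. They are 1 + O(p), so a move of \<open>x\<close>
  by a multiple of \<open>p\<close> changes them only by multiples of \<open>p ^ 2\<close>.\<close>

lemma node_prod_expand:
  assumes "p \<ge> 5" "j < p" "t \<in> zloc p"
  shows "qcong p 3 (node_prod j (of_nat p * t)) (node_prod j 0 * (1 - of_nat p ^ 2 * (t * inv_sq_sum j)))"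
proof -
  define x where "x = of_nat p * t"
  have x: "x \<in> zmax"
    using assms by (auto simp: x_def intro: zmaxI)
  \<comment> \<open>Compared with x = 0, the quotient for \<open>c\<close> changes by the factor 1 -
    p x / (c (c + x - p)), and p x = p^2 t.\<close>
  define b where "b = (\<lambda>c::nat. - t / (of_nat c * (of_nat c + (x - of_nat p))))"
  have eq: "node_prod j y = unit_prod y * pochhammer (1 + y) j / pochhammer (1 + y - of_nat p) j" if "y \<in> zmax" for y
    using node_prod_mult[OF assms(2), of y] pochhammer_shift_zunit[OF assms(2) that, THEN zunit_nz]
    by (simp add: field_simps)
  have u1: "of_nat c \<in> zunit p" and u2: "of_nat c + (x - of_nat p) \<in> zunit p"
    and u3: "of_nat c - of_nat p \<in> zunit p" if "c \<in> {1..j}" for c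
    using that assms x zunit_of_nat_diff[of c "of_nat p"]
    by (auto intro!: zunit_of_nat zunit_of_nat_add)
  have split: "pochhammer (1 + x) j / pochhammer (1 + x - of_nat p) j
      = pochhammer 1 j / pochhammer (1 - of_nat p) j * (\<Prod>c\<in>{1..j}. 1 + of_nat p ^ 2 * b c)"
  proof -
    have "(\<Prod>c\<in>{1..j}. (of_nat c + x) / (of_nat c + (x - of_nat p)))
        = (\<Prod>c\<in>{1..j}. (of_nat c + 0) / (of_nat c + (- of_nat p)) * (1 + of_nat p ^ 2 * b c))"
    proof (rule prod.cong)
      fix c assume c: "c \<in> {1..j}"
      define X where "X = of_nat c + (x - of_nat p)"
      have "X \<noteq> 0" "of_nat c \<noteq> (0::rat)" "of_nat c - of_nat p \<noteq> (0::rat)"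
        using u1[OF c] u2[OF c] u3[OF c] zunit_nz unfolding X_def by blast+
      moreover have "of_nat c + x = X + of_nat p" "of_nat p * x = of_nat p ^ 2 * t"
        "x = X + of_nat p - of_nat c"
        by (simp_all add: X_def x_def power2_eq_square)
      ultimately show "(of_nat c + x) / (of_nat c + (x - of_nat p))
          = (of_nat c + 0) / (of_nat c + (- of_nat p)) * (1 + of_nat p ^ 2 * b c)"
        unfolding b_def X_def[symmetric] by (simp add: field_simps) algebra
    qed simp
    then show ?thesis
      unfolding pochhammer_1_prod[of 0, simplified] pochhammer_1_prod add_diff_eq[symmetric]
      using pochhammer_1_prod[of "- (of_nat p :: rat)" j]
      by (simp add: prod_dividef prod.distrib)
  qed
  have c0: "pochhammer 1 j / pochhammer (1 - of_nat p) j \<in> zloc p"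
    using pochhammer_shift_zunit[of j 0] assms by (intro zloc_divide zloc_pochhammer) auto
  have "node_prod j x = unit_prod x * (pochhammer 1 j / pochhammer (1 - of_nat p) j * (\<Prod>c\<in>{1..j}. 1 + of_nat p ^ 2 * b c))"
    unfolding eq[OF x] split[symmetric] by simp
  also have "qcong p 3 \<dots> (unit_prod 0 * (pochhammer 1 j / pochhammer (1 - of_nat p) j
      * (1 + of_nat p ^ 2 * (\<Sum>c\<in>{1..j}. - t * (1 / of_nat c ^ 2)))))"
  proof (intro qcong_mult qcong_refl prod_perturb_qcong)
    show "qcong p 3 (unit_prod x) (unit_prod 0)"
      using assms x by (intro unit_prod_qcong) auto
    show "qcong p 1 (b c) (- t * (1 / of_nat c ^ 2))" if c: "c \<in> {1..j}" for c
    proof -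
      have "qcong p 1 (of_nat c + (x - of_nat p)) (of_nat c + 0)"
        using x by (intro qcong_add qcong_refl qcong_zmax) auto
      then have "qcong p 1 (of_nat c * (of_nat c + (x - of_nat p))) (of_nat c ^ 2)"
        unfolding power2_eq_square by (intro qcong_lmult) auto
      then have "qcong p 1 (- t / (of_nat c * (of_nat c + (x - of_nat p)))) (- t / of_nat c ^ 2)"
        using assms u1[OF c] u2[OF c] by (intro qcong_divide zunit_mult zunit_power) auto
      then show ?thesis
        by (simp add: b_def)
    qed
    show "- t * (1 / of_nat c ^ 2) \<in> zloc p" if "c \<in> {1..j}" for c
      using assms inv_sq_zloc[OF that] by (intro zloc_mult zloc_uminus) auto
    show "pochhammer 1 j / pochhammer (1 - of_nat p) j * (\<Prod>c = 1..j. 1 + (rat_of_nat p)\<^sup>2 * b c) \<in> zloc p"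
      unfolding split[symmetric] using x assms
      by (intro zloc_divide zloc_pochhammer pochhammer_shift_zunit) auto
    show "(\<Prod>c = 1..j. 1 + (rat_of_nat p)\<^sup>2 * b c) \<in> zloc p"
      unfolding b_def using u1 u2 assms
      by (intro zloc_prod zloc_add zloc_mult zloc_divide zunit_mult zloc_power) auto
  qed (use c0 unit_prod_zunit[of 0] in auto)
  also have "(\<Sum>c\<in>{1..j}. - t * (1 / of_nat c ^ 2)) = - t * inv_sq_sum j"
    unfolding inv_sq_sum_def by (rule sum_distrib_left [symmetric])
  also have "unit_prod 0 * (pochhammer 1 j / pochhammer (1 - of_nat p) j * (1 + of_nat p ^ 2 * (- t * inv_sq_sum j)))
      = node_prod j 0 * (1 - of_nat p ^ 2 * (t * inv_sq_sum j))"
    unfolding eq[OF zmax_0] by simp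
  finally show ?thesis
    by (simp add: x_def)
qed

section \<open>Continued factors of the hypergeometric term\<close>

lemma zunit_factor: "x * y \<in> zunit p \<Longrightarrow> x \<in> zloc p \<Longrightarrow> y \<in> zloc p \<Longrightarrow> x \<in> zunit p"
proof -
  assume xy: "x * y \<in> zunit p" and x: "x \<in> zloc p" and y: "y \<in> zloc p"
  have "inverse x = y * inverse (x * y)"
    using zunit_nz[OF xy] by simp
  moreover have "inverse (x * y) \<in> zloc p"
    using zunit_inverse[OF xy] by blast
  ultimately have "inverse x \<in> zloc p"
    using y zloc_mult by metis
  then show "x \<in> zunit p"
    using x zunit_nz[OF xy] by (simp add: zunit_def)
qed

text \<open>The factor \<open>pochhammer a j / fact j\<close> of the series continued from \<open>j\<close> to \<open>j + x\<close>,
  where \<open>m\<close> is the residue of \<open>- a\<close>.\<close>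

definition hyp_factor :: "rat \<Rightarrow> nat \<Rightarrow> nat \<Rightarrow> rat \<Rightarrow> rat" where
  "hyp_factor a m j x = pochhammer a m * pochhammer (a + x) j / (pochhammer (a + x) m * pochhammer (1 + x) j)"

text \<open>Reflection of the first symbol makes the two run through consecutive factors, together a
  whole \<open>unit_prod\<close>. This is why a parameter \<open>a\<close> is treated together with
  \<open>1 - a\<close>.\<close>

lemma pochhammer_pair:
  assumes "m < p"
  shows "pochhammer (a + x) m * pochhammer (1 - a - x) (p - 1 - m)
    = (- 1) ^ m * unit_prod (a + of_nat m + x)"
proof -
  have "pochhammer (a + x) m = (- 1) ^ m * pochhammer (1 - (a + of_nat m + x)) m"
    using pochhammer_reflect[of "a + x" m] by (simp add: algebra_simps)
  moreover have "pochhammer (1 - (a + of_nat m + x)) (p - 1)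
      = pochhammer (1 - (a + of_nat m + x)) m * pochhammer (1 - (a + of_nat m + x) + of_nat m) (p - 1 - m)"
    using assms by (intro pochhammer_product) auto
  moreover have "1 - (a + of_nat m + x) + of_nat m = 1 - a - x"
    by simp
  ultimately show ?thesis
    by (simp add: unit_prod_pochhammer)
qed

lemma pochhammer_residue_zunit:
  assumes "m < p" "a \<in> zloc p" "a + of_nat m \<in> zmax" "x \<in> zmax"
  shows "pochhammer (a + x) m \<in> zunit p"
proof (rule zunit_factor)
  show "pochhammer (a + x) m * pochhammer (1 - a - x) (p - 1 - m) \<in> zunit p"
    unfolding pochhammer_pair[OF assms(1)] using assms
    by (intro zunit_mult zunit_power zunit_uminus unit_prod_zunit) auto
qed (use assms in auto)

lemma hyp_factor_zloc:
  assumes "m < p" "a \<in> zloc p" "a + of_nat m \<in> zmax" "x \<in> zmax" "j < p"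
  shows "hyp_factor a m j x \<in> zloc p"
  unfolding hyp_factor_def using assms
  by (intro zloc_divide zunit_mult zloc_mult zloc_pochhammer pochhammer_residue_zunit pochhammer_1_zunit) auto

lemma hyp_factor_0:
  assumes "m < p" "a \<in> zloc p" "a + of_nat m \<in> zmax"
  shows "hyp_factor a m j 0 = pochhammer a j / fact j"
  using pochhammer_residue_zunit[OF assms, of 0, THEN zunit_nz]
  by (simp add: hyp_factor_def pochhammer_fact)

text \<open>An identity of rationals. Exchange turns the symbols of length \<open>j\<close> into
  polynomials in \<open>j + x\<close>; the denominators so created combine with those of
  \<open>hyp_factor\<close> to unit products at \<open>b + x\<close> and \<open>b - x\<close>. What
  is left over is a product of factors 1 + O(p^2).\<close>

lemma hyp_factor_pair_exact:
  assumes "p \<ge> 5" "m < p" "j < p" "a \<in> zloc p" "a + of_nat m \<in> zmax" "x \<in> zmax"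
  defines "b \<equiv> a + of_nat m"
  shows "hyp_factor a m j x * hyp_factor (1 - a) (p - 1 - m) j x
    = unit_prod b * unit_prod x / (unit_prod (b + x) * unit_prod (b - x))
      * ((- 1) ^ m * pochhammer (a - of_nat j - x) m * pochhammer (1 - a - of_nat j - x) (p - 1 - m)
        / node_prod j x)
      * (\<Prod>c\<in>{1..j}. 1 + b * (of_nat p - b) / ((of_nat c + x) * (of_nat c + x - of_nat p)))"
proof -
  define m' where "m' = p - 1 - m"
  define A where "A = pochhammer (a - of_nat j - x) m"
  define A' where "A' = pochhammer (1 - a - of_nat j - x) m'"
  define D1 where "D1 = pochhammer (a + x) m"
  define D2 where "D2 = pochhammer (1 - a - x) m'"
  define D3 where "D3 = pochhammer (a - x) m"
  define D4 where "D4 = pochhammer (1 - a + x) m'"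
  define e where "e = pochhammer (1 + x) j"
  define q where "q = pochhammer (1 + x - b) j"
  \<comment> \<open>For the parameter \<open>1 - a\<close> with residue \<open>m'\<close>, the
    element \<open>b\<close> becomes \<open>p - b\<close>.\<close>
  define q' where "q' = pochhammer (1 + x - (of_nat p - b)) j"
  define w where "w = pochhammer (1 + x - of_nat p) j"
  define W where "W = node_prod j x"
  have m'p: "m' < p" and m'': "p - 1 - m' = m" and mm: "of_nat m' = of_nat p - 1 - (of_nat m :: rat)"
    using assms by (auto simp: m'_def of_nat_diff)
  have F1: "pochhammer (1 - a + x) j * D3 = A * q"
    using pochhammer_exchange[of "a - x" j m] by (simp add: A_def D3_def q_def b_def algebra_simps)
  have F1': "pochhammer (a + x) j * D2 = A' * q'"
    using pochhammer_exchange[of "1 - a - x" j m'] mm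
    by (simp add: A'_def D2_def q'_def b_def algebra_simps)
  have F2: "D1 * D2 = (- 1) ^ m * unit_prod (b + x)"
    using pochhammer_pair[OF assms(2)] by (simp add: D1_def D2_def m'_def b_def)
  have F2': "D3 * D4 = (- 1) ^ m * unit_prod (b - x)"
    using pochhammer_pair[OF assms(2), of a "- x"] by (simp add: D3_def D4_def m'_def b_def)
  have F2'': "pochhammer a m * pochhammer (1 - a) m' = (- 1) ^ m * unit_prod b"
    using pochhammer_pair[OF assms(2), of a 0] by (simp add: m'_def b_def)
  have F3: "W * w = unit_prod x * e"
    using node_prod_mult[OF assms(3)] by (simp add: W_def w_def e_def)
  have "b \<in> zmax"
    using assms by simp
  then have nz: "unit_prod (b + x) \<noteq> 0" "unit_prod (b - x) \<noteq> 0" "unit_prod x \<noteq> 0" "W \<noteq> 0" "e \<noteq> 0" "w \<noteq> 0"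
    unfolding W_def e_def w_def using assms
    by (auto intro!: zunit_nz unit_prod_zunit node_prod_zunit pochhammer_1_zunit pochhammer_shift_zunit)
  then have nzD: "D1 \<noteq> 0" "D2 \<noteq> 0" "D3 \<noteq> 0" "D4 \<noteq> 0"
    using F2 F2' by auto
  have Q: "q * q' / (e * w) = (\<Prod>c\<in>{1..j}. 1 + b * (of_nat p - b) / ((of_nat c + x) * (of_nat c + x - of_nat p)))"
  proof -
    have "q * q' / (e * w) = (\<Prod>c\<in>{1..j}. ((of_nat c + (x - b)) * (of_nat c + (x - (of_nat p - b))))
        / ((of_nat c + x) * (of_nat c + (x - of_nat p))))"
      unfolding q_def q'_def e_def w_def add_diff_eq[symmetric] pochhammer_1_prod
      by (simp add: prod_dividef prod.distrib)
    \<comment> \<open>With X = c + x, the numerator (X - b) (X - p + b) is X (X - p) + b (p -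
      b).\<close>
    also have "\<dots> = (\<Prod>c\<in>{1..j}. 1 + b * (of_nat p - b) / ((of_nat c + x) * (of_nat c + x - of_nat p)))"
    proof (rule prod.cong)
      fix c assume c: "c \<in> {1..j}"
      have "of_nat c + x \<noteq> 0" "of_nat c + (x - of_nat p) \<noteq> 0"
        using c assms by (auto intro!: zunit_nz zunit_of_nat_add)
      moreover define X where "X = of_nat c + x"
      ultimately have "X \<noteq> 0" "X - of_nat p \<noteq> 0"
        by auto
      then show "((of_nat c + (x - b)) * (of_nat c + (x - (of_nat p - b))))
        / ((of_nat c + x) * (of_nat c + (x - of_nat p)))
        = 1 + b * (of_nat p - b) / ((of_nat c + x) * (of_nat c + x - of_nat p))"
        unfolding add_diff_eq X_def[symmetric] by (simp add: field_simps)
    qed simp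
    finally show ?thesis .
  qed
  have "hyp_factor a m j x * hyp_factor (1 - a) m' j x
      = (pochhammer a m * pochhammer (1 - a) m') * (pochhammer (a + x) j * pochhammer (1 - a + x) j)
        / (D1 * D4 * e * e)"
    by (simp add: hyp_factor_def D1_def D4_def e_def mult_ac)
  also have "pochhammer (a + x) j = A' * q' / D2"
    using F1' nzD by (simp add: field_simps)
  also have "pochhammer (1 - a + x) j = A * q / D3"
    using F1 nzD by (simp add: field_simps)
  also have "pochhammer a m * pochhammer (1 - a) m' * (A' * q' / D2 * (A * q / D3)) / (D1 * D4 * e * e)
      = ((- 1) ^ m * unit_prod b) * (A' * q' * A * q) / ((D1 * D2) * (D3 * D4) * e * e)"
    unfolding F2'' by (simp add: mult_ac)
  also have "\<dots> = unit_prod b * ((- 1) ^ m * A * A') * (q * q') / (unit_prod (b + x) * unit_prod (b - x) * e * e)"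
  proof -
    define sg where "sg = (- 1 :: rat) ^ m"
    have "sg * sg = 1"
      by (simp add: sg_def flip: power_mult_distrib)
    then have "(sg * y) * (sg * z) = y * z" for y z
      by (metis mult.assoc mult.left_commute mult_1)
    then have D: "(sg * unit_prod (b + x)) * (sg * unit_prod (b - x)) = unit_prod (b + x) * unit_prod (b - x)" .
    show ?thesis
      unfolding F2 F2' sg_def[symmetric] D by (simp only: mult_ac)
  qed
  also have "\<dots> = unit_prod b * (W * w / e) / (unit_prod (b + x) * unit_prod (b - x))
      * ((- 1) ^ m * A * A' / W) * (q * q' / (e * w))"
    using nz by (simp add: field_simps)
  also have "W * w / e = unit_prod x"
    using F3 nz by (simp add: field_simps)
  finally show ?thesis
    unfolding Q by (simp add: A_def A'_def W_def m'_def)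
qed

text \<open>Modulo \<open>p ^ 3\<close> the four unit products cancel. In the leftover product b (p
  - b) already supplies \<open>p ^ 2\<close>, so its denominators matter only modulo
  \<open>p\<close>, where \<open>x\<close> disappears. Hence one \<open>k\<close> serves all
  \<open>x\<close>.\<close>

lemma hyp_factor_pair:
  assumes "p \<ge> 5" "m < p" "j < p" "a \<in> zloc p" "a + of_nat m \<in> zmax"
  shows "\<exists>k\<in>zloc p. \<forall>x\<in>zmax. qcong p 3 (hyp_factor a m j x * hyp_factor (1 - a) (p - 1 - m) j x)
    ((1 + of_nat p ^ 2 * k) * ((- 1) ^ m * pochhammer (a - of_nat j - x) m
       * pochhammer (1 - a - of_nat j - x) (p - 1 - m) / node_prod j x))"
proof -
  define b where "b = a + of_nat m"
  have b: "b \<in> zmax"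
    using assms by (simp add: b_def)
  obtain v where v: "v \<in> zloc p" "b * (of_nat p - b) = of_nat p ^ 2 * v"
    using zmax_sq_mult[of b "of_nat p - b"] b by auto
  define k where "k = (\<Sum>c\<in>{1..j}. v * (1 / of_nat c ^ 2))"
  have kz: "v * (1 / of_nat c ^ 2) \<in> zloc p" if "c \<in> {1..j}" for c
    using v inv_sq_zloc[OF that assms(3)] by blast
  have "qcong p 3 (hyp_factor a m j x * hyp_factor (1 - a) (p - 1 - m) j x)
    ((1 + of_nat p ^ 2 * k) * ((- 1) ^ m * pochhammer (a - of_nat j - x) m
       * pochhammer (1 - a - of_nat j - x) (p - 1 - m) / node_prod j x))" if x: "x \<in> zmax" for x
  proof -
    define M where "M = (- 1) ^ m * pochhammer (a - of_nat j - x) m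
       * pochhammer (1 - a - of_nat j - x) (p - 1 - m) / node_prod j x"
    define V where "V = unit_prod b * unit_prod x / (unit_prod (b + x) * unit_prod (b - x))"
    define \<beta> where "\<beta> = (\<lambda>c::nat. v / ((of_nat c + x) * (of_nat c + (x - of_nat p))))"
    have u: "of_nat c + x \<in> zunit p" "of_nat c + (x - of_nat p) \<in> zunit p" if "c \<in> {1..j}" for c
      using that assms x by (auto intro!: zunit_of_nat_add)
    have "a - of_nat j - x \<in> zloc p" "1 - a - of_nat j - x \<in> zloc p"
      using assms x by auto
    then have M: "M \<in> zloc p"
      unfolding M_def using assms x
      by (intro zloc_divide node_prod_zunit zloc_mult zloc_pochhammer zloc_neg_one_power) auto
    have "qcong p 3 V (unit_prod b * unit_prod b / (unit_prod b * unit_prod b))"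
      unfolding V_def using assms b x
      by (intro qcong_divide qcong_mult qcong_refl unit_prod_qcong zloc_mult zunit_mult
          zunit_imp_zloc unit_prod_zunit) auto
    then have V: "qcong p 3 V 1"
      using unit_prod_zunit[OF b, THEN zunit_nz] by simp
    have "hyp_factor a m j x * hyp_factor (1 - a) (p - 1 - m) j x
        = V * M * (\<Prod>c\<in>{1..j}. 1 + of_nat p ^ 2 * \<beta> c)"
      using hyp_factor_pair_exact[OF assms x] v(2)
      by (simp add: b_def[symmetric] V_def M_def \<beta>_def add_diff_eq)
    also have "qcong p 3 \<dots> (1 * M * (1 + of_nat p ^ 2 * k))"
    proof (rule qcong_mult)
      show "qcong p 3 (V * M) (1 * M)"
        using V M by (rule qcong_rmult)
      show "qcong p 3 (\<Prod>c\<in>{1..j}. 1 + of_nat p ^ 2 * \<beta> c) (1 + of_nat p ^ 2 * k)"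
        unfolding k_def
      proof (rule prod_perturb_qcong)
        fix c assume c: "c \<in> {1..j}"
        have "qcong p 1 (of_nat c + x) (of_nat c + 0)" "qcong p 1 (of_nat c + (x - of_nat p)) (of_nat c + 0)"
          using x by (intro qcong_add qcong_refl qcong_zmax; auto)+
        then have "qcong p 1 ((of_nat c + x) * (of_nat c + (x - of_nat p))) ((of_nat c + 0) * (of_nat c + 0))"
          using x by (intro qcong_mult) auto
        then have "qcong p 1 (\<beta> c) (v / ((of_nat c + 0) * (of_nat c + 0)))"
          unfolding \<beta>_def using u[OF c] v c assms
          by (intro qcong_divide qcong_refl zunit_mult) (auto intro!: zunit_of_nat)
        then show "qcong p 1 (\<beta> c) (v * (1 / of_nat c ^ 2))"
          by (simp add: power2_eq_square)
        show "v * (1 / of_nat c ^ 2) \<in> zloc p"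
          using kz c by blast
      qed simp
      show "1 * M \<in> zloc p"
        using M by simp
      show "(\<Prod>c\<in>{1..j}. 1 + of_nat p ^ 2 * \<beta> c) \<in> zloc p"
        unfolding \<beta>_def using u v
        by (intro zloc_prod zloc_add zloc_mult zloc_divide zunit_mult zloc_power) auto
    qed
    finally show ?thesis
      unfolding M_def by (simp add: mult.commute)
  qed
  moreover have "k \<in> zloc p"
    unfolding k_def using kz by (rule zloc_sum)
  ultimately show ?thesis
    by blast
qed

section \<open>Interpolation at the nodes j and j / (1 - p)\<close>

lemma one_minus_p_zunit: "1 - of_nat p \<in> zunit p"
  using zunit_of_nat_diff[of 1 "of_nat p"] p_ge_3 by simp

text \<open>At the node j v, the nodes s contribute \<open>node_prod j\<close> at j v p, because j +
  j v p = j v, and the nodes s v a scaled \<open>node_prod j 0\<close>. At the node j, the former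
  contribute \<open>node_prod j 0\<close> and the latter a scaled \<open>node_prod j\<close> at - j
  p, because j = v (j - j p). The distance j v - j = j v p gives the common factor
  \<open>p\<close>.\<close>

lemma lagrange_nodes:
  fixes P :: "rat poly"
  assumes "degree P \<le> 2 * (p - 1)"
  defines "v \<equiv> 1 / (1 - of_nat p)"
  shows "(\<Sum>j<p. v * poly P (of_nat j * v) / (node_prod j 0 * node_prod j (of_nat j * v * of_nat p))
            - poly P (of_nat j) / (node_prod j 0 * node_prod j (- (of_nat j * of_nat p))))
    = of_nat p * v ^ p * coeff P (2 * (p - 1))"
proof -
  define A where "A = (of_nat ` {..<p} :: rat set)"
  define B where "B = (\<lambda>j. of_nat j * v) ` {1..<p}"
  have v0: "v \<noteq> 0" and vp: "v * (1 - of_nat p) = 1"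
    using one_minus_p_zunit[THEN zunit_nz] by (simp_all add: v_def)
  have vp1: "v - 1 = v * of_nat p"
    using vp by (simp add: algebra_simps)
  \<comment> \<open>Negativity separates the nodes of \<open>B\<close> from the natural numbers in
    \<open>A\<close>.\<close>
  have vneg: "v < 0"
    using p_ge_3 by (simp add: v_def)
  have pe: "even (p - 1)"
    using p_odd by simp
  have injA: "inj_on (of_nat :: nat \<Rightarrow> rat) {..<p}" and injB: "inj_on (\<lambda>j. of_nat j * v) {1..<p}"
    using v0 by (auto simp: inj_on_def)
  have disj: "A \<inter> B = {}"
  proof -
    have "of_nat i \<noteq> of_nat j * v" if "j \<in> {1..<p}" for i j
    proof -
      have "of_nat j * v < 0"
        using vneg that by (simp add: mult_pos_neg)
      then show ?thesis
        by (metis of_nat_0_le_iff not_less)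
    qed
    then show ?thesis
      by (auto simp: A_def B_def)
  qed
  have cA: "card A = p" and cB: "card B = p - 1"
    using injA injB by (simp_all add: A_def B_def card_image)
  have finA: "finite A" and finB: "finite B"
    by (simp_all add: A_def B_def)
  have "card (A \<union> B) = 2 * (p - 1) + 1"
    using cA cB disj finA finB p_pos by (simp add: card_Un_disjoint)
  then have main: "(\<Sum>x\<in>A \<union> B. poly P x / (\<Prod>y\<in>(A \<union> B) - {x}. x - y)) = coeff P (2 * (p - 1))"
    using lagrange_leading_coeff[of "A \<union> B" P] finA finB assms(1) by force
  define F where "F = (\<lambda>x. poly P x / (\<Prod>y\<in>(A \<union> B) - {x}. x - y))"
  have flip: "(\<Prod>s\<in>{..<p} - {j}. of_nat s - f s) = (\<Prod>s\<in>{..<p} - {j}. f s - (of_nat s :: rat))"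
    if "j < p" for f j
  proof -
    have "(\<Prod>s\<in>{..<p} - {j}. of_nat s - f s) = (\<Prod>s\<in>{..<p} - {j}. - (f s - of_nat s))"
      by simp
    also have "\<dots> = (\<Prod>s\<in>{..<p} - {j}. f s - (of_nat s :: rat))"
      unfolding prod_uminus using that pe by simp
    finally show ?thesis .
  qed
  have W: "node_prod j y = (\<Prod>s\<in>{..<p} - {j}. (of_nat j + y) - of_nat s)" if "j < p" for j y
    using flip[OF that, of "\<lambda>_. of_nat j + y"] by (simp add: node_prod_def algebra_simps)
  have prodA: "(\<Prod>y\<in>A - {of_nat j}. g y) = (\<Prod>s\<in>{..<p} - {j}. g (of_nat s))" if "j < p" for j and g :: "rat \<Rightarrow> rat"
  proof -
    have "A - {of_nat j} = of_nat ` ({..<p} - {j})"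
      by (auto simp: A_def)
    then show ?thesis
      by (simp add: prod.reindex inj_on_def)
  qed
  have prodB: "(\<Prod>y\<in>B - {of_nat j * v}. g y) = (\<Prod>s\<in>{1..<p} - {j}. g (of_nat s * v))" for j and g :: "rat \<Rightarrow> rat"
  proof -
    have "B - {of_nat j * v} = (\<lambda>s. of_nat s * v) ` ({1..<p} - {j})"
      using v0 by (auto simp: B_def)
    moreover have "inj_on (\<lambda>s. of_nat s * v) ({1..<p} - {j})"
      using v0 by (auto simp: inj_on_def)
    ultimately show ?thesis
      by (simp add: prod.reindex)
  qed
  \<comment> \<open>The products over \<open>B\<close> lack s = 0 while \<open>node_prod j\<close>
    has it for positive j; this factor is divided out again.\<close>
  have pull: "(\<Prod>s\<in>{..<p} - {j}. h s) = h 0 * (\<Prod>s\<in>{1..<p} - {j}. h s)" if "0 < j" "j < p" for j and h :: "nat \<Rightarrow> rat"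
  proof -
    have "{..<p} - {j} = insert 0 ({1..<p} - {j})"
      using that by auto
    then show ?thesis
      by simp
  qed
  have card1: "card ({1..<p} - {j}) = p - 2" if "0 < j" "j < p" for j
    using that by simp
  have FB: "F (of_nat j * v) = poly P (of_nat j * v) * v / (of_nat p * v ^ p * node_prod j 0 * node_prod j (of_nat j * v * of_nat p))"
    if j: "0 < j" "j < p" for j
  proof -
    have "of_nat j * v \<in> B"
      using j by (auto simp: B_def)
    then have "(A \<union> B) - {of_nat j * v} = A \<union> (B - {of_nat j * v})"
      using disj by auto
    then have "(\<Prod>y\<in>(A \<union> B) - {of_nat j * v}. of_nat j * v - y)
        = (\<Prod>y\<in>A. of_nat j * v - y) * (\<Prod>y\<in>B - {of_nat j * v}. of_nat j * v - y)"
      using finA finB disj by (auto intro!: prod.union_disjoint)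
    also have "(\<Prod>y\<in>A. of_nat j * v - y) = (of_nat j * v - of_nat j) * (\<Prod>y\<in>A - {of_nat j}. of_nat j * v - y)"
      using finA j by (intro prod.remove) (auto simp: A_def)
    also have "(\<Prod>y\<in>A - {of_nat j}. of_nat j * v - y) = node_prod j (of_nat j * v * of_nat p)"
    proof -
      have "of_nat j + of_nat j * v * of_nat p = of_nat j * (v * of_nat p + 1)"
        by (simp add: algebra_simps)
      also have "v * of_nat p + 1 = v"
        using vp by (simp add: algebra_simps)
      finally show ?thesis
        unfolding prodA[OF j(2)] W[OF j(2)] by simp
    qed
    also have "of_nat j * v - of_nat j = of_nat j * v * of_nat p"
      unfolding mult.assoc vp1[symmetric] by (simp add: algebra_simps)
    also have "(\<Prod>y\<in>B - {of_nat j * v}. of_nat j * v - y) = (\<Prod>s\<in>{1..<p} - {j}. v * (of_nat j - of_nat s))"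
      unfolding prodB by (simp add: algebra_simps)
    also have "\<dots> = v ^ (p - 2) * (\<Prod>s\<in>{1..<p} - {j}. of_nat j - of_nat s)"
      using card1[OF j] by (simp add: prod.distrib)
    also have "(\<Prod>s\<in>{1..<p} - {j}. of_nat j - of_nat s) = node_prod j 0 / of_nat j"
      unfolding W[OF j(2)] pull[OF j] using j by simp
    finally have "(\<Prod>y\<in>(A \<union> B) - {of_nat j * v}. of_nat j * v - y)
        = of_nat p * (v * v ^ (p - 2)) * node_prod j 0 * node_prod j (of_nat j * v * of_nat p)"
      using j by (simp add: field_simps)
    also have "v * v ^ (p - 2) = v ^ p / v"
    proof -
      have "p = Suc (Suc (p - 2))"
        using p_ge_3 by simp
      then have "v ^ p = v * (v * v ^ (p - 2))"
        by (metis power_Suc)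
      then show ?thesis
        using v0 by simp
    qed
    also have "of_nat p * (v ^ p / v) * node_prod j 0 * node_prod j (of_nat j * v * of_nat p)
        = (of_nat p * v ^ p * node_prod j 0 * node_prod j (of_nat j * v * of_nat p)) / v"
      by simp
    finally show ?thesis
      unfolding F_def by (simp only: divide_divide_eq_right)
  qed
  have FA: "F (of_nat j) = - poly P (of_nat j) / (of_nat p * v ^ p * node_prod j 0 * node_prod j (- (of_nat j * of_nat p)))"
    if j: "0 < j" "j < p" for j
  proof -
    have "of_nat j \<in> A"
      using j by (auto simp: A_def)
    then have "(A \<union> B) - {of_nat j} = (A - {of_nat j}) \<union> B"
      using disj by auto
    then have "(\<Prod>y\<in>(A \<union> B) - {of_nat j}. of_nat j - y)
        = (\<Prod>y\<in>A - {of_nat j}. of_nat j - y) * (\<Prod>y\<in>B. of_nat j - y)"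
      using finA finB disj by (auto intro!: prod.union_disjoint)
    also have "(\<Prod>y\<in>A - {of_nat j}. of_nat j - y) = node_prod j 0"
      unfolding prodA[OF j(2)] W[OF j(2)] by simp
    also have "(\<Prod>y\<in>B. of_nat j - y) = (of_nat j - of_nat j * v) * (\<Prod>y\<in>B - {of_nat j * v}. of_nat j - y)"
      using finB j by (intro prod.remove) (auto simp: B_def)
    also have "(\<Prod>y\<in>B - {of_nat j * v}. of_nat j - y) = (\<Prod>s\<in>{1..<p} - {j}. v * (of_nat j * (1 - of_nat p) - of_nat s))"
    proof -
      have "v * (of_nat j * (1 - of_nat p)) = of_nat j"
        using vp by (metis mult.left_commute mult.right_neutral)
      then have "of_nat j - of_nat s * v = v * (of_nat j * (1 - of_nat p) - of_nat s)" for s :: nat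
        by (metis right_diff_distrib mult.commute)
      then show ?thesis
        unfolding prodB by simp
    qed
    also have "\<dots> = v ^ (p - 2) * (\<Prod>s\<in>{1..<p} - {j}. of_nat j * (1 - of_nat p) - of_nat s)"
      using card1[OF j] by (simp add: prod.distrib)
    also have "(\<Prod>s\<in>{1..<p} - {j}. of_nat j * (1 - of_nat p) - of_nat s)
        = node_prod j (- (of_nat j * of_nat p)) / (of_nat j * (1 - of_nat p))"
    proof -
      have q: "of_nat j + - (of_nat j * of_nat p) = of_nat j * (1 - of_nat p :: rat)"
        by (simp add: algebra_simps)
      have "of_nat j * (1 - of_nat p) \<noteq> (0 :: rat)"
        using j one_minus_p_zunit[THEN zunit_nz] by simp
      then show ?thesis
        unfolding W[OF j(2)] pull[OF j] q by simp
    qed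
    also have "of_nat j - of_nat j * v = - (of_nat j * v * of_nat p)"
      unfolding mult.assoc vp1[symmetric] by (simp add: algebra_simps)
    also have "node_prod j (- (of_nat j * of_nat p)) / (of_nat j * (1 - of_nat p))
        = node_prod j (- (of_nat j * of_nat p)) * v / of_nat j"
      by (simp add: v_def)
    finally have "(\<Prod>y\<in>(A \<union> B) - {of_nat j}. of_nat j - y)
        = - (of_nat p * (v * (v * v ^ (p - 2))) * node_prod j 0 * node_prod j (- (of_nat j * of_nat p)))"
      using j by (simp add: field_simps)
    also have "v * (v * v ^ (p - 2)) = v ^ p"
    proof -
      have "p = Suc (Suc (p - 2))"
        using p_ge_3 by simp
      then show ?thesis
        by (metis power_Suc)
    qed
    finally show ?thesis
      by (simp add: F_def)
  qed
  \<comment> \<open>The single node 0 accounts for both terms with j = 0; they combine through v - 1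
    = v p.\<close>
  have F0: "of_nat p * v ^ p * F 0 = (v - 1) * poly P 0 / (node_prod 0 0 * node_prod 0 0)"
  proof -
    have "0 \<in> A"
      using p_pos by (force simp: A_def)
    then have "(A \<union> B) - {0} = (A - {of_nat 0}) \<union> B"
      using disj by auto
    then have "(\<Prod>y\<in>(A \<union> B) - {0}. 0 - y) = (\<Prod>y\<in>A - {of_nat 0}. 0 - y) * (\<Prod>y\<in>B. 0 - y)"
      using finA finB disj by (auto intro!: prod.union_disjoint)
    also have "(\<Prod>y\<in>A - {of_nat 0}. 0 - y) = node_prod 0 0"
      unfolding prodA[OF p_pos] W[OF p_pos] by simp
    also have "(\<Prod>y\<in>B. 0 - y) = (\<Prod>s\<in>{1..<p}. v * - of_nat s)"
      unfolding B_def by (subst prod.reindex[OF injB]) (simp add: mult.commute)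
    also have "\<dots> = v ^ (p - 1) * (\<Prod>s\<in>{1..<p}. - of_nat s)"
      unfolding prod.distrib by simp
    also have "(\<Prod>s\<in>{1..<p}. - of_nat s) = node_prod 0 0"
    proof -
      have "{..<p} - {0} = {1..<p}"
        by auto
      then show ?thesis
        unfolding W[OF p_pos] by simp
    qed
    finally have F0: "v ^ (p - 1) * F 0 = poly P 0 / (node_prod 0 0 * node_prod 0 0)"
      using v0 by (simp add: F_def mult_ac)
    have "v ^ p = v * v ^ (p - 1)"
      using p_pos by (metis Suc_pred' power_Suc)
    then have "of_nat p * v ^ p * F 0 = (v * of_nat p) * (v ^ (p - 1) * F 0)"
      by (simp only: mult_ac)
    then show ?thesis
      unfolding F0 vp1[symmetric] by simp
  qed
  define G where "G = (\<lambda>j. v * poly P (of_nat j * v) / (node_prod j 0 * node_prod j (of_nat j * v * of_nat p))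
            - poly P (of_nat j) / (node_prod j 0 * node_prod j (- (of_nat j * of_nat p))))"
  have pv: "of_nat p * v ^ p \<noteq> 0"
    using v0 p_pos by simp
  have G1: "G j = of_nat p * v ^ p * (F (of_nat j) + F (of_nat j * v))" if j: "0 < j" "j < p" for j
    unfolding FA[OF j] FB[OF j] G_def using v0 p_pos by (simp add: field_simps)
  have G0: "G 0 = of_nat p * v ^ p * F 0"
    unfolding F0 G_def by (simp add: diff_divide_distrib left_diff_distrib)
  have "(\<Sum>x\<in>A \<union> B. F x) = (\<Sum>x\<in>A. F x) + (\<Sum>x\<in>B. F x)"
    using finA finB disj by (rule sum.union_disjoint)
  also have "(\<Sum>x\<in>A. F x) = (\<Sum>j<p. F (of_nat j))"
    unfolding A_def using injA by (simp add: sum.reindex)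
  also have "\<dots> = F 0 + (\<Sum>j\<in>{1..<p}. F (of_nat j))"
  proof -
    have "{..<p} = insert 0 {1..<p}"
      using p_pos by auto
    then show ?thesis
      by simp
  qed
  also have "(\<Sum>x\<in>B. F x) = (\<Sum>j\<in>{1..<p}. F (of_nat j * v))"
    unfolding B_def by (subst sum.reindex[OF injB]) simp
  finally have "coeff P (2 * (p - 1))
      = F 0 + (\<Sum>j\<in>{1..<p}. F (of_nat j)) + (\<Sum>j\<in>{1..<p}. F (of_nat j * v))"
    unfolding main[folded F_def, symmetric] .
  then have "of_nat p * v ^ p * coeff P (2 * (p - 1))
      = of_nat p * v ^ p * F 0 + (\<Sum>j\<in>{1..<p}. of_nat p * v ^ p * (F (of_nat j) + F (of_nat j * v)))"
    by (simp only: distrib_left sum_distrib_left sum.distrib add.assoc)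
  also have "\<dots> = G 0 + (\<Sum>j\<in>{1..<p}. G j)"
    using G0 G1 by simp
  also have "\<dots> = (\<Sum>j<p. G j)"
  proof -
    have "{..<p} = insert 0 {1..<p}"
      using p_pos by auto
    then show ?thesis
      by simp
  qed
  finally show ?thesis
    by (simp add: G_def)
qed

lemma one_minus_p_power: "qcong p 2 ((1 - of_nat p) ^ n) (1 - of_nat n * of_nat p)"
proof (induction n)
  case (Suc n)
  have "qcong p 2 ((1 - of_nat p) * (1 - of_nat p) ^ n) ((1 - of_nat p) * (1 - of_nat n * of_nat p))"
    using Suc by (intro qcong_lmult) auto
  also have "qcong p 2 \<dots> (1 - of_nat (Suc n) * of_nat p)"
    by (rule qcongI[of "of_nat n"]) (auto simp: algebra_simps power2_eq_square)
  finally show ?case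
    by simp
qed simp

text \<open>The interpolation identity at the nodes \<open>j\<close> and \<open>j / (1 - p)\<close> replaces the sum over \<open>j\<close> of the
  differences by a single leading coefficient. Exchanging \<open>node_prod j 0\<close> for the product at the
  shifted node costs only a term of size \<open>p\<^sup>2\<close>, which cancels between the two halves.\<close>

lemma shifted_sum_diff:
  fixes P :: "rat poly" and T :: "nat \<Rightarrow> rat \<Rightarrow> rat"
  assumes p5: "p \<ge> 5" and deg: "degree P \<le> 2 * (p - 1)"
    and lead: "coeff P (2 * (p - 1)) \<in> zloc p"
    and Pz: "\<And>y. y \<in> zloc p \<Longrightarrow> poly P y \<in> zloc p"
    and Pc: "\<And>x y. qcong p 1 x y \<Longrightarrow> y \<in> zloc p \<Longrightarrow> qcong p 1 (poly P x) (poly P y)"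
    and K: "\<And>j. j < p \<Longrightarrow> K j \<in> zloc p"
    and T: "\<And>j x. j < p \<Longrightarrow> x \<in> zmax \<Longrightarrow>
      qcong p 3 (T j x) ((1 + of_nat p ^ 2 * K j) * (poly P (of_nat j + x) / (node_prod j x * node_prod j x)))"
  defines "v \<equiv> 1 / (1 - of_nat p)"
  shows "qcong p 3 (\<Sum>j<p. v * T j (of_nat j * v * of_nat p) - T j 0) (of_nat p * coeff P (2 * (p - 1)))"
proof -
  have v: "v \<in> zloc p" and vp: "v = 1 + of_nat p * v"
    using one_minus_p_zunit one_minus_p_zunit[THEN zunit_nz]
    by (auto simp: v_def field_simps)
  have "qcong p 3 (v * T j (of_nat j * v * of_nat p) - T j 0)
      (v * poly P (of_nat j * v) / (node_prod j 0 * node_prod j (of_nat j * v * of_nat p))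
            - poly P (of_nat j) / (node_prod j 0 * node_prod j (- (of_nat j * of_nat p))))"
    if j: "j < p" for j
  proof -
    \<comment> \<open>The relative \<open>p ^ 2\<close> coefficient of \<open>node_prod j\<close> at
      the shift \<open>x\<close>, which is p j modulo p^2. At the shift - p j the coefficient is
      \<open>- k\<close>.\<close>
    define k where "k = - (of_nat j * inv_sq_sum j)"
    define W where "W = node_prod j 0"
    define A where "A = v * poly P (of_nat j * v)"
    define B where "B = poly P (of_nat j)"
    define x where "x = of_nat j * v * of_nat p"
    define \<pi> where "\<pi> = (of_nat p :: rat) ^ 2"
    have \<pi>: "\<pi> \<in> zloc p"
      by (simp add: \<pi>_def zloc_power)
    have k: "k \<in> zloc p"
      using inv_sq_sum_zloc[OF j] by (auto simp: k_def)
    have Kj: "K j \<in> zloc p"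
      using K j by blast
    have W: "W \<in> zunit p"
      unfolding W_def using j by (intro node_prod_zunit) auto
    have jv: "of_nat j * v \<in> zloc p"
      using v by auto
    have A: "A \<in> zloc p" and B: "B \<in> zloc p"
      unfolding A_def B_def using v jv Pz by auto
    have x: "x \<in> zmax" and jx: "of_nat j + x = of_nat j * v"
    proof -
      have "x = of_nat p * (of_nat j * v)"
        by (simp add: x_def mult_ac)
      then show "x \<in> zmax"
        using jv zmaxI by metis
      have "of_nat j + x = of_nat j * (1 + of_nat p * v)"
        by (simp add: x_def algebra_simps)
      then show "of_nat j + x = of_nat j * v"
        using vp by metis
    qed
    have v1: "qcong p 1 v 1"
      using v by (intro qcongI[of v]) (use vp in \<open>auto simp: algebra_simps\<close>)
    have jv1: "qcong p 1 (of_nat j * v) (of_nat j)"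
      using qcong_lmult[OF v1, of "of_nat j"] by simp
    have AB: "qcong p 1 A B"
    proof -
      have "qcong p 1 (v * poly P (of_nat j * v)) (1 * poly P (of_nat j))"
        using v1 jv1 Pc Pz jv by (intro qcong_mult) auto
      then show ?thesis
        by (simp add: A_def B_def)
    qed
    then obtain h where h: "h \<in> zloc p" "A - B = of_nat p * h"
      by (auto simp: qcong_def)
    have \<pi>2: "qcong p 3 (\<pi> * y) (\<pi> * z)" if "qcong p 1 y z" for y z
      unfolding \<pi>_def using that by (rule qcong_p2_mult)
    have unit1: "1 + \<pi> * y \<in> zunit p" if "y \<in> zloc p" for y
    proof -
      have "\<pi> * y = of_nat p * (of_nat p * y)"
        by (simp add: \<pi>_def power2_eq_square)
      then have "\<pi> * y \<in> zmax"
        using that zmaxI by (metis zloc_mult zloc_of_nat)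
      then show ?thesis
        using zunit_add_zmax by blast
    qed
    have inv: "qcong p 3 (1 / (1 + \<pi> * y)) (1 - \<pi> * y)" if y: "y \<in> zloc p" for y
    proof (rule qcong_cancel[OF _ unit1[OF y]])
      have "1 - (1 + \<pi> * y) * (1 - \<pi> * y) = of_nat p ^ 3 * (of_nat p * y * y)"
        by (simp add: \<pi>_def algebra_simps power2_eq_square power3_eq_cube)
      then have "qcong p 3 1 ((1 + \<pi> * y) * (1 - \<pi> * y))"
        using y by (intro qcongI[of "of_nat p * y * y"]) auto
      then show "qcong p 3 ((1 + \<pi> * y) * (1 / (1 + \<pi> * y))) ((1 + \<pi> * y) * (1 - \<pi> * y))"
        using unit1[OF y, THEN zunit_nz] by simp
    qed
    have Wx: "qcong p 3 (node_prod j x) (W * (1 + \<pi> * k))"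
    proof -
      have "qcong p 3 (node_prod j (of_nat p * (of_nat j * v))) (W * (1 - \<pi> * (of_nat j * v * inv_sq_sum j)))"
        unfolding W_def \<pi>_def using p5 j jv by (rule node_prod_expand)
      also have "qcong p 3 \<dots> (W * (1 - \<pi> * (of_nat j * inv_sq_sum j)))"
        using W jv1 inv_sq_sum_zloc[OF j]
        by (intro qcong_lmult qcong_diff[OF qcong_refl] \<pi>2 qcong_rmult) auto
      finally show ?thesis
        by (simp add: x_def k_def mult_ac)
    qed
    have Wx': "qcong p 3 (node_prod j (- (of_nat j * of_nat p))) (W * (1 + \<pi> * (- k)))"
      using node_prod_expand[OF p5 j, of "- of_nat j"]
      by (simp add: k_def W_def \<pi>_def mult_ac zloc_uminus)
    have Wxu: "node_prod j x \<in> zunit p" "node_prod j (- (of_nat j * of_nat p)) \<in> zunit p"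
      using j x by (auto intro!: node_prod_zunit)
    have kn: "- k \<in> zloc p"
      using k by blast
    note u = W unit1[OF k] unit1[OF kn] Wxu
    have invWx: "qcong p 3 (1 / node_prod j x) (1 / W * (1 - \<pi> * k))"
    proof -
      have "qcong p 3 (1 / node_prod j x) (1 / (W * (1 + \<pi> * k)))"
        using Wx u by (intro qcong_divide zunit_mult) auto
      also have "1 / (W * (1 + \<pi> * k)) = 1 / W * (1 / (1 + \<pi> * k))"
        by simp
      also have "qcong p 3 \<dots> (1 / W * (1 - \<pi> * k))"
        using inv[OF k] W by (intro qcong_lmult) auto
      finally show ?thesis .
    qed
    have invWx': "qcong p 3 (1 / node_prod j (- (of_nat j * of_nat p))) (1 / W * (1 + \<pi> * k))"
    proof -
      have "qcong p 3 (1 / node_prod j (- (of_nat j * of_nat p))) (1 / (W * (1 + \<pi> * (- k))))"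
        using Wx' u by (intro qcong_divide zunit_mult) auto
      also have "1 / (W * (1 + \<pi> * (- k))) = 1 / W * (1 / (1 + \<pi> * (- k)))"
        by simp
      also have "qcong p 3 \<dots> (1 / W * (1 - \<pi> * (- k)))"
        using inv[OF kn] W by (intro qcong_lmult) auto
      finally show ?thesis
        by simp
    qed
    have iW: "1 / W \<in> zloc p"
      using W by auto
    have fac: "1 + \<pi> * K j \<in> zloc p" "1 - \<pi> * k \<in> zloc p" "1 + \<pi> * k \<in> zloc p"
      using \<pi> Kj k by auto
    have T1: "qcong p 3 (v * T j x) (A * (1 + \<pi> * K j) * (1 / W * (1 - \<pi> * k)) * (1 / W * (1 - \<pi> * k)))"
    proof -
      have "qcong p 3 (v * T j x) (v * ((1 + \<pi> * K j) * (poly P (of_nat j * v) / (node_prod j x * node_prod j x))))"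
        using T[OF j x] v unfolding jx \<pi>_def by (intro qcong_lmult)
      also have "\<dots> = A * (1 + \<pi> * K j) * (1 / node_prod j x) * (1 / node_prod j x)"
        by (simp add: A_def)
      also have "qcong p 3 \<dots> (A * (1 + \<pi> * K j) * (1 / W * (1 - \<pi> * k)) * (1 / W * (1 - \<pi> * k)))"
        using invWx A fac iW Wxu by (intro qcong_mult qcong_refl zloc_mult) auto
      finally show ?thesis .
    qed
    have T0: "qcong p 3 (T j 0) (B * (1 + \<pi> * K j) * (1 / W) * (1 / W))"
      using T[OF j zmax_0] by (simp add: B_def W_def \<pi>_def mult_ac)
    have I1: "qcong p 3 (A * (1 / W) * (1 / node_prod j x)) (A * (1 / W) * (1 / W * (1 - \<pi> * k)))"
      using invWx A iW by (intro qcong_lmult zloc_mult)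
    have I2: "qcong p 3 (B * (1 / W) * (1 / node_prod j (- (of_nat j * of_nat p)))) (B * (1 / W) * (1 / W * (1 + \<pi> * k)))"
      using invWx' B iW by (intro qcong_lmult zloc_mult)
    define z where "z = 1 / W"
    have z: "z \<in> zloc p"
      using iW by (simp add: z_def)
    have "qcong p 3 (A * (1 + \<pi> * K j) * (z * (1 - \<pi> * k)) * (z * (1 - \<pi> * k)) - B * (1 + \<pi> * K j) * z * z)
       (A * z * (z * (1 - \<pi> * k)) - B * z * (z * (1 + \<pi> * k)))"
    proof (rule qcongI)
      \<comment> \<open>To first order in \<open>\<pi>\<close> the two sides differ by z^2 (K j - k)
        (A - B) \<open>\<pi>\<close>, and A - B supplies the third factor \<open>p\<close>. The
        terms with \<open>\<pi> * \<pi>\<close> carry \<open>p ^ 4\<close>.\<close>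
      let ?r = "z * z * ((K j - k) * h + of_nat p * (A * (k * k - 2 * k * K j + \<pi> * K j * k * k)))"
      show "?r \<in> zloc p"
        using z Kj k h A \<pi> by (intro zloc_mult zloc_add zloc_diff) auto
      have "(A * (1 + \<pi> * K j) * (z * (1 - \<pi> * k)) * (z * (1 - \<pi> * k)) - B * (1 + \<pi> * K j) * z * z)
         - (A * z * (z * (1 - \<pi> * k)) - B * z * (z * (1 + \<pi> * k)))
         = z * z * (\<pi> * ((K j - k) * (A - B)) + \<pi> * \<pi> * (A * (k * k - 2 * k * K j + \<pi> * K j * k * k)))"
        by (simp add: algebra_simps)
      also have "\<dots> = of_nat p ^ 3 * ?r"
        unfolding h(2) by (simp add: algebra_simps \<pi>_def power2_eq_square power3_eq_cube)
      finally show "(A * (1 + \<pi> * K j) * (z * (1 - \<pi> * k)) * (z * (1 - \<pi> * k)) - B * (1 + \<pi> * K j) * z * z)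
         - (A * z * (z * (1 - \<pi> * k)) - B * z * (z * (1 + \<pi> * k))) = of_nat p ^ 3 * ?r" .
    qed
    then have "qcong p 3 (v * T j x - T j 0)
        (A * (1 / W) * (1 / node_prod j x) - B * (1 / W) * (1 / node_prod j (- (of_nat j * of_nat p))))"
      unfolding z_def using qcong_diff[OF T1 T0] qcong_diff[OF I1 I2] qcong_sym qcong_trans by blast
    then show ?thesis
      by (simp add: x_def[symmetric] A_def B_def W_def)
  qed
  then have "qcong p 3 (\<Sum>j<p. v * T j (of_nat j * v * of_nat p) - T j 0)
      (\<Sum>j<p. v * poly P (of_nat j * v) / (node_prod j 0 * node_prod j (of_nat j * v * of_nat p))
            - poly P (of_nat j) / (node_prod j 0 * node_prod j (- (of_nat j * of_nat p))))"
    by (intro qcong_sum) auto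
  also have "\<dots> = of_nat p * v ^ p * coeff P (2 * (p - 1))"
    unfolding v_def using deg by (rule lagrange_nodes)
  also have "qcong p 3 \<dots> (of_nat p * 1 * coeff P (2 * (p - 1)))"
  proof -
    \<comment> \<open>Because of the outer factor \<open>p\<close>, the power \<open>v ^ p\<close>
      is needed only modulo \<open>p ^ 2\<close>.\<close>
    have "qcong p 2 (1 - of_nat p * of_nat p) 1"
      by (rule qcongI[of "- 1"]) (auto simp: power2_eq_square)
    then have "qcong p 2 ((1 - of_nat p) ^ p) 1"
      using one_minus_p_power qcong_trans by blast
    then have "qcong p 2 (1 / (1 - of_nat p) ^ p) (1 / 1)"
      using one_minus_p_zunit by (intro qcong_divide) auto
    then have "qcong p 2 (v ^ p) 1"
      by (simp add: v_def power_one_over)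
    then have "qcong p 3 (of_nat p * v ^ p) (of_nat p * 1)"
      using qcong_scale_power[of 2 "v ^ p" 1 1] by (simp add: numeral_3_eq_3)
    then show ?thesis
      using lead by (rule qcong_rmult)
  qed
  finally show ?thesis
    by simp
qed

section \<open>Reduction of the function \<open>G\<close>\<close>

text \<open>For \<open>j\<close> at most \<open>m\<close>, the symbol of length \<open>j\<close> at
  \<open>a + x\<close> cancels against the one of length \<open>m\<close>, and only symbols made of
  units remain.\<close>

lemma hyp_factor_le:
  assumes "m < p" "a \<in> zloc p" "a + of_nat m \<in> zmax" "x \<in> zmax" "j \<le> m"
  shows "hyp_factor a m j x = (- 1) ^ j * pochhammer (1 - (a + of_nat m)) m
    / (pochhammer (1 - (a + of_nat m + x)) (m - j) * pochhammer (1 + x) j)"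
proof -
  have split: "pochhammer (a + x) m = pochhammer (a + x) j * pochhammer (a + x + of_nat j) (m - j)"
    using assms by (intro pochhammer_product) auto
  have "pochhammer (a + x) m \<noteq> 0"
    using pochhammer_residue_zunit[OF assms(1-4)] by (rule zunit_nz)
  then have nz: "pochhammer (a + x) j \<noteq> 0"
    using split by auto
  have r1: "pochhammer a m = (- 1) ^ m * pochhammer (1 - (a + of_nat m)) m"
    using pochhammer_reflect[of a m] by (simp add: algebra_simps)
  have r2: "pochhammer (a + x + of_nat j) (m - j) = (- 1) ^ (m - j) * pochhammer (1 - (a + of_nat m + x)) (m - j)"
    using pochhammer_reflect[of "a + x + of_nat j" "m - j"] assms by (simp add: of_nat_diff algebra_simps)
  have "(- 1 :: rat) ^ m = (- 1) ^ j * (- 1) ^ (m - j)"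
    using assms by (simp flip: power_add)
  then show ?thesis
    unfolding hyp_factor_def split r1 r2 using nz by simp
qed

text \<open>For \<open>j\<close> beyond \<open>m\<close>, the symbol of length \<open>j\<close> at
  \<open>a + x\<close> runs past \<open>a + m + x\<close>, an element of \<open>zmax\<close>. This
  factor is split off because the functional equation of the gamma function omits it.\<close>

lemma hyp_factor_gt:
  assumes "m < p" "a \<in> zloc p" "a + of_nat m \<in> zmax" "x \<in> zmax" "m < j"
  shows "hyp_factor a m j x = (- 1) ^ m * pochhammer (1 - (a + of_nat m)) m
    * pochhammer (1 + (a + of_nat m + x)) (j - m - 1) / pochhammer (1 + x) j * (a + of_nat m + x)"
proof -
  have split: "pochhammer (a + x) j = pochhammer (a + x) m * pochhammer (a + x + of_nat m) (j - m)"
    using assms by (intro pochhammer_product) auto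
  have nz: "pochhammer (a + x) m \<noteq> 0"
    using pochhammer_residue_zunit[OF assms(1-4)] by (rule zunit_nz)
  have r1: "pochhammer a m = (- 1) ^ m * pochhammer (1 - (a + of_nat m)) m"
    using pochhammer_reflect[of a m] by (simp add: algebra_simps)
  have "j - m = Suc (j - m - 1)"
    using assms by simp
  then have "pochhammer (a + x + of_nat m) (j - m)
      = (a + x + of_nat m) * pochhammer (a + x + of_nat m + 1) (j - m - 1)"
    by (metis pochhammer_rec)
  then have r2: "pochhammer (a + x + of_nat m) (j - m)
      = (a + of_nat m + x) * pochhammer (1 + (a + of_nat m + x)) (j - m - 1)"
    by (simp add: algebra_simps)
  show ?thesis
    unfolding hyp_factor_def split r1 r2 using nz by simp
qed

text \<open>The values of \<open>gam\<close> at \<open>a\<close>, \<open>a + j + x\<close> and \<open>- j - x\<close> reduce to those at \<open>b\<close>, \<open>b + x\<close> and \<open>- x\<close> with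
  \<open>b = a + m\<close>, and these cancel because \<open>gam\<close> is multiplicative on \<open>zmax\<close>.\<close>

lemma gam_quotient:
  assumes p5: "p \<ge> 5" and am: "m < p" "a \<in> zloc p" "a + of_nat m \<in> zmax" and x: "x \<in> zmax" and j: "j < p"
  shows "qcong p 3 ((- 1) ^ j * gam (- of_nat j - x) * (gam (a + of_nat j + x) / gam a)
      * (if m < j then a + of_nat m + x else 1)) (hyp_factor a m j x)"
proof -
  define b where "b = a + of_nat m"
  define e where "e = pochhammer (1 + x) j"
  define n where "n = pochhammer (1 - b) m"
  have b: "b \<in> zmax" and bx: "b + x \<in> zmax" and xm: "- x \<in> zmax"
    using am x by (auto simp: b_def)
  have e: "e \<in> zunit p"
    unfolding e_def using j x by (rule pochhammer_1_zunit)
  have n: "n \<in> zunit p"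
    unfolding n_def using pochhammer_1_zunit[of m "- b"] am b by auto
  have ga: "gam z \<in> zunit p" for z
    by (rule gam_zunit)
  have "- x - of_nat j = - of_nat j - x"
    by simp
  then have "qcong p 3 (gam (- x)) (gam (- of_nat j - x) * e)"
    unfolding e_def using gam_down[OF xm j] by (simp only: diff_minus_eq_add)
  then have "qcong p 3 (gam (- x) / e) (gam (- of_nat j - x) * e / e)"
    using e by (intro qcong_divide) auto
  then have g1: "qcong p 3 (gam (- of_nat j - x)) (gam (- x) / e)"
    using e[THEN zunit_nz] by (simp add: qcong_sym)
  have "qcong p 3 (gam b) (gam (b - of_nat m) * n)"
    unfolding n_def using gam_down[OF b am(1)] .
  then have "qcong p 3 (gam b / n) (gam (b - of_nat m) * n / n)"
    using n by (intro qcong_divide) auto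
  then have g2: "qcong p 3 (gam a) (gam b / n)"
    using n[THEN zunit_nz] by (simp add: qcong_sym b_def)
  have gx: "qcong p 3 (gam (- x) * (gam (b + x) / gam b)) 1"
  proof -
    have "qcong p 3 (gam (- x) * (gam (b + x) / gam b)) (gam (- x) * (gam b * gam x / gam b))"
      using gam_add_zmax[OF p5 b x] ga by (intro qcong_lmult qcong_divide) auto
    also have "\<dots> = gam x * gam (- x)"
      using ga[of b, THEN zunit_nz] by simp
    also have "qcong p 3 \<dots> 1"
      using x by (rule gam_reflect)
    finally show ?thesis .
  qed
  \<comment> \<open>When the argument of the gamma function passes \<open>b + x\<close>, the
    functional equation drops this element of \<open>zmax\<close>; \<open>r\<close> supplies
    it.\<close>
  define r where "r = (if m < j then a + of_nat m + x else 1)"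
  have r: "r \<in> zloc p"
    using bx by (auto simp: r_def b_def)
  have "\<exists>c\<in>zloc p. qcong p 3 (gam (a + of_nat j + x)) (gam (b + x) * c) \<and>
      (- 1) ^ j * c * n / e * r = hyp_factor a m j x"
  proof (cases "m < j")
    case False
    define h where "h = pochhammer (1 - (b + x)) (m - j)"
    have h: "h \<in> zunit p"
      unfolding h_def
      by (rule pochhammer_1_zunit[OF _ zmax_uminus[OF bx], unfolded add_uminus_conv_diff]) (use am in simp)
    have "qcong p 3 (gam (b + x)) (gam (b + x - of_nat (m - j)) * h)"
      unfolding h_def using bx am by (intro gam_down) auto
    moreover have "b + x - of_nat (m - j) = a + of_nat j + x"
      using False by (simp add: b_def of_nat_diff)
    ultimately have "qcong p 3 (gam (b + x) / h) (gam (a + of_nat j + x) * h / h)"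
      using h by (intro qcong_divide) auto
    then have "qcong p 3 (gam (a + of_nat j + x)) (gam (b + x) * (1 / h))"
      using h[THEN zunit_nz] by (simp add: qcong_sym)
    moreover have "(- 1) ^ j * (1 / h) * n / e * r = hyp_factor a m j x"
      using hyp_factor_le[OF am x] False by (simp add: h_def n_def e_def r_def b_def mult_ac)
    ultimately show ?thesis
      using h by (intro bexI[of _ "1 / h"]) auto
  next
    case True
    define h where "h = pochhammer (1 + (b + x)) (j - m - 1)"
    have "qcong p 3 (gam (b + x + of_nat (Suc (j - m - 1)))) ((- 1) ^ Suc (j - m - 1) * gam (b + x) * h)"
      unfolding h_def using bx j by (intro gam_up) auto
    moreover have "b + x + of_nat (Suc (j - m - 1)) = a + of_nat j + x"
      using True by (simp add: b_def of_nat_diff)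
    moreover have S: "Suc (j - m - 1) = j - m"
      using True by simp
    ultimately have "qcong p 3 (gam (a + of_nat j + x)) (gam (b + x) * ((- 1) ^ (j - m) * h))"
      by (simp only: mult_ac)
    moreover have "(- 1) ^ j * ((- 1) ^ (j - m) * h) * n / e * r = hyp_factor a m j x"
    proof -
      have "(- 1 :: rat) ^ j = (- 1) ^ m * (- 1) ^ (j - m)"
        using True by (simp flip: power_add)
      then have "(- 1 :: rat) ^ j * (- 1) ^ (j - m) = (- 1) ^ m * ((- 1) ^ (j - m) * (- 1) ^ (j - m))"
        by (simp only: mult.assoc)
      also have "\<dots> = (- 1) ^ m"
        by (simp flip: power_mult_distrib)
      finally have sg: "(- 1 :: rat) ^ j * (- 1) ^ (j - m) = (- 1) ^ m" .
      have "(- 1) ^ j * ((- 1) ^ (j - m) * h) * n / e * r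
          = ((- 1) ^ j * (- 1) ^ (j - m)) * n * h / e * (b + x)"
        using True by (simp add: r_def b_def)
      also have "\<dots> = hyp_factor a m j x"
        unfolding sg hyp_factor_gt[OF am x True] by (simp add: h_def n_def e_def b_def)
      finally show ?thesis .
    qed
    moreover have "(- 1) ^ (j - m) * h \<in> zloc p"
      unfolding h_def using bx by (intro zloc_mult zloc_neg_one_power zloc_pochhammer) auto
    ultimately show ?thesis
      by blast
  qed
  then obtain c where c: "c \<in> zloc p" "qcong p 3 (gam (a + of_nat j + x)) (gam (b + x) * c)"
    and hyp: "(- 1) ^ j * c * n / e * r = hyp_factor a m j x"
    by blast
  have "qcong p 3 ((- 1) ^ j * gam (- of_nat j - x) * (gam (a + of_nat j + x) / gam a) * r)
      ((- 1) ^ j * (gam (- x) / e) * (gam (b + x) * c / (gam b / n)) * r)"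
    using g1 g2 c e n ga r
    by (intro qcong_mult qcong_divide qcong_refl zloc_mult zloc_divide zloc_neg_one_power zunit_divide)
       auto
  also have "\<dots> = (gam (- x) * (gam (b + x) / gam b)) * ((- 1) ^ j * c * n / e * r)"
    by (simp add: mult_ac)
  also have "qcong p 3 \<dots> (1 * ((- 1) ^ j * c * n / e * r))"
    using gx c n e r
    by (intro qcong_rmult zloc_mult zloc_divide zloc_neg_one_power) auto
  finally show ?thesis
    unfolding mult_1 hyp unfolding r_def .
qed

end

section \<open>Four parameters permuted by the Dwork prime\<close>

lemma less_4_cases: "(i::nat) < 4 \<Longrightarrow> i = 0 \<or> i = 1 \<or> i = 2 \<or> i = 3"
  by auto

lemma prod_4: "(\<Prod>i<4. f i) = f 0 * f 1 * f 2 * f (3::nat)" for f :: "nat \<Rightarrow> 'a::comm_monoid_mult"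
  by (simp add: numeral_eq_Suc mult_ac)

text \<open>
  \<open>M i\<close> is the residue of \<open>- A i\<close> and \<open>B i\<close> is the Dwork prime of \<open>A i\<close>. The condition \<open>perm\<close> is what the
  hypothesis on \<open>p\<close> modulo \<open>d\<close> is for. The condition \<open>edge\<close> accounts for the index \<open>p - 1\<close>, which
  occurs in the truncated series but not in \<open>G\<close>.
\<close>

locale dwork_quadruple = odd_prime +
  fixes A B :: "nat \<Rightarrow> rat" and M :: "nat \<Rightarrow> nat" and \<pi> :: "nat \<Rightarrow> nat"
  assumes A_zloc: "i < 4 \<Longrightarrow> A i \<in> zloc p" and B_zloc: "i < 4 \<Longrightarrow> B i \<in> zloc p"
    and A_pos: "i < 4 \<Longrightarrow> 0 < A i" and A_less: "i < 4 \<Longrightarrow> A i < 1"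
    and B_pos: "i < 4 \<Longrightarrow> 0 < B i" and B_less: "i < 4 \<Longrightarrow> B i < 1"
    and A_M: "i < 4 \<Longrightarrow> A i + of_nat (M i) = of_nat p * B i"
    and A_compl: "i < 4 \<Longrightarrow> A (3 - i) = 1 - A i" and B_compl: "i < 4 \<Longrightarrow> B (3 - i) = 1 - B i"
    and perm: "bij_betw \<pi> {..<4} {..<4}" and B_perm: "i < 4 \<Longrightarrow> B i = A (\<pi> i)"
    and edge: "qcong p 3 (\<Prod>i<4. if M i < p - 1 then of_nat p * (1 - B i) else 1) 0"
begin

lemma M_less: "i < 4 \<Longrightarrow> M i < p"
proof -
  assume i: "i < 4"
  have "of_nat (M i) < of_nat p * B i"
    using A_M[OF i] A_pos[OF i] by simp
  also have "\<dots> < of_nat p * 1"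
    using B_less[OF i] p_pos by (intro mult_strict_left_mono) auto
  finally show ?thesis
    by simp
qed

lemma AM_zmax: "i < 4 \<Longrightarrow> A i + of_nat (M i) \<in> zmax"
  using A_M B_zloc zmaxI by simp

lemma M_compl: "i < 4 \<Longrightarrow> M (3 - i) = p - 1 - M i"
proof -
  assume i: "i < 4"
  have "of_nat (M i + M (3 - i)) = of_nat p * B i + of_nat p * B (3 - i) - (A i + A (3 - i))"
  proof -
    have "3 - i < 4"
      by simp
    then show ?thesis
      using A_M[OF i] A_M[of "3 - i"] by simp
  qed
  also have "\<dots> = of_nat p - 1"
    unfolding A_compl[OF i] B_compl[OF i] by (simp add: algebra_simps)
  finally have "(of_nat (M i + M (3 - i) + 1) :: rat) = of_nat p"
    by simp
  then have "M i + M (3 - i) + 1 = p"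
    using of_nat_eq_iff by blast
  then show ?thesis
    by simp
qed

definition hyp_term :: "nat \<Rightarrow> rat \<Rightarrow> rat" where
  "hyp_term j x = (\<Prod>i<4. hyp_factor (A i) (M i) j x)"

text \<open>
  The exponent of \<open>p\<close> in \<open>G\<close> jumps when \<open>j\<close> passes \<open>A i * (p - 1)\<close>, that of the Pochhammer symbol when \<open>j\<close>
  passes \<open>M i\<close>. After the permutation the two thresholds disagree only at \<open>j = M i\<close>, where
  \<open>A i < t\<close> iff \<open>B i < t\<close> because \<open>A i - t = p * (B i - t)\<close>.
\<close>

lemma gap_prod:
  assumes "j < p"
  defines "t \<equiv> of_nat j / (of_nat p - 1)"
  shows "(\<Prod>i<4. if A i < t then of_nat p * (if M i = j then 1 else A i - t) else 1)
    = (\<Prod>i<4. if M i < j then of_nat p * (B i - t) else 1)"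
proof -
  have p1: "(of_nat p :: rat) - 1 > 0"
    using p_ge_3 by simp
  then have jt: "of_nat j = (of_nat p - 1) * t"
    by (simp add: t_def)
  define f where "f = (\<lambda>i. if A i < t then of_nat p * (if M i = j then 1 else A i - t) else 1)"
  define g where "g = (\<lambda>i. if M i < j then of_nat p * (B i - t) else 1)"
  \<comment> \<open>A nonzero compensating factor. Multiplied by it, both sides become products of
    one function \<open>h\<close>, over the \<open>A i\<close> and over the \<open>B i\<close>, and
    the permutation applies.\<close>
  define q where "q = (\<lambda>i. if M i = j \<and> A i < t then A i - t else 1)"
  define h where "h = (\<lambda>z::rat. if z < t then of_nat p * (z - t) else 1)"
  have fq: "f i * q i = h (A i)" for i
    by (simp add: f_def q_def h_def)
  have gq: "g i * q i = h (B i)" if i: "i < 4" for i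
  proof -
    have 1: "(of_nat p - 1) * (B i - t) = A i - B i + (of_nat (M i) - of_nat j)"
      using A_M[OF i] jt by (simp add: algebra_simps)
    have 2: "of_nat p * (B i - t) = A i - t" if "M i = j"
      using A_M[OF i] jt that by (simp add: algebra_simps)
    have 3: "B i < t \<longleftrightarrow> (of_nat p - 1) * (B i - t) < 0"
      using p1 by (simp add: mult_less_0_iff)
    have 4: "B i < t \<longleftrightarrow> of_nat p * (B i - t) < 0"
      using p_pos by (simp add: mult_less_0_iff)
    have bnd: "A i < 1" "0 < A i" "B i < 1" "0 < B i"
      using A_less A_pos B_less B_pos i by auto
    show ?thesis
    proof (rule linorder_cases[of "M i" j])
      assume lt: "M i < j"
      then have "of_nat (M i) + 1 \<le> (of_nat j :: rat)"
        by (metis Suc_eq_plus1 Suc_leI of_nat_1 of_nat_add of_nat_le_iff)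
      then have "B i < t"
        unfolding 3 1 using bnd by linarith
      then show ?thesis
        using lt by (simp add: g_def q_def h_def)
    next
      assume eq: "M i = j"
      have "B i < t \<longleftrightarrow> A i < t"
        unfolding 4 2[OF eq] by simp
      then show ?thesis
        using eq 2[OF eq] by (simp add: g_def q_def h_def)
    next
      assume gt: "j < M i"
      then have "of_nat j + 1 \<le> (of_nat (M i) :: rat)"
        by (metis Suc_eq_plus1 Suc_leI of_nat_1 of_nat_add of_nat_le_iff)
      then have "\<not> B i < t"
        unfolding 3 1 using bnd by linarith
      then show ?thesis
        using gt by (simp add: g_def q_def h_def)
    qed
  qed
  have "(\<Prod>i<4. f i) * (\<Prod>i<4. q i) = (\<Prod>i<4. h (A i))"
    by (simp add: fq flip: prod.distrib)
  also have "\<dots> = (\<Prod>i<4. h (A (\<pi> i)))"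
    using prod.reindex_bij_betw[OF perm, of "\<lambda>i. h (A i)"] by simp
  also have "\<dots> = (\<Prod>i<4. g i * q i)"
    using B_perm gq by (intro prod.cong) auto
  also have "\<dots> = (\<Prod>i<4. g i) * (\<Prod>i<4. q i)"
    by (rule prod.distrib)
  finally have "(\<Prod>i<4. f i) * (\<Prod>i<4. q i) = (\<Prod>i<4. g i) * (\<Prod>i<4. q i)" .
  moreover have "(\<Prod>i<4. q i) \<noteq> 0"
    by (simp add: q_def)
  ultimately show ?thesis
    by (simp add: f_def g_def)
qed

definition G_term :: "nat \<Rightarrow> rat" where
  "G_term j = ((- 1) ^ j * gam (of_nat j / (of_nat p - 1))) ^ 4
     * (\<Prod>i<4. gam (frac (A i - of_nat j / (of_nat p - 1))) * inverse (gam (A i))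
         * (- of_nat p) ^ nat (- \<lfloor>A i - of_nat j / (of_nat p - 1)\<rfloor>))"

text \<open>With t = j / (p - 1) = - j - x, the four copies of (- 1)^j Gamma_p(t) are distributed
  over the parameters. Where \<open>A i < t\<close>, the fractional part is A i - t + 1, and the
  functional equation together with - p gives the factor p (A i - t), or p alone if j = M i. Then
  \<open>gap_prod\<close> moves these factors to the thresholds \<open>M i\<close>.\<close>

lemma G_term_qcong:
  assumes p5: "p \<ge> 5" and j: "j < p - 1"
  defines "v \<equiv> 1 / (1 - of_nat p)"
  shows "qcong p 3 (G_term j) (hyp_term j (of_nat j * v * of_nat p))"
proof -
  define t where "t = of_nat j / (of_nat p - 1 :: rat)"
  define x where "x = of_nat j * v * of_nat p"
  have p1: "(of_nat p :: rat) - 1 > 0"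
    using p_ge_3 by simp
  have vp: "v = 1 + v * of_nat p" and tv: "t = - (of_nat j * v)"
    using p1 by (simp_all add: v_def t_def field_simps)
  have xt: "x = - (of_nat p * t)"
    by (simp add: x_def tv mult_ac)
  have "of_nat j + x = of_nat j * (1 + v * of_nat p)"
    by (simp add: x_def algebra_simps)
  then have tx: "t = - of_nat j - x"
    using vp tv by (metis minus_add_distrib uminus_add_conv_diff diff_minus_eq_add add.inverse_inverse)
  have v: "v \<in> zloc p"
    unfolding v_def using one_minus_p_zunit by (intro zloc_divide) auto
  have tz: "t \<in> zloc p"
    unfolding tv using v by auto
  have x: "x \<in> zmax"
    unfolding xt using tz by (auto intro: zmaxI)
  have t: "0 \<le> t" "t < 1"
    using j p1 by (auto simp: t_def of_nat_diff less_diff_conv simp flip: of_nat_Suc)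
  have jp: "j < p"
    using j by simp
  define Xh where "Xh = (\<lambda>i. if M i = j then 1 else A i - t)"
  have fac: "qcong p 3 (gam (frac (A i - t)) * inverse (gam (A i)) * (- of_nat p) ^ nat (- \<lfloor>A i - t\<rfloor>))
      (gam (A i - t) / gam (A i) * (if A i < t then of_nat p * Xh i else 1))" if i: "i < 4" for i
  proof (cases "A i < t")
    case False
    then have "\<lfloor>A i - t\<rfloor> = 0"
      using t A_less[OF i] A_pos[OF i] by (intro floor_unique) auto
    then show ?thesis
      using False by (simp add: frac_def divide_inverse)
  next
    case True
    then have fl: "\<lfloor>A i - t\<rfloor> = - 1"
      using t A_less[OF i] A_pos[OF i] by (intro floor_unique) auto
    have eq: "A i - t = of_nat j - of_nat (M i) + (A i + of_nat (M i) + x)"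
      by (simp add: tx)
    have bx: "A i + of_nat (M i) + x \<in> zmax"
      using AM_zmax[OF i] x by auto
    have "qcong p 3 (gam (A i - t + 1)) (- Xh i * gam (A i - t))"
    proof (cases "M i = j")
      case True
      with eq have "A i - t = A i + of_nat (M i) + x"
        by (metis add_0 diff_self)
      with bx have "A i - t \<in> zmax"
        by (simp only:)
      then show ?thesis
        using gam_Suc_zmax True by (simp add: Xh_def)
    next
      case False
      have "\<not> int p dvd int j - int (M i)"
        using False M_less[OF i] jp zdvd_imp_le[of "int p" "int j - int (M i)"]
          zdvd_imp_le[of "int p" "int (M i) - int j"] by (cases "j < M i") (auto simp: dvd_diff_commute)
      then have "of_int (int j - int (M i)) \<in> zunit p"
        by (rule zunit_of_int)
      then have "A i - t \<in> zunit p"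
        unfolding eq using bx by (intro zunit_add_zmax) auto
      then show ?thesis
        using gam_Suc_zunit[of "A i - t"] False by (simp only: Xh_def if_False)
    qed
    then have "qcong p 3 (gam (A i - t + 1) * (inverse (gam (A i)) * (- of_nat p)))
        ((- Xh i * gam (A i - t)) * (inverse (gam (A i)) * (- of_nat p)))"
      using gam_zunit by (intro qcong_rmult) (auto simp: zunit_def)
    then show ?thesis
      using True fl by (simp add: frac_def divide_inverse mult_ac)
  qed
  have Xz: "Xh i \<in> zloc p" if "i < 4" for i
    using A_zloc[OF that] tz by (auto simp: Xh_def)
  have inv: "inverse (gam z) \<in> zloc p" for z
    using gam_zunit by (auto simp: zunit_def)
  define X1 where "X1 = (\<Prod>i<4::nat. (- 1) ^ j * gam t) * (\<Prod>i<4. gam (frac (A i - t)) * inverse (gam (A i))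
         * (- of_nat p) ^ nat (- \<lfloor>A i - t\<rfloor>))"
  define X2 where "X2 = (\<Prod>i<4::nat. (- 1) ^ j * gam t)
      * (\<Prod>i<4. gam (A i - t) / gam (A i) * (if A i < t then of_nat p * Xh i else 1))"
  define X3 where "X3 = (\<Prod>i<4. (- 1) ^ j * gam (- of_nat j - x) * (gam (A i + of_nat j + x) / gam (A i))
      * (if M i < j then A i + of_nat (M i) + x else 1))"
  have "G_term j = X1"
    by (simp add: G_term_def t_def X1_def)
  moreover have "qcong p 3 X1 X2"
    unfolding X1_def X2_def
  proof (intro qcong_lmult qcong_prod)
    show "(\<Prod>i<4::nat. (- 1) ^ j * gam t) \<in> zloc p"
      by (intro zloc_prod zloc_mult zloc_neg_one_power gam_zloc)
    fix i :: nat
    assume "i \<in> {..<4}"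
    then have i: "i < 4"
      by simp
    show "qcong p 3 (gam (frac (A i - t)) * inverse (gam (A i)) * (- of_nat p) ^ nat (- \<lfloor>A i - t\<rfloor>))
      (gam (A i - t) / gam (A i) * (if A i < t then of_nat p * Xh i else 1))"
      using i by (rule fac)
    show "gam (frac (A i - t)) * inverse (gam (A i)) * (- of_nat p) ^ nat (- \<lfloor>A i - t\<rfloor>) \<in> zloc p"
      by (intro zloc_mult inv gam_zloc zloc_power zloc_uminus zloc_of_nat)
    have "(if A i < t then of_nat p * Xh i else 1) \<in> zloc p"
      using Xz[OF i] by (simp add: zloc_mult)
    then show "gam (A i - t) / gam (A i) * (if A i < t then of_nat p * Xh i else 1) \<in> zloc p"
      by (intro zloc_mult zloc_divide gam_zloc gam_zunit)
  qed
  moreover have "X2 = X3"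
  proof -
    have "(\<Prod>i<4. if A i < t then of_nat p * Xh i else 1) = (\<Prod>i<4. if M i < j then of_nat p * (B i - t) else 1)"
      unfolding Xh_def t_def using jp by (rule gap_prod)
    also have "\<dots> = (\<Prod>i<4. if M i < j then A i + of_nat (M i) + x else 1)"
      by (intro prod.cong) (auto simp: A_M xt algebra_simps)
    finally have gap: "(\<Prod>i<4. if A i < t then of_nat p * Xh i else 1)
        = (\<Prod>i<4. if M i < j then A i + of_nat (M i) + x else 1)" .
    have At: "A i - t = A i + of_nat j + x" for i
      by (simp add: tx)
    show ?thesis
      unfolding X2_def X3_def prod.distrib gap tx[symmetric] At by (simp only: mult.assoc)
  qed
  moreover have "qcong p 3 X3 (hyp_term j x)"
    unfolding X3_def hyp_term_def
  proof (rule qcong_prod)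
    fix i :: nat
    assume "i \<in> {..<4}"
    then have i: "i < 4"
      by simp
    show "qcong p 3 ((- 1) ^ j * gam (- of_nat j - x) * (gam (A i + of_nat j + x) / gam (A i))
        * (if M i < j then A i + of_nat (M i) + x else 1)) (hyp_factor (A i) (M i) j x)"
      using p5 M_less A_zloc AM_zmax i x jp by (intro gam_quotient) auto
    then show "(- 1) ^ j * gam (- of_nat j - x) * (gam (A i + of_nat j + x) / gam (A i))
        * (if M i < j then A i + of_nat (M i) + x else 1) \<in> zloc p"
      using M_less A_zloc AM_zmax i x jp qcong_zloc hyp_factor_zloc by metis
    show "hyp_factor (A i) (M i) j x \<in> zloc p"
      using M_less A_zloc AM_zmax i x jp by (intro hyp_factor_zloc) auto
  qed
  ultimately show ?thesis
    unfolding x_def using qcong_trans by metis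
qed

lemma hyp_term_0: "hyp_term j 0 = (\<Prod>i<4. pochhammer (A i) j) / fact j ^ 4"
proof -
  have "hyp_term j 0 = (\<Prod>i<4. pochhammer (A i) j / fact j)"
    unfolding hyp_term_def using M_less A_zloc AM_zmax by (intro prod.cong hyp_factor_0) auto
  then show ?thesis
    by (simp add: prod_dividef)
qed

text \<open>Here j + x = - 1. Each parameter with \<open>M i < p - 1\<close> contributes its factor
  A i + M i - p = - p (1 - B i), and \<open>edge\<close> says that these supply
  \<open>p ^ 3\<close>.\<close>

lemma hyp_term_edge: "qcong p 3 (hyp_term (p - 1) (- of_nat p)) 0"
proof -
  define c where "c = (\<lambda>i. if M i < p - 1 then of_nat p * (1 - B i) else 1)"
  have "\<exists>z\<in>zloc p. hyp_factor (A i) (M i) (p - 1) (- of_nat p) = z * c i" if i: "i < 4" for i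
  proof (cases "M i < p - 1")
    case False
    have "hyp_factor (A i) (M i) (p - 1) (- of_nat p) \<in> zloc p"
      using M_less A_zloc AM_zmax i p_pos by (intro hyp_factor_zloc) auto
    then show ?thesis
      using False by (simp add: c_def)
  next
    case True
    define b where "b = A i + of_nat (M i)"
    define z where "z = (- 1) ^ M i * pochhammer (1 - b) (M i)
      * pochhammer (1 + (b + - of_nat p)) (p - 1 - M i - 1) / pochhammer (1 + - of_nat p) (p - 1)"
    have b: "b \<in> zmax"
      using AM_zmax[OF i] by (simp add: b_def)
    have "hyp_factor (A i) (M i) (p - 1) (- of_nat p) = z * (b + - of_nat p)"
      unfolding z_def b_def using True M_less A_zloc AM_zmax i by (intro hyp_factor_gt) auto
    also have "\<dots> = (- z) * c i"
      using True A_M[OF i] by (simp add: c_def b_def algebra_simps)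
    finally have "hyp_factor (A i) (M i) (p - 1) (- of_nat p) = - z * c i" .
    moreover have "- z \<in> zloc p"
      unfolding z_def using b p_pos
      by (intro zloc_uminus zloc_divide zloc_mult zloc_neg_one_power zloc_pochhammer pochhammer_1_zunit) auto
    ultimately show ?thesis
      by blast
  qed
  then obtain z where z: "\<And>i. i < 4 \<Longrightarrow> z i \<in> zloc p"
    and eq: "\<And>i. i < 4 \<Longrightarrow> hyp_factor (A i) (M i) (p - 1) (- of_nat p) = z i * c i"
    by metis
  have "hyp_term (p - 1) (- of_nat p) = (\<Prod>i<4. z i) * (\<Prod>i<4. c i)"
    unfolding hyp_term_def using eq by (simp flip: prod.distrib)
  also have "qcong p 3 \<dots> ((\<Prod>i<4. z i) * 0)"
    using edge z unfolding c_def by (intro qcong_lmult zloc_prod) auto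
  finally show ?thesis
    by simp
qed

text \<open>The sign is the one produced by the complementary pairs {0, 3} and {1, 2}. Within each
  pair the \<open>M i\<close> add up to \<open>p - 1\<close>.\<close>

definition inv_poly :: "rat poly" where
  "inv_poly = smult ((- 1) ^ (M 0 + M 1)) (\<Prod>i<4. \<Prod>s<M i. [:A i + of_nat s, - 1:])"

lemma poly_inv_poly: "poly inv_poly y = (- 1) ^ (M 0 + M 1) * (\<Prod>i<4. pochhammer (A i - y) (M i))"
proof -
  have "poly (\<Prod>s<m. [:a + of_nat s, - 1:]) y = pochhammer (a - y) m" for a and m :: nat
    unfolding poly_prod pochhammer_prod lessThan_atLeast0 by (intro prod.cong) auto
  then show ?thesis
    by (simp add: inv_poly_def poly_prod)
qed

lemma inv_poly_lead:
  "degree inv_poly = 2 * (p - 1)" "coeff inv_poly (2 * (p - 1)) = (- 1) ^ (M 0 + M 1)"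
proof -
  define Q where "Q = (\<Prod>i<4. \<Prod>s<M i. [:A i + of_nat s, - 1:])"
  have "M 0 + M 3 = p - 1" "M 1 + M 2 = p - 1"
    using M_compl[of 0] M_compl[of 1] M_less[of 0] M_less[of 1] by auto
  then have sum: "M 0 + M 1 + M 2 + M 3 = 2 * (p - 1)"
    by linarith
  have d: "degree (\<Prod>s<m. [:a + of_nat s, - 1:]) = m" for a :: rat and m :: nat
    by (subst degree_prod_eq_sum_degree) auto
  have l: "lead_coeff (\<Prod>s<m. [:a + of_nat s, - 1:]) = (- 1) ^ m" for a :: rat and m :: nat
    by (subst lead_coeff_prod) simp
  have "degree Q = (\<Sum>i<4. M i)"
    unfolding Q_def by (subst degree_prod_eq_sum_degree) (auto simp: d)
  also have "\<dots> = 2 * (p - 1)"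
    using sum by (simp add: numeral_eq_Suc)
  finally have dQ: "degree Q = 2 * (p - 1)" .
  have "lead_coeff Q = (\<Prod>i<4. lead_coeff (\<Prod>s<M i. [:A i + of_nat s, - 1:]))"
    unfolding Q_def by (rule lead_coeff_prod)
  also have "\<dots> = (\<Prod>i<4. (- 1) ^ M i)"
    by (simp only: l)
  also have "\<dots> = (- 1) ^ (M 0 + M 1 + M 2 + M 3)"
    by (simp add: prod_4 power_add)
  also have "\<dots> = 1"
    unfolding sum by simp
  finally have lQ: "lead_coeff Q = 1" .
  show "degree inv_poly = 2 * (p - 1)" "coeff inv_poly (2 * (p - 1)) = (- 1) ^ (M 0 + M 1)"
    using dQ lQ by (simp_all add: inv_poly_def Q_def[symmetric])
qed

lemma hyp_term_qcong:
  assumes p5: "p \<ge> 5" and j: "j < p"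
  shows "\<exists>k\<in>zloc p. \<forall>x\<in>zmax. qcong p 3 (hyp_term j x)
    ((1 + of_nat p ^ 2 * k) * (poly inv_poly (of_nat j + x) / (node_prod j x * node_prod j x)))"
proof -
  define E where "E = (\<lambda>i x. (- 1) ^ M i * pochhammer (A i - of_nat j - x) (M i)
       * pochhammer (1 - A i - of_nat j - x) (p - 1 - M i) / node_prod j x)"
  have "\<exists>k\<in>zloc p. \<forall>x\<in>zmax. qcong p 3 (hyp_factor (A i) (M i) j x * hyp_factor (1 - A i) (p - 1 - M i) j x)
    ((1 + of_nat p ^ 2 * k) * E i x)" if "i < 4" for i
    unfolding E_def using p5 j that M_less A_zloc AM_zmax by (intro hyp_factor_pair) auto
  from this[of 0] this[of 1] obtain k l where k: "k \<in> zloc p" and l: "l \<in> zloc p"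
    and 0: "\<And>x. x \<in> zmax \<Longrightarrow> qcong p 3 (hyp_factor (A 0) (M 0) j x * hyp_factor (A 3) (M 3) j x)
      ((1 + of_nat p ^ 2 * k) * E 0 x)"
    and 1: "\<And>x. x \<in> zmax \<Longrightarrow> qcong p 3 (hyp_factor (A 1) (M 1) j x * hyp_factor (A 2) (M 2) j x)
      ((1 + of_nat p ^ 2 * l) * E 1 x)"
    using M_compl[of 0] M_compl[of 1] A_compl[of 0] A_compl[of 1] by auto
  have "qcong p 3 (hyp_term j x)
    ((1 + of_nat p ^ 2 * (k + l)) * (poly inv_poly (of_nat j + x) / (node_prod j x * node_prod j x)))"
    if x: "x \<in> zmax" for x
  proof -
    have E: "E i x \<in> zloc p" if "i < 4" for i
    proof -
      have "A i - of_nat j - x \<in> zloc p" "1 - A i - of_nat j - x \<in> zloc p"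
        using A_zloc[OF that] x by auto
      then show ?thesis
        unfolding E_def using j x
        by (intro zloc_divide node_prod_zunit zloc_mult zloc_pochhammer zloc_neg_one_power)
    qed
    have "hyp_term j x = (hyp_factor (A 0) (M 0) j x * hyp_factor (A 3) (M 3) j x)
        * (hyp_factor (A 1) (M 1) j x * hyp_factor (A 2) (M 2) j x)"
      by (simp add: hyp_term_def prod_4 mult_ac)
    also have "qcong p 3 \<dots> (((1 + of_nat p ^ 2 * k) * E 0 x) * ((1 + of_nat p ^ 2 * l) * E 1 x))"
    proof (rule qcong_mult[OF 0[OF x] 1[OF x]])
      show "(1 + of_nat p ^ 2 * k) * E 0 x \<in> zloc p"
        using k E[of 0] by (intro zloc_mult zloc_add zloc_power) auto
      show "hyp_factor (A 1) (M 1) j x * hyp_factor (A 2) (M 2) j x \<in> zloc p"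
        using M_less A_zloc AM_zmax x j by (intro zloc_mult hyp_factor_zloc) auto
    qed
    also have "\<dots> = ((1 + of_nat p ^ 2 * k) * (1 + of_nat p ^ 2 * l)) * (E 0 x * E 1 x)"
      by (simp only: mult_ac)
    also have "qcong p 3 \<dots> ((1 + of_nat p ^ 2 * (k + l)) * (E 0 x * E 1 x))"
    proof (rule qcong_rmult)
      show "qcong p 3 ((1 + of_nat p ^ 2 * k) * (1 + of_nat p ^ 2 * l)) (1 + of_nat p ^ 2 * (k + l))"
        using k l by (intro qcongI[of "of_nat p * (k * l)"]) (auto simp: algebra_simps power2_eq_square power3_eq_cube)
      show "E 0 x * E 1 x \<in> zloc p"
        using E by auto
    qed
    also have "E 0 x * E 1 x = poly inv_poly (of_nat j + x) / (node_prod j x * node_prod j x)"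
      using M_compl[of 0] M_compl[of 1] A_compl[of 0] A_compl[of 1]
      by (simp add: E_def poly_inv_poly prod_4 power_add diff_diff_eq add.assoc mult_ac)
    finally show ?thesis .
  qed
  then show ?thesis
    using k l by (intro bexI[of _ "k + l"]) auto
qed

lemma G_sum_qcong:
  assumes p5: "p \<ge> 5"
  shows "qcong p 3 (- 1 / (of_nat p - 1) * (\<Sum>j\<in>{0..p - 2}. G_term j))
    ((\<Sum>j\<in>{0..p - 1}. (\<Prod>i<4. pochhammer (A i) j) / fact j ^ 4)
      + gam (A 0) * gam (A 1) * gam (A 2) * gam (A 3) * of_nat p)"
proof -
  define v where "v = 1 / (1 - of_nat p :: rat)"
  have v: "v \<in> zloc p"
    unfolding v_def using one_minus_p_zunit by (intro zloc_divide) auto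
  have v_eq: "v = - 1 / (of_nat p - 1)"
    using one_minus_p_zunit[THEN zunit_nz] by (simp add: v_def field_simps)
  obtain K where K: "\<And>j. j < p \<Longrightarrow> K j \<in> zloc p" and
    T: "\<And>j x. j < p \<Longrightarrow> x \<in> zmax \<Longrightarrow> qcong p 3 (hyp_term j x)
    ((1 + of_nat p ^ 2 * K j) * (poly inv_poly (of_nat j + x) / (node_prod j x * node_prod j x)))"
    using hyp_term_qcong[OF p5] by metis
  have main: "qcong p 3 (\<Sum>j<p. v * hyp_term j (of_nat j * v * of_nat p) - hyp_term j 0)
      (of_nat p * (- 1) ^ (M 0 + M 1))"
    unfolding v_def inv_poly_lead(2)[symmetric]
  proof (rule shifted_sum_diff[OF p5, where K = K])
    show "degree inv_poly \<le> 2 * (p - 1)"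
      by (simp add: inv_poly_lead)
    show "coeff inv_poly (2 * (p - 1)) \<in> zloc p"
      unfolding inv_poly_lead by (rule zloc_neg_one_power)
    show "poly inv_poly y \<in> zloc p" if "y \<in> zloc p" for y
      unfolding poly_inv_poly using that A_zloc
      by (intro zloc_mult zloc_neg_one_power zloc_prod zloc_pochhammer) auto
    show "qcong p 1 (poly inv_poly x) (poly inv_poly y)" if "qcong p 1 x y" "y \<in> zloc p" for x y
      unfolding poly_inv_poly using that A_zloc qcong_zloc[OF that]
      by (intro qcong_lmult qcong_prod qcong_pochhammer qcong_diff zloc_pochhammer zloc_neg_one_power) auto
  qed (use K T in auto)
  have set_eq: "{0..p - 2} = {..<p - 1}" "{0..p - 1} = {..<p}"
    using p5 by auto
  have Suc: "(\<Sum>j<p. f j) = (\<Sum>j<p - 1. f j) + f (p - 1)" for f :: "nat \<Rightarrow> rat"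
    using p_pos sum.lessThan_Suc[of f "p - 1"] by simp
  have last: "of_nat (p - 1) * v * of_nat p = - of_nat p"
    using one_minus_p_zunit[THEN zunit_nz] p5 by (simp add: v_def of_nat_diff field_simps)
  have "qcong p 3 (v * (\<Sum>j<p - 1. G_term j)) (v * (\<Sum>j<p - 1. hyp_term j (of_nat j * v * of_nat p)))"
    unfolding v_def using p5 v[unfolded v_def] by (intro qcong_lmult qcong_sum G_term_qcong) auto
  also have "\<dots> = v * (\<Sum>j<p - 1. hyp_term j (of_nat j * v * of_nat p)) + v * 0"
    by simp
  \<comment> \<open>G has no term for j = p - 1; a term that vanishes modulo \<open>p ^ 3\<close> is
    inserted to complete the sum.\<close>
  also have "qcong p 3 \<dots> (v * (\<Sum>j<p - 1. hyp_term j (of_nat j * v * of_nat p)) + v * hyp_term (p - 1) (- of_nat p))"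
    using hyp_term_edge v by (intro qcong_add[OF qcong_refl] qcong_lmult) (auto intro: qcong_sym)
  also have "\<dots> = (\<Sum>j<p. v * hyp_term j (of_nat j * v * of_nat p))"
    unfolding Suc last by (simp add: sum_distrib_left)
  also have "\<dots> = (\<Sum>j<p. v * hyp_term j (of_nat j * v * of_nat p) - hyp_term j 0) + (\<Sum>j<p. hyp_term j 0)"
    by (simp add: sum_subtractf)
  also have "qcong p 3 \<dots> (of_nat p * (- 1) ^ (M 0 + M 1) + (\<Sum>j<p. hyp_term j 0))"
    using main by (rule qcong_add) auto
  also have "qcong p 3 \<dots> (of_nat p * (gam (A 0) * gam (A 3) * (gam (A 1) * gam (A 2))) + (\<Sum>j<p. hyp_term j 0))"
  proof (intro qcong_add qcong_refl qcong_lmult)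
    \<comment> \<open>The reflection formula for the two complementary pairs identifies the leading
      coefficient with s(p).\<close>
    have "qcong p 3 (gam (A i) * gam (A (3 - i))) (- ((- 1) ^ M i))" if "i < 4" for i
      unfolding A_compl[OF that] using A_zloc AM_zmax M_less that by (intro gam_reflect_residue) auto
    from this[of 0] this[of 1] have "qcong p 3 (gam (A 0) * gam (A 3) * (gam (A 1) * gam (A 2)))
        ((- ((- 1) ^ M 0)) * (- ((- 1) ^ M 1)))"
      by (intro qcong_mult zloc_uminus zloc_neg_one_power zloc_mult gam_zloc) auto
    then show "qcong p 3 ((- 1) ^ (M 0 + M 1)) (gam (A 0) * gam (A 3) * (gam (A 1) * gam (A 2)))"
      by (simp add: power_add qcong_sym)
  qed auto
  finally show ?thesis
    unfolding set_eq hyp_term_0 v_eq by (simp add: algebra_simps)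
qed

end

context odd_prime
begin

section \<open>The supercongruence\<close>

definition G_rat :: "rat list \<Rightarrow> rat" where
  "G_rat as = - 1 / (of_nat p - 1) * (\<Sum>j\<in>{0..p - 2}.
     ((- 1) ^ j * gam (of_nat j / (of_nat p - 1))) ^ length as
     * (\<Prod>i<length as. gam (frac (as ! i - of_nat j / (of_nat p - 1))) * inverse (gam (as ! i))
         * (- of_nat p) ^ nat (- \<lfloor>as ! i - of_nat j / (of_nat p - 1)\<rfloor>)))"

text \<open>The fourth power collects the three lower parameters 1 and the factorial of the series
  itself.\<close>

definition F_rat :: "rat list \<Rightarrow> rat" where
  "F_rat as = (\<Sum>j\<in>{0..p - 1}. (\<Prod>a\<leftarrow>as. pochhammer a j) / fact j ^ 4)"

lemma p_minus_1_zunit: "of_nat p - 1 \<in> zunit p"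
  using one_minus_p_zunit zunit_uminus by fastforce

lemma zloc_frac: "x \<in> zloc p \<Longrightarrow> frac x \<in> zloc p"
  by (simp add: frac_def zloc_diff)

text \<open>The exponents of the nonunit \<open>- p\<close> are integers. As the parameters are less
  than 1 and j / (p - 1) is nonnegative, the floors are at most 0, so these are ordinary
  powers.\<close>

lemma rep_padic_G:
  assumes "\<And>a. a \<in> set as \<Longrightarrow> a \<in> zloc p \<and> 0 < a \<and> a < 1"
  shows "rep (padic_G p as) (G_rat as)"
proof -
  have t: "of_nat j / (of_nat p - 1) \<in> zloc p" for j
    using p_minus_1_zunit by (intro zloc_divide) auto
  have "rep (padic_of_int p (- int p) [^]\<^bsub>R\<^esub> (- \<lfloor>as ! i - of_nat j / (of_nat p - 1)\<rfloor>))
      ((- of_nat p) ^ nat (- \<lfloor>as ! i - of_nat j / (of_nat p - 1)\<rfloor>))"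
    if i: "i < length as" and j: "j \<le> p - 2" for i j
  proof -
    define n where "n = nat (- \<lfloor>as ! i - of_nat j / (of_nat p - 1)\<rfloor>)"
    have "of_nat j \<le> (of_nat (p - 2) :: rat)"
      using j by simp
    then have "of_nat j / (of_nat p - 1) < (1 :: rat)"
      using p_ge_3 by (simp add: of_nat_diff)
    moreover have "0 < as ! i" "as ! i < 1" "0 \<le> of_nat j / (of_nat p - 1 :: rat)"
      using assms[of "as ! i"] i p_ge_3 by auto
    ultimately have "\<lfloor>as ! i - of_nat j / (of_nat p - 1)\<rfloor> \<le> 0"
      by (simp add: floor_le_zero)
    then have "- \<lfloor>as ! i - of_nat j / (of_nat p - 1)\<rfloor> = int n"
      by (simp add: n_def)
    moreover have "rep (padic_of_int p (- int p) [^]\<^bsub>R\<^esub> n) (of_int (- int p) ^ n)"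
      by (intro rep_power rep_of_int)
    ultimately show ?thesis
      unfolding n_def[symmetric] by (simp add: int_pow_int)
  qed
  then show ?thesis
    unfolding padic_G_def G_rat_def Let_def
    using assms t p_minus_1_zunit gam_zunit rep_of_int[of "(- 1) ^ j" for j]
    by (intro rep_mult rep_of_rat rep_finsum rep_finprod rep_power rep_gamma rep_inv
        zloc_frac zloc_diff) (auto intro!: zloc_divide zloc_uminus)
qed

lemma F_rat_zloc:
  assumes "\<And>a. a \<in> set as \<Longrightarrow> a \<in> zloc p"
  shows "F_rat as \<in> zloc p"
proof -
  have "(\<Prod>a\<leftarrow>as. pochhammer a j) \<in> zloc p" for j
    using assms by (induction as) auto
  moreover have "fact j ^ 4 \<in> zunit p" if "j \<in> {0..p - 1}" for j
    using that p_pos by (intro zunit_power fact_zunit) auto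
  ultimately show ?thesis
    unfolding F_rat_def by (intro zloc_sum zloc_divide)
qed

lemma F_rat_hypergeom: "hypergeom_trunc as [1, 1, 1] 1 (p - 1) = F_rat as"
  by (simp add: hypergeom_trunc_def F_rat_def power4_eq_xxxx mult_ac flip: pochhammer_fact)

lemma supercongruence_of_rat:
  assumes "\<And>a. a \<in> {a0, a1, a2, a3} \<Longrightarrow> a \<in> zloc p \<and> 0 < a \<and> a < 1"
    and "qcong p 3 (G_rat [a0, a1, a2, a3]) (F_rat [a0, a1, a2, a3] + gam a0 * gam a1 * gam a2 * gam a3 * of_nat p)"
  shows "padic_cong p 3 (padic_G p [a0, a1, a2, a3])
    (padic_of_rat p (hypergeom_trunc [a0, a1, a2, a3] [1, 1, 1] 1 (p - 1)) \<oplus>\<^bsub>R\<^esub>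
      (padic_gamma p (padic_of_rat p a0) \<otimes>\<^bsub>R\<^esub> padic_gamma p (padic_of_rat p a1) \<otimes>\<^bsub>R\<^esub>
       padic_gamma p (padic_of_rat p a2) \<otimes>\<^bsub>R\<^esub> padic_gamma p (padic_of_rat p a3)) \<otimes>\<^bsub>R\<^esub>
      padic_of_int p (int p))"
proof (rule padic_cong_3_rep[OF _ _ assms(2)])
  show "rep (padic_G p [a0, a1, a2, a3]) (G_rat [a0, a1, a2, a3])"
    using assms(1) by (intro rep_padic_G) auto
  have "F_rat [a0, a1, a2, a3] \<in> zloc p"
    using assms(1) by (intro F_rat_zloc) auto
  moreover have "rep (padic_of_int p (int p)) (of_nat p)"
    using rep_of_int[of "int p"] by simp
  ultimately show "rep (padic_of_rat p (hypergeom_trunc [a0, a1, a2, a3] [1, 1, 1] 1 (p - 1)) \<oplus>\<^bsub>R\<^esub>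
      (padic_gamma p (padic_of_rat p a0) \<otimes>\<^bsub>R\<^esub> padic_gamma p (padic_of_rat p a1) \<otimes>\<^bsub>R\<^esub>
       padic_gamma p (padic_of_rat p a2) \<otimes>\<^bsub>R\<^esub> padic_gamma p (padic_of_rat p a3)) \<otimes>\<^bsub>R\<^esub>
      padic_of_int p (int p))
     (F_rat [a0, a1, a2, a3] + gam a0 * gam a1 * gam a2 * gam a3 * of_nat p)"
    unfolding F_rat_hypergeom using assms(1)
    by (intro rep_add rep_mult rep_of_rat rep_gamma) auto
qed

end

lemma (in dwork_quadruple) supercongruence_rat:
  assumes "p \<ge> 5"
  shows "qcong p 3 (G_rat [A 0, A 1, A 2, A 3])
    (F_rat [A 0, A 1, A 2, A 3] + gam (A 0) * gam (A 1) * gam (A 2) * gam (A 3) * of_nat p)"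
proof -
  have "G_rat [A 0, A 1, A 2, A 3] = - 1 / (of_nat p - 1) * (\<Sum>j\<in>{0..p - 2}. G_term j)"
    unfolding G_rat_def G_term_def by (simp add: prod_4 power4_eq_xxxx mult_ac)
  moreover have "F_rat [A 0, A 1, A 2, A 3] = (\<Sum>j\<in>{0..p - 1}. (\<Prod>i<4. pochhammer (A i) j) / fact j ^ 4)"
    unfolding F_rat_def by (simp add: prod_4 mult_ac)
  ultimately show ?thesis
    using G_sum_qcong[OF assms] by simp
qed

section \<open>From congruences modulo d to the conditions on the quadruple\<close>

context odd_prime
begin

lemma qcong_0_mult:
  assumes "qcong p k x 0" "qcong p l y 0"
  shows "qcong p (k + l) (x * y) 0"
proof -
  obtain v w where "v \<in> zloc p" "x = of_nat p ^ k * v" "w \<in> zloc p" "y = of_nat p ^ l * w"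
    using assms by (auto simp: qcong_0_iff)
  then show ?thesis
    by (intro qcongI[of "v * w"]) (auto simp: power_add)
qed

text \<open>Parameters are encoded by their numerators over \<open>d\<close>. The Dwork prime of
  \<open>a i / d\<close> is \<open>a (\<pi> i) / d\<close>, because \<open>p * a (\<pi> i)\<close>
  is congruent to \<open>a i\<close>; for the indices 2 and 3 this follows by complement.\<close>

lemma dwork_quadruple_int:
  fixes r d :: int and \<pi> :: "nat \<Rightarrow> nat"
  defines "a \<equiv> (\<lambda>i::nat. [1, r, d - r, d - 1] ! i)"
  assumes r: "2 \<le> r" "r \<le> d - 2" and cop: "coprime d (int p)"
    and \<pi>: "\<And>i. i < 4 \<Longrightarrow> \<pi> i < 4" "inj_on \<pi> {..<4}" "\<And>i. i < 4 \<Longrightarrow> \<pi> (3 - i) = 3 - \<pi> i"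
    and cong: "[int p * a (\<pi> 0) = 1] (mod d)" "[int p * a (\<pi> 1) = r] (mod d)"
    and edge: "int p * a (\<pi> 3) = d - 1 \<Longrightarrow> int p * a (\<pi> 1) = r \<or> int p * a (\<pi> 2) = d - r
      \<Longrightarrow> \<exists>i<4. int p * a (\<pi> i) \<noteq> a i \<and> int p dvd a (\<pi> i)"
  shows "dwork_quadruple p (\<lambda>i. of_int (a i) / of_int d) (\<lambda>i. of_int (a (\<pi> i)) / of_int d)
    (\<lambda>i. nat ((int p * a (\<pi> i) - a i) div d)) \<pi>"
proof -
  have d: "d > 0"
    using r by simp
  have av: "a 0 = 1" "a 1 = r" "a 2 = d - r" "a 3 = d - 1"
    by (simp_all add: a_def)
  have a_bounds: "0 < a i" "a i < d" if "i < 4" for i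
    using less_4_cases[OF that] av r by auto
  have a_compl: "a (3 - i) = d - a i" if "i < 4" for i
    using less_4_cases[OF that] by (auto simp: a_def)
  have ap_bounds: "0 < a (\<pi> i)" "a (\<pi> i) < d" if "i < 4" for i
    using a_bounds[OF \<pi>(1)[OF that]] by auto
  have ap_compl: "a (\<pi> (3 - i)) = d - a (\<pi> i)" if "i < 4" for i
    using \<pi>(3)[OF that] a_compl[OF \<pi>(1)[OF that]] by simp
  have flip: "d dvd int p * a (\<pi> (3 - i)) - a (3 - i)" if "d dvd int p * a (\<pi> i) - a i" "i < 4" for i
  proof -
    have "int p * a (\<pi> (3 - i)) - a (3 - i) = (int p - 1) * d - (int p * a (\<pi> i) - a i)"
      unfolding ap_compl[OF that(2)] a_compl[OF that(2)] by (simp add: algebra_simps)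
    then show ?thesis
      using that(1) by (metis dvd_diff dvd_triv_right)
  qed
  have dv01: "d dvd int p * a (\<pi> 0) - a 0" "d dvd int p * a (\<pi> 1) - a 1"
    using cong av by (simp_all add: cong_iff_dvd_diff)
  have dv: "d dvd int p * a (\<pi> i) - a i" if "i < 4" for i
    using less_4_cases[OF that] dv01 flip[of 0] flip[of 1] by auto
  define M where "M = (\<lambda>i. nat ((int p * a (\<pi> i) - a i) div d))"
  have M: "int (M i) * d = int p * a (\<pi> i) - a i" if "i < 4" for i
  proof -
    define q where "q = (int p * a (\<pi> i) - a i) div d"
    have q: "q * d = int p * a (\<pi> i) - a i"
      using dv[OF that] by (simp add: q_def)
    have "int p * a (\<pi> i) > 0"
      using p_pos ap_bounds[OF that] by simp
    then have "(q + 1) * d > 0"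
      using q a_bounds[OF that] by (simp add: algebra_simps)
    then have "q \<ge> 0"
      using d by (simp add: zero_less_mult_iff)
    then show ?thesis
      using q by (simp add: M_def q_def)
  qed
  have M0: "M i = 0 \<longleftrightarrow> int p * a (\<pi> i) = a i" if "i < 4" for i
    using M[OF that] d by auto
  have M_compl: "M i + M (3 - i) = p - 1" if i: "i < 4" for i
  proof -
    have i': "3 - i < 4"
      by simp
    have "(int (M i) + int (M (3 - i))) * d = (int p - 1) * d"
      unfolding distrib_right M[OF i] M[OF i'] ap_compl[OF i] a_compl[OF i]
      by (simp add: algebra_simps)
    then have "int (M i) + int (M (3 - i)) = int p - 1"
      using d by simp
    then show ?thesis
      by linarith
  qed
  have du: "of_int d \<in> zunit p"
    using cop coprime_p_iff zunit_of_int by blast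
  \<comment> \<open>The factors of the edge product in reversed order:
    \<open>M (3 - i) < p - 1\<close> iff \<open>M i \<noteq> 0\<close>, and 1 minus a Dwork prime
    belongs to the complementary index. Below, \<open>n i\<close> is a lower bound for the exponent
    of \<open>p\<close> in \<open>e i\<close>.\<close>
  define e where "e = (\<lambda>i. if M i = 0 then 1 else of_nat p * (of_int (a (\<pi> i)) / of_int d) :: rat)"
  define n where "n = (\<lambda>i. if M i = 0 then 0 else if int p dvd a (\<pi> i) then 2 else 1 :: nat)"
  have en: "qcong p (n i) (e i) 0" for i
  proof (cases "M i \<noteq> 0 \<and> int p dvd a (\<pi> i)")
    case True
    then obtain z where "a (\<pi> i) = int p * z"
      by blast
    then show ?thesis
      using True du by (intro qcongI[of "of_int z / of_int d"]) (auto simp: n_def e_def power2_eq_square)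
  next
    case False
    then show ?thesis
      using du by (intro qcongI[of "if M i = 0 then 1 else of_int (a (\<pi> i)) / of_int d"]) (auto simp: n_def e_def)
  qed
  have e_prod: "(\<Prod>i<4. if M i < p - 1 then of_nat p * (1 - of_int (a (\<pi> i)) / of_int d) else 1)
      = e 0 * e 1 * e 2 * e 3"
  proof -
    have "(\<Prod>i<4. if M i < p - 1 then of_nat p * (1 - of_int (a (\<pi> i)) / of_int d) else 1) = (\<Prod>i<4. e (3 - i))"
    proof (rule prod.cong)
      fix i :: nat
      assume "i \<in> {..<4}"
      then have i: "i < 4"
        by simp
      have "M i < p - 1 \<longleftrightarrow> M (3 - i) \<noteq> 0"
        using M_compl[OF i] by auto
      moreover have "1 - of_int (a (\<pi> i)) / of_int d = of_int (a (\<pi> (3 - i))) / (of_int d :: rat)"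
        unfolding ap_compl[OF i] using d by (simp add: field_simps)
      ultimately show "(if M i < p - 1 then of_nat p * (1 - of_int (a (\<pi> i)) / of_int d) else 1) = e (3 - i)"
        by (simp add: e_def)
    qed simp
    then show ?thesis
      by (simp add: numeral_eq_Suc mult_ac)
  qed
  \<comment> \<open>\<open>M 0\<close> is not 0, and \<open>M 1\<close> and \<open>M 2\<close> are
    not both 0, so two factors \<open>p\<close> are certain. A third can fail only if
    \<open>M 3\<close> and one of \<open>M 1\<close>, \<open>M 2\<close> are 0; then
    \<open>edge\<close> provides a numerator divisible by \<open>p\<close>.\<close>
  have "n 0 + n 1 + n 2 + n 3 \<ge> 3"
  proof -
    have nz: "n i = 0 \<longleftrightarrow> M i = 0" for i
      by (simp add: n_def)
    have p1: "p - 1 > 0"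
      using p_ge_3 by simp
    have "int p * a (\<pi> 0) > 1"
      using p_ge_3 ap_bounds[of 0] by (intro less_1_mult') auto
    then have "M 0 \<noteq> 0"
      using M0[of 0] av by auto
    then have 0: "n 0 > 0"
      using nz[of 0] by simp
    have 12: "n 1 + n 2 > 0"
      using M_compl[of 1] p1 nz[of 1] nz[of 2] by auto
    show ?thesis
    proof (cases "M 3 = 0 \<and> (M 1 = 0 \<or> M 2 = 0)")
      case False
      then show ?thesis
        using 0 12 nz[of 1] nz[of 2] nz[of 3] by auto
    next
      case True
      then obtain i where "i < 4" "n i = 2"
        using edge M0 av by (auto simp: n_def)
      then show ?thesis
        using 0 12 less_4_cases[of i] by auto
    qed
  qed
  moreover have "qcong p (n 0 + n 1 + n 2 + n 3) (e 0 * e 1 * e 2 * e 3) 0"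
    by (intro qcong_0_mult en)
  ultimately have e3: "qcong p 3 (e 0 * e 1 * e 2 * e 3) 0"
    using qcong_mono by blast
  show ?thesis
    unfolding M_def[symmetric]
  proof unfold_locales
    show "qcong p 3 (\<Prod>i<4. if M i < p - 1 then of_nat p * (1 - of_int (a (\<pi> i)) / of_int d) else 1) 0"
      unfolding e_prod by (rule e3)
    have "\<pi> ` {..<4} \<subseteq> {..<4}"
      using \<pi>(1) by auto
    then show "bij_betw \<pi> {..<4} {..<4}"
      using \<pi>(2) by (simp add: bij_betw_def endo_inj_surj)
    fix i :: nat
    assume i: "i < 4"
    show "of_int (a i) / of_int d + of_nat (M i) = of_nat p * (of_int (a (\<pi> i)) / (of_int d :: rat))"
    proof -
      have "of_int (int (M i) * d) = (of_int (int p * a (\<pi> i) - a i) :: rat)"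
        using M[OF i] by simp
      then show ?thesis
        using d by (simp add: field_simps)
    qed
    show "of_int (a (3 - i)) / of_int d = 1 - of_int (a i) / (of_int d :: rat)"
      unfolding a_compl[OF i] using d by (simp add: field_simps)
    show "of_int (a (\<pi> (3 - i))) / of_int d = 1 - of_int (a (\<pi> i)) / (of_int d :: rat)"
      unfolding ap_compl[OF i] using d by (simp add: field_simps)
  qed (use du d a_bounds ap_bounds in \<open>auto simp: field_simps\<close>)
qed

section \<open>The prime 3\<close>

context
  assumes p3: "p = 3"
begin

text \<open>For \<open>p = 3\<close> the index j = 1 has t = 1 / 2. Together, \<open>a\<close> and
  \<open>1 - a\<close> leave gamma values at complementary arguments, which reflection evaluates to
  signs; the factor - 3 comes from the one floor equal to - 1.\<close>

lemma three_pair: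
  assumes a: "a \<in> zloc p" "0 < a" "a < 1 / 2"
    and m: "a + of_nat m \<in> zmax" "m < 3" and n: "a + 1 / 2 + of_nat n \<in> zmax" "n < 3"
  shows "qcong p 3 (gam (frac (a - 1 / 2)) * inverse (gam a) * (- 3) ^ nat (- \<lfloor>a - 1 / 2\<rfloor>)
     * (gam (frac (1 - a - 1 / 2)) * inverse (gam (1 - a)) * (- 3) ^ nat (- \<lfloor>1 - a - 1 / 2\<rfloor>)))
     (- 3 * (- 1) ^ (m + n))"
proof -
  define w where "w = a + 1 / 2"
  have w: "w \<in> zloc p"
    unfolding w_def using a(1) zlocI[of 2 1] p3 by (intro zloc_add) auto
  have fl: "\<lfloor>a - 1 / 2\<rfloor> = - 1" "\<lfloor>1 - a - 1 / 2\<rfloor> = 0"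
    using a by (intro floor_unique; simp)+
  have fr: "frac (a - 1 / 2) = w" "frac (1 - a - 1 / 2) = 1 - w"
    unfolding frac_def fl by (simp_all add: w_def)
  have "gam (frac (a - 1 / 2)) * inverse (gam a) * (- 3) ^ nat (- \<lfloor>a - 1 / 2\<rfloor>)
     * (gam (frac (1 - a - 1 / 2)) * inverse (gam (1 - a)) * (- 3) ^ nat (- \<lfloor>1 - a - 1 / 2\<rfloor>))
     = - 3 * (gam w * gam (1 - w)) / (gam a * gam (1 - a))"
    unfolding fr fl using gam_zunit[THEN zunit_nz] by (simp add: field_simps)
  also have "qcong p 3 \<dots> (- 3 * (- ((- 1) ^ n)) / (- ((- 1) ^ m)))"
  proof (rule qcong_divide)
    show "qcong p 3 (- 3 * (gam w * gam (1 - w))) (- 3 * (- ((- 1) ^ n)))"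
      using gam_reflect_residue[OF w n(1)[folded w_def]] n(2) p3
      by (intro qcong_lmult zloc_uminus zloc_numeral) simp
    show "qcong p 3 (gam a * gam (1 - a)) (- ((- 1) ^ m))"
      using gam_reflect_residue[OF a(1) m(1)] m(2) p3 by simp
    show "- 3 * (- ((- 1) ^ n)) \<in> zloc p"
      by (intro zloc_mult zloc_uminus zloc_neg_one_power zloc_numeral)
    show "gam a * gam (1 - a) \<in> zunit p" "- ((- 1) ^ m) \<in> zunit p"
      by (intro zunit_mult gam_zunit zunit_uminus zunit_power zunit_1)+
  qed
  also have "\<dots> = - 3 * (- 1) ^ (m + n)"
    by (simp add: power_add minus_one_power_iff)
  finally show ?thesis .
qed

lemma F_rat_3:
  "F_rat [a, b, c, e] = 1 + a * b * c * e + (a * (a + 1)) * (b * (b + 1)) * (c * (c + 1)) * (e * (e + 1)) / 16"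
proof -
  have "{0..p - 1} = {0, 1, 2 :: nat}"
    by (auto simp: p3)
  then show ?thesis
    by (simp add: F_rat_def numeral_2_eq_2 pochhammer_Suc mult_ac add.commute)
qed

text \<open>Multiplicativity on \<open>zmax\<close> fails here, but the gamma values at 0 and 1 / 2
  have fourth power 1 and the others combine to signs by reflection. This leaves \<open>num\<close>,
  a congruence of explicit rationals modulo 27.\<close>

lemma three_supercongruence_rat:
  assumes a: "a \<in> zloc p" "0 < a" "a < 1 / 2"
    and m: "a + of_nat m \<in> zmax" "m < 3" and n: "a + 1 / 2 + of_nat n \<in> zmax" "n < 3"
    and b: "b \<in> zloc p" "0 < b" "b < 1 / 2"
    and k: "b + of_nat k \<in> zmax" "k < 3" and l: "b + 1 / 2 + of_nat l \<in> zmax" "l < 3"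
    and num: "qcong p 3 (- 1 / 2 * (1 + 9 * (- 1) ^ (m + n + (k + l))))
       (F_rat [a, b, 1 - b, 1 - a] + 3 * (- 1) ^ (m + k))"
  shows "qcong p 3 (G_rat [a, b, 1 - b, 1 - a])
    (F_rat [a, b, 1 - b, 1 - a] + gam a * gam b * gam (1 - b) * gam (1 - a) * of_nat p)"
proof -
  define h where "h = (\<lambda>c. gam (frac (c - 1 / 2)) * inverse (gam c) * (- 3) ^ nat (- \<lfloor>c - 1 / 2\<rfloor>))"
  have half: "- 1 / 2 \<in> zloc p" "1 / 2 \<in> zloc p"
    using zlocI[of 2 "- 1"] zlocI[of 2 1] p3 by auto
  have "1 / 2 + of_nat 1 = of_nat p * (1 / 2 :: rat)"
    by (simp add: p3)
  then have "qcong p 3 (gam (1 / 2) * gam (1 - 1 / 2)) (- ((- 1) ^ 1))"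
    using half zmaxI[of "1 / 2"] p3 by (intro gam_reflect_residue) auto
  then have "qcong p 3 (gam (1 / 2) ^ 2) 1"
    by (simp add: power2_eq_square)
  then have "qcong p 3 ((gam (1 / 2) ^ 2) ^ 2) (1 ^ 2)"
    by (intro qcong_power) auto
  then have g4: "qcong p 3 (gam (1 / 2) ^ 4) 1"
    by simp
  have g0: "qcong p 3 (gam 0 ^ 4) 1"
    using qcong_power[OF gam_0, of 4] by simp
  have h: "qcong p 3 (h a * h (1 - a)) (- 3 * (- 1) ^ (m + n))" "qcong p 3 (h b * h (1 - b)) (- 3 * (- 1) ^ (k + l))"
    unfolding h_def using three_pair[OF a m n] three_pair[OF b k l] by auto
  have fl: "frac c = c" "\<lfloor>c\<rfloor> = 0" if "0 < c" "c < 1" for c :: rat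
    using that by (auto simp: frac_eq floor_eq_iff)
  have H0: "gam (frac c) * inverse (gam c) * (- 3) ^ nat (- \<lfloor>c\<rfloor>) = 1" if "0 < c" "c < 1" for c
    using fl[OF that] gam_zunit[of c, THEN zunit_nz] by simp
  define H where "H = (\<lambda>(j::nat) c. gam (frac (c - of_nat j / 2)) * inverse (gam c) * (- 3) ^ nat (- \<lfloor>c - of_nat j / 2\<rfloor>))"
  have "{0..p - 2} = {0, 1 :: nat}" "of_nat p - 1 = (2 :: rat)" "- of_nat p = (- 3 :: rat)"
    by (auto simp: p3)
  then have "G_rat [a, b, 1 - b, 1 - a] = - 1 / 2 * (\<Sum>j\<in>{0, 1}. ((- 1) ^ j * gam (of_nat j / 2)) ^ length [a, b, 1 - b, 1 - a]
      * (\<Prod>i<length [a, b, 1 - b, 1 - a]. H j ([a, b, 1 - b, 1 - a] ! i)))"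
    by (simp only: G_rat_def H_def)
  moreover have "(\<Prod>i<length [a, b, 1 - b, 1 - a]. f ([a, b, 1 - b, 1 - a] ! i)) = (f a * f (1 - a)) * (f b * f (1 - b))"
    for f :: "rat \<Rightarrow> rat"
    by (simp add: mult_ac)
  moreover have "H 0 c = 1" if "c \<in> {a, b, 1 - b, 1 - a}" for c
    using H0[of c] that a b by (auto simp: H_def)
  moreover have "H 1 = h"
    by (simp add: H_def h_def)
  ultimately have "G_rat [a, b, 1 - b, 1 - a] = - 1 / 2 * (gam 0 ^ 4 + gam (1 / 2) ^ 4 * ((h a * h (1 - a)) * (h b * h (1 - b))))"
    by (simp add: power4_eq_xxxx mult_ac)
  also have "qcong p 3 \<dots> (- 1 / 2 * (1 + 1 * ((- 3 * (- 1) ^ (m + n)) * (- 3 * (- 1) ^ (k + l)))))"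
  proof (intro qcong_lmult half qcong_add[OF g0] qcong_mult[OF g4] qcong_mult[OF h])
    show "- 3 * (- 1) ^ (m + n) \<in> zloc p"
      by (intro zloc_mult zloc_uminus zloc_neg_one_power zloc_numeral)
    have "h c \<in> zloc p" for c
      unfolding h_def using gam_zunit by (intro zloc_mult gam_zloc zloc_power zloc_uminus zloc_numeral) (simp add: zunit_def)
    then show "h b * h (1 - b) \<in> zloc p" "h a * h (1 - a) * (h b * h (1 - b)) \<in> zloc p"
      by (intro zloc_mult; blast)+
  qed simp
  also have "\<dots> = - 1 / 2 * (1 + 9 * (- 1) ^ (m + n + (k + l)))"
    by (simp add: power_add)
  also have "qcong p 3 \<dots> (F_rat [a, b, 1 - b, 1 - a] + 3 * (- 1) ^ (m + k))"
    by (rule num)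
  also have "\<dots> = F_rat [a, b, 1 - b, 1 - a] + 3 * ((- ((- 1) ^ m)) * (- ((- 1) ^ k)))"
    by (simp add: power_add)
  also have "qcong p 3 \<dots> (F_rat [a, b, 1 - b, 1 - a] + 3 * ((gam a * gam (1 - a)) * (gam b * gam (1 - b))))"
  proof -
    have ra: "qcong p 3 (gam a * gam (1 - a)) (- ((- 1) ^ m))"
      using gam_reflect_residue[OF a(1) m(1)] m(2) p3 by simp
    have rb: "qcong p 3 (gam b * gam (1 - b)) (- ((- 1) ^ k))"
      using gam_reflect_residue[OF b(1) k(1)] k(2) p3 by simp
    show ?thesis
      by (intro qcong_add[OF qcong_refl] qcong_lmult qcong_mult[OF qcong_sym[OF ra] qcong_sym[OF rb]]
          zloc_mult zloc_uminus zloc_neg_one_power gam_zloc zloc_numeral)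
  qed
  finally show ?thesis
    by (simp add: p3 mult_ac)
qed

lemma zloc_3I: "\<not> 3 dvd b \<Longrightarrow> of_int a / of_int b \<in> zloc p"
  using zlocI[of b a] coprime_p_iff[of b] p3 by auto

lemma zmax_3I: "x = 3 * (of_int a / of_int b) \<Longrightarrow> \<not> 3 dvd b \<Longrightarrow> x \<in> zmax"
  using zmaxI[OF zloc_3I[of b a]] by (simp add: p3)

lemma three_cases_rat:
  assumes "(d, y) \<in> {(5, 2), (8, 3), (10, 3 :: int)}"
  defines "a \<equiv> 1 / of_int d" and "b \<equiv> of_int y / of_int d"
  shows "qcong p 3 (G_rat [a, b, 1 - b, 1 - a])
    (F_rat [a, b, 1 - b, 1 - a] + gam a * gam b * gam (1 - b) * gam (1 - a) * of_nat p)"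
proof -
  consider "d = 5" "y = 2" | "d = 8" "y = 3" | "d = 10" "y = 3"
    using assms(1) by auto
  then show ?thesis
  proof cases
    case 1
    show ?thesis
    \<comment> \<open>The numbers are the residues modulo 3 of the negatives of a, a + 1 / 2, b and
      b + 1 / 2; likewise in the other two cases.\<close>
    proof (rule three_supercongruence_rat[of _ 1 2 _ 2 0])
      show "a + of_nat 1 \<in> zmax"
        by (rule zmax_3I[of _ 2 5]) (simp_all add: 1 a_def b_def)
      show "a + 1 / 2 + of_nat 2 \<in> zmax"
        by (rule zmax_3I[of _ 9 10]) (simp_all add: 1 a_def b_def)
      show "b + of_nat 2 \<in> zmax"
        by (rule zmax_3I[of _ 4 5]) (simp_all add: 1 a_def b_def)
      show "b + 1 / 2 + of_nat 0 \<in> zmax"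
        by (rule zmax_3I[of _ 3 10]) (simp_all add: 1 a_def b_def)
      show "a \<in> zloc p" "b \<in> zloc p"
        using zloc_3I[of 5 1] zloc_3I[of 5 2] by (simp_all add: 1 a_def b_def)
      show "qcong p 3 (- 1 / 2 * (1 + 9 * (- 1) ^ (1 + 2 + (2 + 0))))
          (F_rat [a, b, 1 - b, 1 - a] + 3 * (- 1) ^ (1 + 2))"
        unfolding F_rat_3 using zloc_3I[of 390625 86082]
        \<comment> \<open>The witness is the difference of the two sides divided by 27, a fraction
          whose denominator 5^8 is prime to 3.\<close>
        by (intro qcongI[of "86082 / 390625"]) (simp_all add: p3 1 a_def b_def)
    qed (simp_all add: 1 a_def b_def)
  next
    case 2
    show ?thesis
    proof (rule three_supercongruence_rat[of _ 1 2 _ 0 1])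
      show "a + of_nat 1 \<in> zmax"
        by (rule zmax_3I[of _ 3 8]) (simp_all add: 2 a_def b_def)
      show "a + 1 / 2 + of_nat 2 \<in> zmax"
        by (rule zmax_3I[of _ 7 8]) (simp_all add: 2 a_def b_def)
      show "b + of_nat 0 \<in> zmax"
        by (rule zmax_3I[of _ 1 8]) (simp_all add: 2 a_def b_def)
      show "b + 1 / 2 + of_nat 1 \<in> zmax"
        by (rule zmax_3I[of _ 5 8]) (simp_all add: 2 a_def b_def)
      show "a \<in> zloc p" "b \<in> zloc p"
        using zloc_3I[of 8 1] zloc_3I[of 8 3] by (simp_all add: 2 a_def b_def)
      show "qcong p 3 (- 1 / 2 * (1 + 9 * (- 1) ^ (1 + 2 + (0 + 1))))
          (F_rat [a, b, 1 - b, 1 - a] + 3 * (- 1) ^ (1 + 0))"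
        unfolding F_rat_3 using zloc_3I[of 268435456 "- 30156099"]
        by (intro qcongI[of "- 30156099 / 268435456"]) (simp_all add: p3 2 a_def b_def)
    qed (simp_all add: 2 a_def b_def)
  next
    case 3
    show ?thesis
    proof (rule three_supercongruence_rat[of _ 2 0 _ 0 1])
      show "a + of_nat 2 \<in> zmax"
        by (rule zmax_3I[of _ 7 10]) (simp_all add: 3 a_def b_def)
      show "a + 1 / 2 + of_nat 0 \<in> zmax"
        by (rule zmax_3I[of _ 1 5]) (simp_all add: 3 a_def b_def)
      show "b + of_nat 0 \<in> zmax"
        by (rule zmax_3I[of _ 1 10]) (simp_all add: 3 a_def b_def)
      show "b + 1 / 2 + of_nat 1 \<in> zmax"
        by (rule zmax_3I[of _ 3 5]) (simp_all add: 3 a_def b_def)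
      show "a \<in> zloc p" "b \<in> zloc p"
        using zloc_3I[of 10 1] zloc_3I[of 10 3] by (simp_all add: 3 a_def b_def)
      show "qcong p 3 (- 1 / 2 * (1 + 9 * (- 1) ^ (2 + 0 + (0 + 1))))
          (F_rat [a, b, 1 - b, 1 - a] + 3 * (- 1) ^ (2 + 0))"
        unfolding F_rat_3 using zloc_3I[of 1600000000 "- 1443323"]
        by (intro qcongI[of "- 1443323 / 1600000000"]) (simp_all add: p3 3 a_def b_def)
    qed (simp_all add: 3 a_def b_def)
  qed
qed

end

section \<open>The congruence classes of p modulo d\<close>

lemma G_rat_swap: "G_rat [a, b, c, e] = G_rat [a, c, b, e]"
  and F_rat_swap: "F_rat [a, b, c, e] = F_rat [a, c, b, e]"
  by (simp_all add: G_rat_def F_rat_def mult_ac)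

lemma supercongruence_rat_int:
  fixes r d :: int and \<pi> :: "nat \<Rightarrow> nat"
  defines "a \<equiv> (\<lambda>i::nat. [1, r, d - r, d - 1] ! i)"
  assumes p5: "p \<ge> 5" and r: "2 \<le> r" "r \<le> d - 2" and cop: "coprime d (int p)"
    and \<pi>: "\<And>i. i < 4 \<Longrightarrow> \<pi> i < 4" "inj_on \<pi> {..<4}" "\<And>i. i < 4 \<Longrightarrow> \<pi> (3 - i) = 3 - \<pi> i"
    and cong: "[int p * a (\<pi> 0) = 1] (mod d)" "[int p * a (\<pi> 1) = r] (mod d)"
    and edge: "int p * a (\<pi> 3) = d - 1 \<Longrightarrow> int p * a (\<pi> 1) = r \<or> int p * a (\<pi> 2) = d - r
      \<Longrightarrow> \<exists>i<4. int p * a (\<pi> i) \<noteq> a i \<and> int p dvd a (\<pi> i)"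
  defines "x \<equiv> 1 / of_int d" and "y \<equiv> of_int r / of_int d"
  shows "qcong p 3 (G_rat [x, y, 1 - y, 1 - x])
    (F_rat [x, y, 1 - y, 1 - x] + gam x * gam y * gam (1 - y) * gam (1 - x) * of_nat p)"
proof -
  interpret dwork_quadruple p "\<lambda>i. of_int (a i) / of_int d" "\<lambda>i. of_int (a (\<pi> i)) / of_int d"
    "\<lambda>i. nat ((int p * a (\<pi> i) - a i) div d)" \<pi>
    unfolding a_def using assms unfolding a_def by (intro dwork_quadruple_int) blast+
  have "of_int (a 0) / of_int d = x" "of_int (a 1) / of_int d = y"
    "of_int (a 2) / of_int d = 1 - y" "of_int (a 3) / of_int d = 1 - x"
    using r by (simp_all add: a_def x_def y_def field_simps)
  then show ?thesis
    using supercongruence_rat[OF p5] by simp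
qed

text \<open>The permutations of the classes 1, r, - r, - 1 modulo \<open>d\<close> induced by
  division by \<open>p\<close> in the six cases. They commute with negation, which is the map from i
  to 3 - i.\<close>

lemma perm_list_4:
  assumes "ps \<in> {[0, 1, 2, 3], [3, 2, 1, 0], [1, 0, 3, 2], [2, 0, 3, 1], [2, 3, 0, 1], [1, 3, 0, 2 :: nat]}"
  shows "i < 4 \<Longrightarrow> ps ! i < 4" and "inj_on (\<lambda>i. ps ! i) {..<4}" and "i < 4 \<Longrightarrow> ps ! (3 - i) = 3 - ps ! i"
proof -
  have four: "{..<4} = {0, 1, 2, 3 :: nat}"
    by auto
  show "inj_on (\<lambda>i. ps ! i) {..<4}"
    unfolding four using assms by auto
  show "i < 4 \<Longrightarrow> ps ! i < 4" "i < 4 \<Longrightarrow> ps ! (3 - i) = 3 - ps ! i"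
    using assms less_4_cases[of i] by auto
qed

text \<open>In each case multiplication by \<open>p\<close> preserves the classes 1, r, - r, - 1
  modulo \<open>d\<close>, which fixes the permutation. It remains to check \<open>edge\<close>,
  which concerns the coincidences where \<open>p\<close> times a numerator equals another numerator
  instead of being only congruent to it.\<close>

lemma supercongruence_rat_ge_5:
  fixes r d :: int
  assumes p5: "p \<ge> 5" and r: "2 \<le> r" "r \<le> d - 2" and cop: "coprime d (int p)"
    and hyp: "[int p = 1] (mod d) \<or> [int p = - 1] (mod d) \<or>
         (([int p = r] (mod d) \<or> [int p = - r] (mod d)) \<and>
          ([r ^ 2 = 1] (mod d) \<or> [r ^ 2 = - 1] (mod d)))"
  defines "x \<equiv> 1 / of_int d" and "y \<equiv> of_int r / of_int d"
  shows "qcong p 3 (G_rat [x, y, 1 - y, 1 - x])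
    (F_rat [x, y, 1 - y, 1 - x] + gam x * gam y * gam (1 - y) * gam (1 - x) * of_nat p)"
proof -
  let ?P = "int p"
  note step = supercongruence_rat_int[OF p5 r cop perm_list_4, folded x_def y_def]
  have P: "?P \<ge> 5"
    using p5 by simp
  \<comment> \<open>If r^2 is congruent to 1, a degenerate edge would need p = r or p = d - r and
    hence this equation, whose only solutions are r = 1 and r = d - 1.\<close>
  have no_quad: "r * (d - r) \<noteq> d - 1"
  proof
    assume "r * (d - r) = d - 1"
    then have "(r - 1) * (d - r - 1) = 0"
      by (simp add: algebra_simps)
    then show False
      using r by auto
  qed
  have big: "?P * (d - 1) > d - 1"
    using P r mult_strict_right_mono[of 1 ?P "d - 1"] by simp
  consider (1) "d dvd ?P - 1" | (2) "d dvd ?P + 1"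
    | (3) "d dvd ?P - r" "d dvd r * r - 1" | (4) "d dvd ?P - r" "d dvd r * r + 1"
    | (5) "d dvd ?P + r" "d dvd r * r - 1" | (6) "d dvd ?P + r" "d dvd r * r + 1"
    using hyp by (auto simp: cong_iff_dvd_diff power2_eq_square)
  then show ?thesis
  proof cases
    case 1
    have "[?P * 1 = 1] (mod d)" "[?P * r = r] (mod d)"
      using 1 dvd_mult2[OF 1, of r] by (simp_all add: cong_iff_dvd_diff algebra_simps)
    then show ?thesis
      using big by (intro step[of "[0, 1, 2, 3]"]) auto
  next
    case 2
    have "?P * (d - 1) - 1 = ?P * d - (?P + 1)" "?P * (d - r) - r = ?P * d - (?P + 1) * r"
      by (simp_all add: algebra_simps)
    then have "[?P * (d - 1) = 1] (mod d)" "[?P * (d - r) = r] (mod d)"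
      unfolding cong_iff_dvd_diff using 2 by (metis dvd_diff dvd_triv_right dvd_mult2)+
    moreover have False if e: "?P = d - 1" "?P * (d - r) = r \<or> ?P * r = d - r"
    proof -
      have "(d - 1) * (d - r) - r = d * (d - 1 - r)" "(d - 1) * r - (d - r) = d * (r - 1)"
        by (simp_all add: algebra_simps)
      then have "d * (d - 1 - r) = 0 \<or> d * (r - 1) = 0"
        using e by (metis diff_self)
      then show False
        using r by auto
    qed
    ultimately show ?thesis
      by (intro step[of "[3, 2, 1, 0]"]) auto
  next
    case 3
    have eq: "?P * r - 1 = (?P - r) * r + (r * r - 1)"
      by (simp add: algebra_simps)
    have "d dvd ?P * r - 1" "d dvd ?P * 1 - r"
      unfolding eq using 3 by (simp_all add: dvd_add)
    then have "[?P * r = 1] (mod d)" "[?P * 1 = r] (mod d)"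
      by (simp_all only: cong_iff_dvd_diff)
    moreover have "?P * (d - 1) \<noteq> d - r"
      using big r by linarith
    ultimately show ?thesis
      using no_quad by (intro step[of "[1, 0, 3, 2]"]) auto
  next
    case 4
    have eq: "?P * (d - r) - 1 = ?P * d - ((?P - r) * r + (r * r + 1))"
      by (simp add: algebra_simps)
    have "d dvd ?P * (d - r) - 1" "d dvd ?P * 1 - r"
      unfolding eq using 4 by (simp_all add: dvd_add dvd_diff)
    then have "[?P * (d - r) = 1] (mod d)" "[?P * 1 = r] (mod d)"
      by (simp_all only: cong_iff_dvd_diff)
    moreover have "?P * (d - 1) \<noteq> d - r"
      using big r by linarith
    \<comment> \<open>Here the degenerate edge does occur, for r = p and d = p^2 + 1. The missing
      factor \<open>p\<close> is then found in the numerator d - 1.\<close>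
    moreover have "?P dvd d - 1" if "?P * r = d - 1"
      by (metis that dvd_triv_left)
    ultimately show ?thesis
      by (intro step[of "[2, 0, 3, 1]"]) (auto intro!: exI[of _ 2])
  next
    case 5
    have eq: "?P * (d - r) - 1 = ?P * d - (?P + r) * r + (r * r - 1)" "?P * (d - 1) - r = ?P * d - (?P + r)"
      by (simp_all add: algebra_simps)
    have "d dvd ?P * (d - r) - 1" "d dvd ?P * (d - 1) - r"
      unfolding eq using 5 by (simp_all add: dvd_add dvd_diff)
    then have "[?P * (d - r) = 1] (mod d)" "[?P * (d - 1) = r] (mod d)"
      by (simp_all only: cong_iff_dvd_diff)
    moreover have "?P * (d - 1) \<noteq> r"
      using big r by linarith
    ultimately show ?thesis
      using no_quad by (intro step[of "[2, 3, 0, 1]"]) (auto simp: mult.commute)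
  next
    case 6
    have eq: "?P * r - 1 = (?P + r) * r - (r * r + 1)" "?P * (d - 1) - r = ?P * d - (?P + r)"
      by (simp_all add: algebra_simps)
    have "d dvd ?P * r - 1" "d dvd ?P * (d - 1) - r"
      unfolding eq using 6 by (simp_all add: dvd_add dvd_diff)
    then have "[?P * r = 1] (mod d)" "[?P * (d - 1) = r] (mod d)"
      by (simp_all only: cong_iff_dvd_diff)
    moreover have "?P * (d - 1) \<noteq> r"
      using big r by linarith
    moreover have "?P dvd d - 1" if "?P * (d - r) = d - 1"
      by (metis that dvd_triv_left)
    ultimately show ?thesis
      by (intro step[of "[1, 3, 0, 2]"]) (auto intro!: exI[of _ 1])
  qed
qed

text \<open>As \<open>d\<close> is at least 5, 3 is not congruent to 1 or - 1 modulo
  \<open>d\<close>. Hence r is 3 or d - 3, so r^2 is congruent to 9 and \<open>d\<close> divides 8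
  or 10. Exchanging \<open>r\<close> and \<open>d - r\<close> only permutes the parameters, which
  leaves three pairs.\<close>

lemma supercongruence_rat_3:
  fixes r d :: int
  assumes p3: "p = 3" and r: "2 \<le> r" "r \<le> d - 2" and gcd: "gcd r d = 1"
    and hyp: "[int p = 1] (mod d) \<or> [int p = - 1] (mod d) \<or>
         (([int p = r] (mod d) \<or> [int p = - r] (mod d)) \<and>
          ([r ^ 2 = 1] (mod d) \<or> [r ^ 2 = - 1] (mod d)))"
  defines "x \<equiv> 1 / of_int d" and "y \<equiv> of_int r / of_int d"
  shows "qcong p 3 (G_rat [x, y, 1 - y, 1 - x])
    (F_rat [x, y, 1 - y, 1 - x] + gam x * gam y * gam (1 - y) * gam (1 - x) * of_nat p)"
proof -
  have d5: "d \<ge> 5"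
  proof (rule ccontr)
    assume "\<not> d \<ge> 5"
    then have "d = 4" "r = 2"
      using r by auto
    then show False
      using gcd by simp
  qed
  have "\<not> d dvd 3 - 1" "\<not> d dvd 3 + 1"
    using d5 zdvd_imp_le[of d 2] zdvd_imp_le[of d 4] by auto
  then have h: "(d dvd 3 - r \<or> d dvd 3 + r) \<and> (d dvd r * r - 1 \<or> d dvd r * r + 1)"
    using hyp p3 by (auto simp: cong_iff_dvd_diff power2_eq_square)
  have r3: "r = 3 \<or> r = d - 3"
  proof (cases "d dvd 3 - r")
    case True
    then have "r = 3"
      using zdvd_imp_le[of d "r - 3"] zdvd_imp_le[of d "3 - r"] r d5
      by (cases "r > 3"; cases "r < 3") (auto simp: dvd_diff_commute)
    then show ?thesis ..
  next
    case False
    then obtain k where k: "3 + r = d * k"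
      using h by blast
    have "k = 1"
    proof (rule ccontr)
      assume "k \<noteq> 1"
      moreover have "k > 0"
        using k r d5 by (metis add_pos_nonneg zero_less_mult_pos zero_less_numeral order_trans
            less_le_trans zero_le_numeral)
      ultimately have "d * 2 \<le> d * k"
        using d5 by (intro mult_left_mono) auto
      then show False
        using k r d5 by linarith
    qed
    then show ?thesis
      using k by simp
  qed
  have "d dvd 8 \<or> d dvd 10"
  proof (cases "r = 3")
    case True
    then show ?thesis
      using h by auto
  next
    case False
    then have "r = d - 3"
      using r3 by simp
    have "r * r - 1 = d * (d - 6) + 8" "r * r + 1 = d * (d - 6) + 10"
      unfolding \<open>r = d - 3\<close> by (simp_all add: algebra_simps)
    then show ?thesis
      using h by (metis dvd_add_right_iff dvd_triv_left)
  qed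
  then have "d \<in> {5, 8, 10}"
  proof -
    have "d \<le> 10"
      using \<open>d dvd 8 \<or> d dvd 10\<close> zdvd_imp_le[of d 8] zdvd_imp_le[of d 10] by auto
    then have "d \<in> {5, 6, 7, 8, 9, 10}"
      using d5 by auto
    then show ?thesis
      using \<open>d dvd 8 \<or> d dvd 10\<close> by auto
  qed
  then consider "(d, r) \<in> {(5, 2), (8, 3), (10, 3)}" | "(d, d - r) \<in> {(5, 2), (8, 3), (10, 3)}"
    using r3 by auto
  then show ?thesis
  proof cases
    case 1
    then show ?thesis
      using three_cases_rat[OF p3 1] by (simp add: x_def y_def)
  next
    case 2
    have "of_int (d - r) / of_int d = 1 - y"
      using d5 by (simp add: y_def field_simps)
    then show ?thesis
      using three_cases_rat[OF p3 2] G_rat_swap[of x y] F_rat_swap[of x y] by (simp add: x_def mult_ac)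
  qed
qed

end

theorem theorem2p7:
  fixes r d :: int and p :: nat
  assumes "2 \<le> r" and "r \<le> d - 2" and "gcd r d = 1"
    and "prime p" and "odd p"
    and "[int p = 1] (mod d) \<or> [int p = - 1] (mod d) \<or>
         (([int p = r] (mod d) \<or> [int p = - r] (mod d)) \<and>
          ([r ^ 2 = 1] (mod d) \<or> [r ^ 2 = - 1] (mod d)))"
  shows
    "let R = padic_int p;
         \<Gamma> = (\<lambda>q::rat. padic_gamma p (padic_of_rat p q));
         s = \<Gamma> (1 / of_int d) \<otimes>\<^bsub>R\<^esub> \<Gamma> (of_int r / of_int d) \<otimes>\<^bsub>R\<^esub>
             \<Gamma> (of_int (d - r) / of_int d) \<otimes>\<^bsub>R\<^esub> \<Gamma> (of_int (d - 1) / of_int d);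
         as = [1 / of_int d, of_int r / of_int d, 1 - of_int r / of_int d, 1 - 1 / of_int d]
     in padic_cong p 3
          (padic_G p as)
          (padic_of_rat p (hypergeom_trunc as [1, 1, 1] 1 (p - 1))
             \<oplus>\<^bsub>R\<^esub> s \<otimes>\<^bsub>R\<^esub> padic_of_int p (int p))"
proof -
  interpret odd_prime p
    using assms by unfold_locales
  define x where "x = 1 / (of_int d :: rat)"
  define y where "y = of_int r / (of_int d :: rat)"
  have d: "d > 0"
    using assms by simp
  have xy: "of_int (d - r) / of_int d = 1 - y" "of_int (d - 1) / of_int d = 1 - x"
    using d by (simp_all add: x_def y_def field_simps)
  have "coprime r d"
    using assms by (simp add: coprime_iff_gcd_eq_1)
  then have "coprime (int p) d"
    using assms(6) by (metis cong_imp_coprime cong_sym coprime_1_left coprime_minus_left_iff)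
  then have cop: "coprime d (int p)"
    by (simp add: coprime_commute)
  then have du: "of_int d \<in> zunit p"
    using coprime_p_iff zunit_of_int by blast
  have "qcong p 3 (G_rat [x, y, 1 - y, 1 - x])
    (F_rat [x, y, 1 - y, 1 - x] + gam x * gam y * gam (1 - y) * gam (1 - x) * of_nat p)"
  proof (cases "p = 3")
    case True
    then show ?thesis
      unfolding x_def y_def using assms by (intro supercongruence_rat_3) auto
  next
    case False
    have "p \<noteq> 4"
      using assms by auto
    then have "p \<ge> 5"
      using False p_ge_3 by simp
    then show ?thesis
      unfolding x_def y_def using assms cop by (intro supercongruence_rat_ge_5) auto
  qed
  moreover have "a \<in> zloc p \<and> 0 < a \<and> a < 1" if "a \<in> {x, y, 1 - y, 1 - x}" for a
  proof -
    have "x \<in> zloc p" "y \<in> zloc p"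
      unfolding x_def y_def using du by auto
    moreover have "0 < x" "x < 1" "0 < y" "y < 1"
      using assms by (auto simp: x_def y_def)
    ultimately show ?thesis
      using that by auto
  qed
  ultimately show ?thesis
    unfolding Let_def xy x_def[symmetric] y_def[symmetric] by (intro supercongruence_of_rat)
qed

end
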